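(* Let $\mathbb K$ be an algebraically closed field of characteristic $3$ and let $\mathfrak g=\mathfrak{br}(3)=\mathfrak g(A)$ be the ($29$-dimensional) Brown Lie algebra with Cartan matrix $$A=\begin{pmatrix}2&-1&0\\-1&2&-1\\0&-1&0\end{pmatrix}$$ and with the basis $x_1,\dots,x_{13},y_1,\dots,y_{13},h_1,h_2,h_3$ described in the context. Then $H^2(\mathfrak g;\mathfrak g)$ is spanned by the classes of the following cocycles $c_{-18},c_{-9},c_{-6},c_{-3}$ together with the classes of the symmetric cocycles $\omega\cdot c_{-18},\ \omega\cdot c_{-9},\ \omega\cdot c_{-6},\ \omega\cdot c_{-3}$ of positive degree: $c_{-18}= 2y_{3}\otimes \hat x_{12}\wedge\hat x_{13} + 2y_{5}\otimes \hat x_{11}\wedge \hat x_{13} + 2y_{6}\otimes \hat x_{11}\wedge \hat x_{12} + y_{7}\otimes \hat x_{10}\wedge \hat x_{13} + y_{8}\otimes \hat x_{10}\wedge \hat x_{12} + y_{9}\otimes \hat x_{10}\wedge \hat x_{11} + 2y_{10}\otimes \hat x_{7}\wedge \hat x_{13} + y_{10}\otimes \hat x_{8}\wedge \hat x_{12} + 2y_{10}\otimes \hat x_{9}\wedge \hat x_{11} + 2y_{11}\otimes \hat x_{5}\wedge \hat x_{13} + y_{11}\otimes \hat x_{6}\wedge \hat x_{12} + 2y_{11}\otimes \hat x_{9}\wedge \hat x_{10} + 2y_{12}\otimes \hat x_{3}\wedge \hat x_{13} + y_{12}\otimes \hat x_{6}\wedge \hat x_{11} + 2y_{12}\otimes \hat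 x_{8}\wedge \hat x_{10} + 2y_{13}\otimes \hat x_{3}\wedge \hat x_{12} + y_{13}\otimes \hat x_{5}\wedge \hat x_{11} + 2y_{13}\otimes \hat x_{7}\wedge \hat x_{10}$; $c_{-9}= 2x_{3}\otimes \hat x_{1}\wedge \hat x_{13} + x_{5}\otimes \hat x_{4}\wedge \hat x_{13} + x_{7}\otimes \hat x_{6}\wedge \hat x_{13} + y_{1}\otimes \hat x_{4}\wedge \hat x_{10} + 2y_{1}\otimes \hat x_{6}\wedge \hat x_{9} + 2y_{1}\otimes \hat x_{13}\wedge \hat y_{3} + y_{4}\otimes \hat x_{1}\wedge \hat x_{10} + y_{4}\otimes \hat x_{6}\wedge \hat x_{8} + y_{4}\otimes \hat x_{13}\wedge \hat y_{5} + y_{6}\otimes \hat x_{1}\wedge \hat x_{9} + y_{6}\otimes \hat x_{4}\wedge \hat x_{8} + 2y_{6}\otimes \hat x_{13}\wedge \hat y_{7} + 2y_{8}\otimes \hat x_{4}\wedge \hat x_{6} + y_{9}\otimes \hat x_{1}\wedge \hat x_{6} + 2y_{10}\otimes \hat x_{1}\wedge \hat x_{4} + y_{13}\otimes \hat x_{1}\wedge \hat y_{3} + y_{13}\otimes \hat x_{4}\wedge \hat y_{5} + y_{13}\otimes \hat x_{6}\wedge \hat y_{7}$; $c_{-6}= 2x_{1}\otimes \hat x_{2}\wedge \hat x_{10} + 2x_{1}\otimes \hat x_{5}\wedge \hat x_{9} + 2x_{1}\otimes \hat x_{12}\wedge \hat y_{3} + x_{3}\otimes \hat x_{12}\wedge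 \hat y_{1} + 2x_{6}\otimes \hat x_{2}\wedge \hat x_{12} + x_{8}\otimes \hat x_{5}\wedge \hat x_{12} + 2y_{2}\otimes \hat x_{5}\wedge \hat x_{7} + 2y_{2}\otimes \hat x_{10}\wedge \hat y_{1} + 2y_{2}\otimes \hat x_{12}\wedge \hat y_{6} + 2y_{5}\otimes \hat x_{2}\wedge \hat x_{7} + y_{5}\otimes \hat x_{9}\wedge \hat y_{1} + 2y_{5}\otimes \hat x_{12}\wedge \hat y_{8} + y_{7}\otimes \hat x_{2}\wedge \hat x_{5} + 2y_{9}\otimes \hat x_{5}\wedge \hat y_{1} + 2y_{10}\otimes \hat x_{2}\wedge \hat y_{1} + 2y_{12}\otimes \hat x_{2}\wedge \hat y_{6} + y_{12}\otimes \hat x_{5}\wedge \hat y_{8} + 2y_{12}\otimes \hat y_{1}\wedge \hat y_{3}$; $c_{-3}= 2x_{2}\otimes \hat x_{3}\wedge \hat x_{7} + x_{2}\otimes \hat x_{10}\wedge \hat y_{4} + 2x_{2}\otimes \hat x_{11}\wedge \hat y_{6} + x_{4}\otimes \hat x_{3}\wedge \hat x_{8} + x_{4}\otimes \hat x_{10}\wedge \hat y_{2} + x_{4}\otimes \hat x_{11}\wedge \hat y_{5} + 2x_{5}\otimes \hat x_{11}\wedge \hat y_{4} + x_{6}\otimes \hat x_{11}\wedge \hat y_{2} + x_{9}\otimes \hat x_{3}\wedge \hat x_{11} + 2y_{3}\otimes \hat x_{7}\wedge \hat y_{2} + 2y_{3}\otimes \hat x_{8}\wedge \hat y_{4} + 2y_{3}\otimes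 \hat x_{11}\wedge \hat y_{9} + 2y_{7}\otimes \hat x_{3}\wedge \hat y_{2} + y_{8}\otimes \hat x_{3}\wedge \hat y_{4} + y_{10}\otimes \hat y_{2}\wedge \hat y_{4} + y_{11}\otimes \hat x_{3}\wedge \hat y_{9} + y_{11}\otimes \hat y_{2}\wedge \hat y_{6} + y_{11}\otimes \hat y_{4}\wedge \hat y_{5}$.
   Context: For an $n\times n$ matrix $A$ over $\mathbb K$, invertible, $\mathfrak g(A)$ is the quotient of the Lie algebra generated by $x_i,y_i,h_i$ ($1\le i\le n$) subject to $[x_i,y_j]=\delta_{ij}h_i$, $[h_i,h_j]=0$, $[h_i,x_j]=A_{ij}x_j$, $[h_i,y_j]=-A_{ij}y_j$, by the maximal ideal intersecting $\mathrm{Span}(h_1,\dots,h_n)$ trivially. (The matrix $A$ above is invertible over $\mathbb K$.) Positive basis elements of $\mathfrak{br}(3)$: generators $x_1,x_2,x_3$ and $x_4=[x_1,x_2]$, $x_5=[x_2,x_3]$, $x_6=[x_3,[x_1,x_2]]$, $x_7=[x_3,[x_2,x_3]]$, $x_8=[x_3,[x_3,[x_1,x_2]]]$, $x_9=[[x_2,x_3],[x_3,[x_1,x_2]]]$, $x_{10}=[[x_3,[x_1,x_2]],[x_3,[x_2,x_3]]]$, $x_{11}=[[x_3,[x_2,x_3]],[x_3,[x_3,[x_1,x_2]]]]$, $x_{12}=[[x_3,[x_2,x_3]],[[x_2,x_3],[x_3,[x_1,x_2]]]]$, $x_{13}=[[x_3,[x_3,[x_1,x_2]]],[[x_2,x_3],[x_3,[x_1,x_2]]]]$.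 The negative basis elements $y_k$ are given by the same brackets with $x$'s replaced by $y$'s. The degree is that of the principal grading: $\deg x_i=1$, $\deg y_i=-1$ for the generators; the index of a cocycle is its degree. $H^2(\mathfrak g;\mathfrak g)$ is Chevalley--Eilenberg cohomology with coefficients in the adjoint module. $\hat v$ denotes the element of the dual basis corresponding to the basis element $v$, and $u\otimes\hat v\wedge\hat w$ is the cochain $(X,Y)\mapsto(\hat v(X)\hat w(Y)-\hat v(Y)\hat w(X))u$. $\omega$ is the automorphism of $\mathfrak g$ with $x_i\mapsto -y_i$, $y_i\mapsto -x_i$, $h_i\mapsto -h_i$ for the generators, and $(\omega\cdot c)(X,Y)=\omega(c(\omega^{-1}X,\omega^{-1}Y))$.
   Formalization: The maximal ideal in the definition of g(A) is taken among ideals homogeneous for the principal grading; without homogeneity there is no largest ideal meeting Span(h_1,h_2,h_3) trivially, since deforming the bracket by c_{-18} gives another such ideal whose sum with the first contains h_3. *)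

theory Defs
  imports
    "HOL-Analysis.Analysis"
    "HOL-Library.Poly_Mapping"
    "HOL-Library.Function_Algebras"
    "HOL-Computational_Algebra.Computational_Algebra"
begin

section \<open>Lie algebras and their second adjoint cohomology\<close>

locale lie_algebra = vector_space scl
  for scl :: "'k::field \<Rightarrow> 'g::ab_group_add \<Rightarrow> 'g" +
  fixes br :: "'g \<Rightarrow> 'g \<Rightarrow> 'g"
  assumes br_add_left: "br (X + Y) Z = br X Z + br Y Z"
    and br_add_right: "br X (Y + Z) = br X Y + br X Z"
    and br_scl_left: "br (scl a X) Y = scl a (br X Y)"
    and br_scl_right: "br X (scl a Y) = scl a (br X Y)"
    and br_self: "br X X = 0"
    and jacobi: "br X (br Y Z) + br Y (br Z X) + br Z (br X Y) = 0"
begin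

definition lie_automorphism :: "('g \<Rightarrow> 'g) \<Rightarrow> bool" where
  "lie_automorphism f \<longleftrightarrow>
     Vector_Spaces.linear scl scl f \<and> bij f \<and> (\<forall>X Y. f (br X Y) = br (f X) (f Y))"

definition cochain1 :: "('g \<Rightarrow> 'g) set" where
  "cochain1 = {f. Vector_Spaces.linear scl scl f}"

definition cochain2 :: "('g \<Rightarrow> 'g \<Rightarrow> 'g) set" where
  "cochain2 = {c. (\<forall>X. Vector_Spaces.linear scl scl (c X)) \<and>
                  (\<forall>Y. Vector_Spaces.linear scl scl (\<lambda>X. c X Y)) \<and>
                  (\<forall>X. c X X = 0)}"

text \<open>The Chevalley--Eilenberg differentials with values in the adjoint module, in degrees 1 and 2.\<close>

definition d1 :: "('g \<Rightarrow> 'g) \<Rightarrow> 'g \<Rightarrow> 'g \<Rightarrow> 'g" where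
  "d1 f X Y = br X (f Y) - br Y (f X) - f (br X Y)"

definition d2 :: "('g \<Rightarrow> 'g \<Rightarrow> 'g) \<Rightarrow> 'g \<Rightarrow> 'g \<Rightarrow> 'g \<Rightarrow> 'g" where
  "d2 c X Y Z = br X (c Y Z) - br Y (c X Z) + br Z (c X Y)
              - c (br X Y) Z + c (br X Z) Y - c (br Y Z) X"

definition Z2 :: "('g \<Rightarrow> 'g \<Rightarrow> 'g) set" where
  "Z2 = {c \<in> cochain2. \<forall>X Y Z. d2 c X Y Z = 0}"

definition B2 :: "('g \<Rightarrow> 'g \<Rightarrow> 'g) set" where
  "B2 = d1 ` cochain1"

definition coh_class :: "('g \<Rightarrow> 'g \<Rightarrow> 'g) \<Rightarrow> ('g \<Rightarrow> 'g \<Rightarrow> 'g) set" where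
  "coh_class c = {c'. c' - c \<in> B2}"

definition H2 :: "('g \<Rightarrow> 'g \<Rightarrow> 'g) set set" where
  "H2 = coh_class ` Z2"

definition cochain_scl :: "'k \<Rightarrow> ('g \<Rightarrow> 'g \<Rightarrow> 'g) \<Rightarrow> 'g \<Rightarrow> 'g \<Rightarrow> 'g" where
  "cochain_scl a c = (\<lambda>X Y. scl a (c X Y))"

lemma vector_space_cochain_scl: "vector_space cochain_scl"
  by unfold_locales
    (auto simp: cochain_scl_def fun_eq_iff scale_right_distrib scale_left_distrib)

text \<open>The classes of the linear combinations of elements of \<open>S\<close>, that is, for cocycles,
  the span of their classes in the quotient space of cocycles by coboundaries.\<close>

definition class_span :: "('g \<Rightarrow> 'g \<Rightarrow> 'g) set \<Rightarrow> ('g \<Rightarrow> 'g \<Rightarrow> 'g) set set" where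
  "class_span S = coh_class ` module.span cochain_scl S"

end

definition act_cochain :: "('g \<Rightarrow> 'g) \<Rightarrow> ('g \<Rightarrow> 'g \<Rightarrow> 'g) \<Rightarrow> 'g \<Rightarrow> 'g \<Rightarrow> 'g" where
  "act_cochain f c X Y = f (c (inv f X) (inv f Y))"


section \<open>Lie algebras given by generators and relations\<close>

text \<open>A Lie algebra given by generators and relations is the free nonassociative algebra on the
  generators (finitely supported functions on nonassociative words) modulo the two-sided ideal
  generated by the Lie axioms and the relations.\<close>

datatype 'a word = Gen 'a | Br "'a word" "'a word"

type_synonym ('a, 'k) free_alg = "'a word \<Rightarrow>\<^sub>0 'k"

definition gen :: "'a \<Rightarrow> ('a, 'k::field) free_alg" where
  "gen a = Poly_Mapping.single (Gen a) 1"

definition fscl :: "'k::field \<Rightarrow> ('a, 'k) free_alg \<Rightarrow> ('a, 'k) free_alg" where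
  "fscl a p = Poly_Mapping.map ((*) a) p"

definition fbr :: "('a, 'k::field) free_alg \<Rightarrow> ('a, 'k) free_alg \<Rightarrow> ('a, 'k) free_alg" where
  "fbr p q = (\<Sum>u\<in>Poly_Mapping.keys p. \<Sum>v\<in>Poly_Mapping.keys q.
     Poly_Mapping.single (Br u v) (Poly_Mapping.lookup p u * Poly_Mapping.lookup q v))"

definition is_ideal :: "('a, 'k::field) free_alg set \<Rightarrow> bool" where
  "is_ideal I \<longleftrightarrow> module.subspace fscl I \<and> (\<forall>p. \<forall>q\<in>I. fbr p q \<in> I \<and> fbr q p \<in> I)"

definition ideal_gen :: "('a, 'k::field) free_alg set \<Rightarrow> ('a, 'k) free_alg set" where
  "ideal_gen S = \<Inter>{I. is_ideal I \<and> S \<subseteq> I}"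

definition presentation_ideal :: "('a, 'k::field) free_alg set \<Rightarrow> ('a, 'k) free_alg set" where
  "presentation_ideal R = ideal_gen
     (range (\<lambda>p. fbr p p) \<union>
      {fbr p (fbr q r) + fbr q (fbr r p) + fbr r (fbr p q) | p q r. True} \<union> R)"


section \<open>The Lie algebra of a matrix\<close>

datatype 'n chevalley = GX 'n | GY 'n | GH 'n

definition chevalley_relations ::
    "'k::field ^ 'n ^ 'n \<Rightarrow> ('n chevalley, 'k) free_alg set" where
  "chevalley_relations A =
     {fbr (gen (GX i)) (gen (GY j)) - (if i = j then gen (GH i) else 0) | i j. True} \<union>
     {fbr (gen (GH i)) (gen (GH j)) | i j. True} \<union>
     {fbr (gen (GH i)) (gen (GX j)) - fscl (A $ i $ j) (gen (GX j)) | i j. True} \<union>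
     {fbr (gen (GH i)) (gen (GY j)) - fscl (- (A $ i $ j)) (gen (GY j)) | i j. True}"

primrec word_degree :: "'n chevalley word \<Rightarrow> int" where
  "word_degree (Gen a) = (case a of GX i \<Rightarrow> 1 | GY i \<Rightarrow> - 1 | GH i \<Rightarrow> 0)"
| "word_degree (Br u v) = word_degree u + word_degree v"

definition hom_component ::
    "int \<Rightarrow> ('n chevalley, 'k::field) free_alg \<Rightarrow> ('n chevalley, 'k) free_alg" where
  "hom_component d p =
     (\<Sum>u\<in>{u \<in> Poly_Mapping.keys p. word_degree u = d}.
        Poly_Mapping.single u (Poly_Mapping.lookup p u))"

definition homogeneous :: "('n chevalley, 'k::field) free_alg set \<Rightarrow> bool" where
  "homogeneous I \<longleftrightarrow> (\<forall>p\<in>I. \<forall>d. hom_component d p \<in> I)"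

text \<open>Write \<open>R\<close> for \<^term>\<open>presentation_ideal (chevalley_relations A)\<close>. The ideals of the Lie
  algebra presented by the Chevalley relations are the \<open>I / R\<close> with \<open>I\<close> an ideal containing \<open>R\<close>,
  and \<open>I / R\<close> meets the span of the \<open>h\<^sub>i\<close> trivially iff every linear combination of the \<open>h\<^sub>i\<close>
  lying in \<open>I\<close> lies in \<open>R\<close>.

  The maximal such ideal has to be taken among the ideals that are homogeneous for the principal
  grading. The degree 0 part of the presented algebra is the span of the \<open>h\<^sub>i\<close>, so the sum of all
  homogeneous ideals meeting it trivially is again one, and is the largest. Without homogeneity
  there is in general no largest ideal in positive characteristic: for the matrix below in
  characteristic 3, adding \<open>c_m18\<close> to the bracket gives another Lie algebra generated by elements
  that satisfy the Chevalley relations and have independent \<open>h\<^sub>i\<close>, and the two kernels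
  together generate an ideal containing \<open>h\<^sub>3\<close>.\<close>

definition cartan_ideal :: "'k::field ^ 'n ^ 'n \<Rightarrow> ('n chevalley, 'k) free_alg set" where
  "cartan_ideal A =
     (let R = presentation_ideal (chevalley_relations A);
          hspan = module.span fscl (range (\<lambda>i. gen (GH i)))
      in module.span fscl
           (R \<union> \<Union>{I. is_ideal I \<and> homogeneous I \<and> R \<subseteq> I \<and> I \<inter> hspan \<subseteq> R}))"

lemma lookup_fscl [simp]: "Poly_Mapping.lookup (fscl a p) u = a * Poly_Mapping.lookup p u"
  by (simp add: fscl_def Poly_Mapping.map.rep_eq when_def)

lemma vector_space_fscl: "vector_space fscl"
  by unfold_locales
    (auto intro!: poly_mapping_eqI simp: lookup_add distrib_left distrib_right mult.assoc)

interpretation free: vector_space fscl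
  by (rule vector_space_fscl)

lemma fbr_superset:
  assumes "finite A" "finite B" "Poly_Mapping.keys p \<subseteq> A" "Poly_Mapping.keys q \<subseteq> B"
  shows "fbr p q = (\<Sum>u\<in>A. \<Sum>v\<in>B.
     Poly_Mapping.single (Br u v) (Poly_Mapping.lookup p u * Poly_Mapping.lookup q v))"
proof -
  have "fbr p q = (\<Sum>u\<in>Poly_Mapping.keys p. \<Sum>v\<in>B.
     Poly_Mapping.single (Br u v) (Poly_Mapping.lookup p u * Poly_Mapping.lookup q v))"
    unfolding fbr_def using assms
    by (intro sum.cong refl sum.mono_neutral_left) (auto simp: in_keys_iff)
  also have "\<dots> = (\<Sum>u\<in>A. \<Sum>v\<in>B.
     Poly_Mapping.single (Br u v) (Poly_Mapping.lookup p u * Poly_Mapping.lookup q v))"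
    using assms by (intro sum.mono_neutral_left) (auto simp: in_keys_iff)
  finally show ?thesis .
qed

lemma fbr_add_left: "fbr (p + q) r = fbr p r + fbr q r"
proof -
  let ?A = "Poly_Mapping.keys p \<union> Poly_Mapping.keys q"
  have "Poly_Mapping.keys (p + q) \<subseteq> ?A" by (rule Poly_Mapping.keys_add)
  then show ?thesis
    by (simp add: fbr_superset[of ?A "Poly_Mapping.keys r"] lookup_add distrib_right
        single_add sum.distrib)
qed

lemma fbr_add_right: "fbr r (p + q) = fbr r p + fbr r q"
proof -
  let ?A = "Poly_Mapping.keys p \<union> Poly_Mapping.keys q"
  have "Poly_Mapping.keys (p + q) \<subseteq> ?A" by (rule Poly_Mapping.keys_add)
  then show ?thesis
    by (simp add: fbr_superset[of "Poly_Mapping.keys r" ?A] lookup_add distrib_left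
        single_add sum.distrib)
qed

lemma fscl_single: "fscl a (Poly_Mapping.single u b) = Poly_Mapping.single u (a * b)"
  by (auto intro!: poly_mapping_eqI simp: lookup_single when_def)

lemma keys_fscl: "Poly_Mapping.keys (fscl a p) \<subseteq> Poly_Mapping.keys p"
  by (auto simp: in_keys_iff)

lemma fbr_fscl_left: "fbr (fscl a p) q = fscl a (fbr p q)"
  by (simp add: fbr_superset[OF _ _ keys_fscl order_refl] fbr_def[of p q] free.scale_sum_right
      fscl_single mult.assoc)

lemma fbr_fscl_right: "fbr p (fscl a q) = fscl a (fbr p q)"
  by (simp add: fbr_superset[OF _ _ order_refl keys_fscl] fbr_def[of p q] free.scale_sum_right
      fscl_single mult.left_commute)

lemma fbr_diff_left: "fbr (p - q) r = fbr p r - fbr q r"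
  using fbr_add_left[of "p - q" q r] by (simp add: algebra_simps)

lemma fbr_diff_right: "fbr r (p - q) = fbr r p - fbr r q"
  using fbr_add_right[of r "p - q" q] by (simp add: algebra_simps)

lemma fbr_zero_left [simp]: "fbr 0 p = 0"
  using fbr_add_left[of 0 0 p] by simp

lemma fbr_zero_right [simp]: "fbr p 0 = 0"
  using fbr_add_right[of p 0 0] by simp

lemma is_ideal_ideal_gen: "is_ideal (ideal_gen S)"
  unfolding is_ideal_def ideal_gen_def
  by (auto simp: free.subspace_def)

lemma is_ideal_span:
  assumes "\<And>p q. q \<in> S \<Longrightarrow> fbr p q \<in> S \<and> fbr q p \<in> S"
  shows "is_ideal (free.span S)"
proof -
  have "fbr p q \<in> free.span S \<and> fbr q p \<in> free.span S" if "q \<in> free.span S" for p q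
    using that
  proof (induction rule: free.span_induct_alt)
    case base
    show ?case by (simp add: free.span_zero)
  next
    case (step c x y)
    then have "fbr p x \<in> free.span S" "fbr x p \<in> free.span S"
      using assms[of x p] by (auto intro: free.span_base)
    then show ?case
      using step.IH
      by (simp add: fbr_add_left fbr_add_right fbr_fscl_left fbr_fscl_right
          free.span_add free.span_scale)
  qed
  then show ?thesis
    by (simp add: is_ideal_def)
qed

lemma is_ideal_cartan_ideal:
  fixes A :: "'b::field ^ 'a ^ 'a"
  shows "is_ideal (cartan_ideal A)"
  unfolding cartan_ideal_def Let_def
proof (rule is_ideal_span)
  fix p q :: "('a chevalley, 'b) free_alg"
  let ?R = "presentation_ideal (chevalley_relations A)"
  let ?M = "{I. is_ideal I \<and> homogeneous I \<and> ?R \<subseteq> I \<and>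
               I \<inter> free.span (range (\<lambda>i. gen (GH i))) \<subseteq> ?R}"
  assume "q \<in> ?R \<union> \<Union>?M"
  then obtain I where I: "q \<in> I" "is_ideal I" "I = ?R \<or> I \<in> ?M"
    using is_ideal_ideal_gen unfolding presentation_ideal_def by blast
  then have "fbr p q \<in> I" "fbr q p \<in> I"
    by (simp_all add: is_ideal_def)
  with I(3) show "fbr p q \<in> ?R \<union> \<Union>?M \<and> fbr q p \<in> ?R \<union> \<Union>?M"
    by blast
qed

lemma presentation_subset_cartan_ideal:
  "presentation_ideal (chevalley_relations A) \<subseteq> cartan_ideal A"
  unfolding cartan_ideal_def Let_def using free.span_superset by blast

lemma fbr_self_in_cartan_ideal: "fbr p p \<in> cartan_ideal A"
  using presentation_subset_cartan_ideal[of A]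
  unfolding presentation_ideal_def ideal_gen_def by blast

lemma jacobi_in_cartan_ideal:
  "fbr p (fbr q r) + fbr q (fbr r p) + fbr r (fbr p q) \<in> cartan_ideal A"
  using presentation_subset_cartan_ideal[of A]
  unfolding presentation_ideal_def ideal_gen_def by blast

definition cartan_rel ::
    "'k::field ^ 'n ^ 'n \<Rightarrow> ('n chevalley, 'k) free_alg \<Rightarrow> ('n chevalley, 'k) free_alg \<Rightarrow> bool" where
  "cartan_rel A p q \<longleftrightarrow> p - q \<in> cartan_ideal A"

lemma subspace_cartan_ideal: "free.subspace (cartan_ideal A)"
  using is_ideal_cartan_ideal[of A] by (simp add: is_ideal_def)

lemma equivp_cartan_rel: "equivp (cartan_rel A)"
proof (rule equivpI)
  note s = subspace_cartan_ideal[of A]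
  show "reflp (cartan_rel A)"
    using free.subspace_0[OF s] by (simp add: reflp_def cartan_rel_def)
  show "symp (cartan_rel A)"
  proof (rule sympI)
    fix p q assume "cartan_rel A p q"
    then show "cartan_rel A q p"
      using free.subspace_neg[OF s, of "p - q"] by (simp add: cartan_rel_def)
  qed
  show "transp (cartan_rel A)"
  proof (rule transpI)
    fix p q r assume "cartan_rel A p q" "cartan_rel A q r"
    then show "cartan_rel A p r"
      using free.subspace_add[OF s, of "p - q" "q - r"] by (simp add: cartan_rel_def)
  qed
qed

lemma cartan_rel_refl: "cartan_rel A p p"
  using equivp_cartan_rel by (rule equivp_reflp)

lemma cartan_rel_add:
  assumes "cartan_rel A p p'" "cartan_rel A q q'"
  shows "cartan_rel A (p + q) (p' + q')"
  using assms free.subspace_add[OF subspace_cartan_ideal[of A], of "p - p'" "q - q'"]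
  by (simp add: cartan_rel_def add_diff_add)

lemma cartan_rel_scl: "cartan_rel A p p' \<Longrightarrow> cartan_rel A (fscl a p) (fscl a p')"
  using free.subspace_scale[OF subspace_cartan_ideal[of A], of "p - p'" a]
  by (simp add: cartan_rel_def free.scale_right_diff_distrib)

lemma cartan_rel_uminus: "cartan_rel A p p' \<Longrightarrow> cartan_rel A (- p) (- p')"
  using cartan_rel_scl[of A p p' "- 1"] by simp

lemma cartan_rel_diff:
  assumes "cartan_rel A p p'" "cartan_rel A q q'"
  shows "cartan_rel A (p - q) (p' - q')"
  using cartan_rel_add[OF assms(1) cartan_rel_uminus[OF assms(2)]] by simp

lemma cartan_rel_fbr:
  assumes "cartan_rel A p p'" "cartan_rel A q q'"
  shows "cartan_rel A (fbr p q) (fbr p' q')"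
proof -
  have "fbr (p - p') q + fbr p' (q - q') \<in> cartan_ideal A"
    using assms is_ideal_cartan_ideal[of A]
    by (intro free.subspace_add[OF subspace_cartan_ideal]) (simp_all add: cartan_rel_def is_ideal_def)
  then show ?thesis
    by (simp add: cartan_rel_def fbr_diff_left fbr_diff_right)
qed


section \<open>The Brown algebra\<close>

text \<open>The index type \<^typ>\<open>3\<close> has the elements 1, 2 and 3 (the latter being equal to 0).\<close>

definition br3_cartan :: "'k::field ^ 3 ^ 3" where
  "br3_cartan = vector [vector [ 2, -1,  0],
                        vector [-1,  2, -1],
                        vector [ 0, -1,  0]]"

lemma invertible_br3_cartan:
  assumes "CHAR('k::field) = 3"
  shows "invertible (br3_cartan :: 'k ^ 3 ^ 3)"
proof -
  have "(3 :: 'k) = 0"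
    using of_nat_CHAR[where ?'a = 'k] assms by simp
  then have "(2 :: 'k) + 1 = 0"
    by simp
  then have "(2 :: 'k) \<noteq> 0"
    by (metis add.left_neutral zero_neq_one)
  then show ?thesis
    by (simp add: invertible_det_nz det_3 br3_cartan_def)
qed

quotient_type (overloaded) 'k br3 =
  "(3 chevalley, 'k::field) free_alg" / "cartan_rel (br3_cartan :: 'k ^ 3 ^ 3)"
  by (rule equivp_cartan_rel)

instantiation br3 :: (field) ab_group_add
begin

lift_definition zero_br3 :: "'a br3" is 0 .

lift_definition plus_br3 :: "'a br3 \<Rightarrow> 'a br3 \<Rightarrow> 'a br3" is "(+)"
  by (rule cartan_rel_add)

lift_definition uminus_br3 :: "'a br3 \<Rightarrow> 'a br3" is "uminus"
  by (rule cartan_rel_uminus)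

lift_definition minus_br3 :: "'a br3 \<Rightarrow> 'a br3 \<Rightarrow> 'a br3" is "(-)"
  by (rule cartan_rel_diff)

instance
  by standard (transfer, simp add: cartan_rel_refl algebra_simps)+

end

lift_definition br3_scl :: "'k::field \<Rightarrow> 'k br3 \<Rightarrow> 'k br3" is fscl
  by (rule cartan_rel_scl)

lift_definition br3_br :: "'k::field br3 \<Rightarrow> 'k br3 \<Rightarrow> 'k br3" is fbr
  by (rule cartan_rel_fbr)

global_interpretation br3: lie_algebra br3_scl br3_br
proof
  fix a b :: "'k::field" and X Y Z :: "'k br3"
  show "br3_scl a (X + Y) = br3_scl a X + br3_scl a Y"
    by transfer (simp add: cartan_rel_refl free.scale_right_distrib)
  show "br3_scl (a + b) X = br3_scl a X + br3_scl b X"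
    by transfer (simp add: cartan_rel_refl free.scale_left_distrib)
  show "br3_scl a (br3_scl b X) = br3_scl (a * b) X"
    by transfer (simp add: cartan_rel_refl)
  show "br3_scl 1 X = X"
    by transfer (simp add: cartan_rel_refl)
  show "br3_br (X + Y) Z = br3_br X Z + br3_br Y Z"
    by transfer (simp add: cartan_rel_refl fbr_add_left)
  show "br3_br X (Y + Z) = br3_br X Y + br3_br X Z"
    by transfer (simp add: cartan_rel_refl fbr_add_right)
  show "br3_br (br3_scl a X) Y = br3_scl a (br3_br X Y)"
    by transfer (simp add: cartan_rel_refl fbr_fscl_left)
  show "br3_br X (br3_scl a Y) = br3_scl a (br3_br X Y)"
    by transfer (simp add: cartan_rel_refl fbr_fscl_right)
  show "br3_br X X = 0"
    by transfer (simp add: cartan_rel_def fbr_self_in_cartan_ideal)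
  show "br3_br X (br3_br Y Z) + br3_br Y (br3_br Z X) + br3_br Z (br3_br X Y) = 0"
    by transfer (simp add: cartan_rel_def jacobi_in_cartan_ideal)
qed

lift_definition br3_gen :: "3 chevalley \<Rightarrow> 'k::field br3" is gen .

definition br3_h :: "3 \<Rightarrow> 'k::field br3" where
  "br3_h i = br3_gen (GH i)"

definition root_vectors :: "'k::field br3 \<Rightarrow> 'k br3 \<Rightarrow> 'k br3 \<Rightarrow> 'k br3 list" where
  "root_vectors u1 u2 u3 =
     (let u4 = br3_br u1 u2;
          u5 = br3_br u2 u3;
          u6 = br3_br u3 u4;
          u7 = br3_br u3 u5;
          u8 = br3_br u3 u6;
          u9 = br3_br u5 u6;
          u10 = br3_br u6 u7;
          u11 = br3_br u7 u8;
          u12 = br3_br u7 u9;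
          u13 = br3_br u8 u9
      in [u1, u2, u3, u4, u5, u6, u7, u8, u9, u10, u11, u12, u13])"

text \<open>Both families are indexed by 1 to 13.\<close>

definition br3_x :: "nat \<Rightarrow> 'k::field br3" where
  "br3_x k = root_vectors (br3_gen (GX 1)) (br3_gen (GX 2)) (br3_gen (GX 3)) ! (k - 1)"

definition br3_y :: "nat \<Rightarrow> 'k::field br3" where
  "br3_y k = root_vectors (br3_gen (GY 1)) (br3_gen (GY 2)) (br3_gen (GY 3)) ! (k - 1)"

definition br3_basis :: "'k::field br3 list" where
  "br3_basis = map br3_x [1..<14] @ map br3_y [1..<14] @ [br3_h 1, br3_h 2, br3_h 3]"

definition hat :: "'k::field br3 \<Rightarrow> 'k br3 \<Rightarrow> 'k" where
  "hat v X = br3.representation (set br3_basis) X v"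

text \<open>\<open>wedge_term a u v w\<close> is the cochain \<open>a u \<otimes> v\<^sup>* \<and> w\<^sup>*\<close>, for \<open>v\<close> and \<open>w\<close> in the basis.\<close>

definition wedge_term ::
    "'k::field \<Rightarrow> 'k br3 \<Rightarrow> 'k br3 \<Rightarrow> 'k br3 \<Rightarrow> 'k br3 \<Rightarrow> 'k br3 \<Rightarrow> 'k br3" where
  "wedge_term a u v w = (\<lambda>X Y. br3_scl (a * (hat v X * hat w Y - hat v Y * hat w X)) u)"

text \<open>The index \<open>mn\<close> stands for the degree \<open>-n\<close>; sums are pointwise sums of functions.\<close>

definition c_m18 :: "'k::field br3 \<Rightarrow> 'k br3 \<Rightarrow> 'k br3" where
  "c_m18 =
     wedge_term 2 (br3_y 3) (br3_x 12) (br3_x 13) +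
     wedge_term 2 (br3_y 5) (br3_x 11) (br3_x 13) +
     wedge_term 2 (br3_y 6) (br3_x 11) (br3_x 12) +
     wedge_term 1 (br3_y 7) (br3_x 10) (br3_x 13) +
     wedge_term 1 (br3_y 8) (br3_x 10) (br3_x 12) +
     wedge_term 1 (br3_y 9) (br3_x 10) (br3_x 11) +
     wedge_term 2 (br3_y 10) (br3_x 7) (br3_x 13) +
     wedge_term 1 (br3_y 10) (br3_x 8) (br3_x 12) +
     wedge_term 2 (br3_y 10) (br3_x 9) (br3_x 11) +
     wedge_term 2 (br3_y 11) (br3_x 5) (br3_x 13) +
     wedge_term 1 (br3_y 11) (br3_x 6) (br3_x 12) +
     wedge_term 2 (br3_y 11) (br3_x 9) (br3_x 10) +
     wedge_term 2 (br3_y 12) (br3_x 3) (br3_x 13) +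
     wedge_term 1 (br3_y 12) (br3_x 6) (br3_x 11) +
     wedge_term 2 (br3_y 12) (br3_x 8) (br3_x 10) +
     wedge_term 2 (br3_y 13) (br3_x 3) (br3_x 12) +
     wedge_term 1 (br3_y 13) (br3_x 5) (br3_x 11) +
     wedge_term 2 (br3_y 13) (br3_x 7) (br3_x 10)"

definition c_m9 :: "'k::field br3 \<Rightarrow> 'k br3 \<Rightarrow> 'k br3" where
  "c_m9 =
     wedge_term 2 (br3_x 3) (br3_x 1) (br3_x 13) +
     wedge_term 1 (br3_x 5) (br3_x 4) (br3_x 13) +
     wedge_term 1 (br3_x 7) (br3_x 6) (br3_x 13) +
     wedge_term 1 (br3_y 1) (br3_x 4) (br3_x 10) +
     wedge_term 2 (br3_y 1) (br3_x 6) (br3_x 9) +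
     wedge_term 2 (br3_y 1) (br3_x 13) (br3_y 3) +
     wedge_term 1 (br3_y 4) (br3_x 1) (br3_x 10) +
     wedge_term 1 (br3_y 4) (br3_x 6) (br3_x 8) +
     wedge_term 1 (br3_y 4) (br3_x 13) (br3_y 5) +
     wedge_term 1 (br3_y 6) (br3_x 1) (br3_x 9) +
     wedge_term 1 (br3_y 6) (br3_x 4) (br3_x 8) +
     wedge_term 2 (br3_y 6) (br3_x 13) (br3_y 7) +
     wedge_term 2 (br3_y 8) (br3_x 4) (br3_x 6) +
     wedge_term 1 (br3_y 9) (br3_x 1) (br3_x 6) +
     wedge_term 2 (br3_y 10) (br3_x 1) (br3_x 4) +
     wedge_term 1 (br3_y 13) (br3_x 1) (br3_y 3) +
     wedge_term 1 (br3_y 13) (br3_x 4) (br3_y 5) +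
     wedge_term 1 (br3_y 13) (br3_x 6) (br3_y 7)"

definition c_m6 :: "'k::field br3 \<Rightarrow> 'k br3 \<Rightarrow> 'k br3" where
  "c_m6 =
     wedge_term 2 (br3_x 1) (br3_x 2) (br3_x 10) +
     wedge_term 2 (br3_x 1) (br3_x 5) (br3_x 9) +
     wedge_term 2 (br3_x 1) (br3_x 12) (br3_y 3) +
     wedge_term 1 (br3_x 3) (br3_x 12) (br3_y 1) +
     wedge_term 2 (br3_x 6) (br3_x 2) (br3_x 12) +
     wedge_term 1 (br3_x 8) (br3_x 5) (br3_x 12) +
     wedge_term 2 (br3_y 2) (br3_x 5) (br3_x 7) +
     wedge_term 2 (br3_y 2) (br3_x 10) (br3_y 1) +
     wedge_term 2 (br3_y 2) (br3_x 12) (br3_y 6) +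
     wedge_term 2 (br3_y 5) (br3_x 2) (br3_x 7) +
     wedge_term 1 (br3_y 5) (br3_x 9) (br3_y 1) +
     wedge_term 2 (br3_y 5) (br3_x 12) (br3_y 8) +
     wedge_term 1 (br3_y 7) (br3_x 2) (br3_x 5) +
     wedge_term 2 (br3_y 9) (br3_x 5) (br3_y 1) +
     wedge_term 2 (br3_y 10) (br3_x 2) (br3_y 1) +
     wedge_term 2 (br3_y 12) (br3_x 2) (br3_y 6) +
     wedge_term 1 (br3_y 12) (br3_x 5) (br3_y 8) +
     wedge_term 2 (br3_y 12) (br3_y 1) (br3_y 3)"

definition c_m3 :: "'k::field br3 \<Rightarrow> 'k br3 \<Rightarrow> 'k br3" where
  "c_m3 =
     wedge_term 2 (br3_x 2) (br3_x 3) (br3_x 7) +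
     wedge_term 1 (br3_x 2) (br3_x 10) (br3_y 4) +
     wedge_term 2 (br3_x 2) (br3_x 11) (br3_y 6) +
     wedge_term 1 (br3_x 4) (br3_x 3) (br3_x 8) +
     wedge_term 1 (br3_x 4) (br3_x 10) (br3_y 2) +
     wedge_term 1 (br3_x 4) (br3_x 11) (br3_y 5) +
     wedge_term 2 (br3_x 5) (br3_x 11) (br3_y 4) +
     wedge_term 1 (br3_x 6) (br3_x 11) (br3_y 2) +
     wedge_term 1 (br3_x 9) (br3_x 3) (br3_x 11) +
     wedge_term 2 (br3_y 3) (br3_x 7) (br3_y 2) +
     wedge_term 2 (br3_y 3) (br3_x 8) (br3_y 4) +
     wedge_term 2 (br3_y 3) (br3_x 11) (br3_y 9) +
     wedge_term 2 (br3_y 7) (br3_x 3) (br3_y 2) +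
     wedge_term 1 (br3_y 8) (br3_x 3) (br3_y 4) +
     wedge_term 1 (br3_y 10) (br3_y 2) (br3_y 4) +
     wedge_term 1 (br3_y 11) (br3_x 3) (br3_y 9) +
     wedge_term 1 (br3_y 11) (br3_y 2) (br3_y 6) +
     wedge_term 1 (br3_y 11) (br3_y 4) (br3_y 5)"

definition br3_omega :: "'k::field br3 \<Rightarrow> 'k br3" where
  "br3_omega = (THE f. br3.lie_automorphism f \<and>
     (\<forall>i. f (br3_gen (GX i)) = - br3_gen (GY i) \<and>
          f (br3_gen (GY i)) = - br3_gen (GX i) \<and>
          f (br3_gen (GH i)) = - br3_gen (GH i)))"

end

theory Submission
  imports Defs
begin

text \<open>
  The algebra given by generators, relations and a maximal ideal is first identified with an explicit
  algebra of dimension 29, whose cocycle equations are then solved.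

  Expanding the nested brackets that define the \<open>x\<^sub>k\<close> and \<open>y\<^sub>k\<close> leads to a table of
  structure constants in the prime field. The bracket on \<open>K\<^sup>2\<^sup>9\<close> with this table is a Lie bracket in
  which the Chevalley relations hold, so the free algebra maps onto it. The kernel of this map is a
  homogeneous ideal that meets the span of the \<open>h\<^sub>i\<close> trivially, hence is contained in the Cartan ideal.
  For the converse, let \<open>I\<close> be one of the ideals whose sum is the Cartan ideal. By the triangular
  decomposition (\<open>degree_0_cartan_mod_rels\<close>), an element of degree 0 is a combination of the \<open>h\<^sub>i\<close>
  modulo the relations, so an element of degree 0 in \<open>I\<close> is mapped to zero. An element of the table
  algebra of degree \<open>d \<noteq> 0\<close> vanishes as soon as its brackets with all generators that bring the degree
  nearer to 0 vanish (\<open>separator_exists\<close>), and induction on \<open>\<bar>d\<bar>\<close> shows that \<open>I\<close> is mapped to zero. The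
  resulting equality \<open>cartan_ideal_br3\<close> provides coordinates on the Brown algebra.

  For the cohomology, let \<open>h\<close> be one of the \<open>h\<^sub>i\<close>. The Lie derivative \<open>L\<^sub>h c\<close> of a cocycle
  \<open>c\<close> is a coboundary. On each coordinate of \<open>c\<close>, \<open>L\<^sub>h\<close> is multiplication by an element \<open>x\<close> of the prime field,
  and \<open>1 - x\<^sup>2\<close> is 1 for \<open>x = 0\<close> and 0 otherwise. So \<open>c - L\<^sub>h (L\<^sub>h c)\<close> is cohomologous to \<open>c\<close> and retains
  exactly the coordinates on which \<open>h\<close> acts by 0. The 26 roots of the algebra have distinct nonzero
  weights under \<open>h\<^sub>1, h\<^sub>2, h\<^sub>3\<close>, and only 438 coordinates, up to the order of the arguments, have
  weight 0.
  Subtraction of a coboundary annihilates 32 of these (\<open>coboundary_normalization\<close>), subtraction of a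
  combination of the eight given cocycles annihilates eight more, and the cocycle equations force
  the other 398 to vanish: they can be taken in an order in which each of them is the only
  coordinate in some cocycle equation that is not yet known to vanish
  (\<open>weight_zero_cocycle_vanishes\<close>). Hence every cocycle is a coboundary plus a combination of the eight.

  All tables have their coefficients in the prime field. The Jacobi identity, the cocycle conditions
  and the triangular elimination thus are finite computations in the field with three elements.
\<close>


section \<open>The prime field\<close>

text \<open>The elements 0, 1 and -1 of the prime field, as constructors on which rewriting can compute.\<close>

datatype trit = Zero | Pos | Neg

primrec trit_neg :: "trit \<Rightarrow> trit" where
  "trit_neg Zero = Zero"
| "trit_neg Pos = Neg"
| "trit_neg Neg = Pos"

primrec trit_add :: "trit \<Rightarrow> trit \<Rightarrow> trit" where
  "trit_add Zero t = t"
| "trit_add Pos t = (case t of Zero \<Rightarrow> Pos | Pos \<Rightarrow> Neg | Neg \<Rightarrow> Zero)"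
| "trit_add Neg t = (case t of Zero \<Rightarrow> Neg | Pos \<Rightarrow> Zero | Neg \<Rightarrow> Pos)"

primrec trit_mult :: "trit \<Rightarrow> trit \<Rightarrow> trit" where
  "trit_mult Zero t = Zero"
| "trit_mult Pos t = t"
| "trit_mult Neg t = trit_neg t"

primrec tval :: "trit \<Rightarrow> 'k::field" where
  "tval Zero = 0"
| "tval Pos = 1"
| "tval Neg = - 1"

lemma tval_neg [simp]: "tval (trit_neg t) = - tval t"
  by (cases t) auto

lemma tval_mult [simp]: "tval (trit_mult s t) = tval s * tval t"
  by (cases s) auto

lemma tval_eq_0_iff [simp]: "tval t = 0 \<longleftrightarrow> t = Zero"
  by (cases t) auto

locale char3_field =
  fixes K :: "'k::field itself"
  assumes CHAR_3: "CHAR('k) = 3"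
begin

lemma three_eq_0: "(3 :: 'k) = 0"
  using of_nat_CHAR[where ?'a = 'k] CHAR_3 by simp

lemma two_eq_minus_1: "(2 :: 'k) = - 1"
proof -
  have "(2 :: 'k) + 1 = 0"
    using three_eq_0 by simp
  then show ?thesis
    by (rule add.inverse_unique[symmetric, OF trans[OF add.commute]])
qed

lemma tval_add [simp]: "(tval (trit_add s t) :: 'k) = tval s + tval t"
proof -
  have "(1 :: 'k) + 1 = - 1" "(- 1 :: 'k) - 1 = 1"
    by (simp_all add: two_eq_minus_1)
  then show ?thesis
    by (cases s; cases t) simp_all
qed

end


section \<open>Sparse tables\<close>

datatype idx =
    X1 | X2 | X3 | X4 | X5 | X6 | X7 | X8 | X9 | X10 | X11 | X12 | X13
  | Y1 | Y2 | Y3 | Y4 | Y5 | Y6 | Y7 | Y8 | Y9 | Y10 | Y11 | Y12 | Y13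
  | H1 | H2 | H3

definition all_idx :: "idx list" where
  "all_idx = [X1, X2, X3, X4, X5, X6, X7, X8, X9, X10, X11, X12, X13,
              Y1, Y2, Y3, Y4, Y5, Y6, Y7, Y8, Y9, Y10, Y11, Y12, Y13, H1, H2, H3]"

lemma set_all_idx: "set all_idx = UNIV"
proof -
  have "i \<in> set all_idx" for i
    by (cases i) (simp_all add: all_idx_def)
  then show ?thesis by blast
qed

instance idx :: finite
  by standard (metis set_all_idx List.finite_set)

text \<open>A row \<open>r\<close> stands for the linear map that sends the basis vector \<open>j\<close> to the sum of the \<open>t m\<close>
  with \<open>(j, m, t)\<close> in \<open>r\<close>; a table \<open>R\<close> stands for the bilinear map whose partial map at the basis
  vector \<open>i\<close> is the row \<open>R i\<close>. Entries are sparse because the brackets and cochains at hand send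
  most pairs of basis vectors to zero.\<close>

type_synonym row = "(idx \<times> idx \<times> trit) list"

fun row_coef :: "row \<Rightarrow> idx \<Rightarrow> idx \<Rightarrow> 'k::field" where
  "row_coef [] j m = 0"
| "row_coef ((j', m', t) # r) j m = (if j' = j \<and> m' = m then tval t else 0) + row_coef r j m"

abbreviation table_coef :: "(idx \<Rightarrow> row) \<Rightarrow> idx \<Rightarrow> idx \<Rightarrow> idx \<Rightarrow> 'k::field" where
  "table_coef R i \<equiv> row_coef (R i)"

fun vec_coef :: "(idx \<times> trit) list \<Rightarrow> idx \<Rightarrow> 'k::field" where
  "vec_coef [] m = 0"
| "vec_coef ((k, t) # xs) m = (if k = m then tval t else 0) + vec_coef xs m"

lemma vec_coef_append [simp]: "vec_coef (xs @ ys) m = vec_coef xs m + vec_coef ys m"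
  by (induction xs) auto

lemma vec_coef_scale:
  "vec_coef (map (\<lambda>(k, u). (k, trit_mult t u)) xs) m = tval t * vec_coef xs m"
  by (induction xs) (auto simp: algebra_simps)

fun entries :: "idx \<Rightarrow> row \<Rightarrow> (idx \<times> trit) list" where
  "entries j [] = []"
| "entries j ((j', m, t) # r) = (if j' = j then (m, t) # entries j r else entries j r)"

lemma vec_coef_entries [simp]: "vec_coef (entries j r) m = row_coef r j m"
  by (induction j r rule: entries.induct) auto

text \<open>The entries of a row that contribute to a given coordinate of the image; in matrix terms, a row of
  the transpose.\<close>

fun preimages :: "idx \<Rightarrow> row \<Rightarrow> (idx \<times> trit) list" where
  "preimages m [] = []"
| "preimages m ((j, m', t) # r) = (if m' = m then (j, t) # preimages m r else preimages m r)"

fun combination :: "(idx \<times> trit) list \<Rightarrow> (idx \<Rightarrow> 'k) \<Rightarrow> 'k::field" where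
  "combination [] f = 0"
| "combination ((k, t) # xs) f = tval t * f k + combination xs f"

lemma sum_delta_mult:
  fixes g :: "idx \<Rightarrow> 'k::field"
  shows "(\<Sum>k\<in>UNIV. (if j = k then c else 0) * g k) = c * g j"
proof -
  have "(\<Sum>k\<in>UNIV. (if j = k then c else 0) * g k) = (\<Sum>k\<in>UNIV. if j = k then c * g k else 0)"
    by (intro sum.cong) auto
  then show ?thesis by simp
qed

lemma sum_delta_mult':
  fixes g :: "idx \<Rightarrow> 'k::field"
  shows "(\<Sum>k\<in>UNIV. g k * (if j = k then c else 0)) = c * g j"
  using sum_delta_mult[of j c g] by (simp only: mult.commute)

lemma combination_entries: "(\<Sum>k\<in>UNIV. vec_coef xs k * f k) = combination xs f"
  by (induction xs f rule: combination.induct)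
    (auto simp: distrib_right sum.distrib sum_delta_mult)

lemma combination_preimages:
  "(\<Sum>k\<in>UNIV. row_coef r k m * f k) = combination (preimages m r) f"
proof (induction m r rule: preimages.induct)
  case (2 m j m' t r)
  have "(\<Sum>k\<in>UNIV. (if j = k \<and> m' = m then tval t else 0) * f k)
      = (if m' = m then tval t * f j else 0)"
    by (cases "m' = m") (simp_all add: sum_delta_mult)
  with 2 show ?case
    by (simp add: distrib_right sum.distrib)
qed simp


section \<open>The cocycle condition in coordinates\<close>

text \<open>If \<open>N\<close> holds the structure constants of a bracket and \<open>C\<close> the coordinates of a 2-cochain,
  these are the coordinates of the Chevalley--Eilenberg differential of the cochain.\<close>

definition cocycle_defect ::
    "(idx \<Rightarrow> idx \<Rightarrow> idx \<Rightarrow> 'k::field) \<Rightarrow> (idx \<Rightarrow> idx \<Rightarrow> idx \<Rightarrow> 'k) \<Rightarrow> idx \<Rightarrow> idx \<Rightarrow> idx \<Rightarrow> idx \<Rightarrow> 'k" where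
  "cocycle_defect N C a b d m =
     (\<Sum>k\<in>UNIV. N a k m * C b d k) - (\<Sum>k\<in>UNIV. N b k m * C a d k) + (\<Sum>k\<in>UNIV. N d k m * C a b k)
     - (\<Sum>k\<in>UNIV. N a b k * C k d m) + (\<Sum>k\<in>UNIV. N a d k * C k b m) - (\<Sum>k\<in>UNIV. N b d k * C k a m)"

definition alternating :: "(idx \<Rightarrow> idx \<Rightarrow> idx \<Rightarrow> 'k::field) \<Rightarrow> bool" where
  "alternating C \<longleftrightarrow> (\<forall>a b m. C a b m = - C b a m) \<and> (\<forall>a m. C a a m = 0)"

text \<open>By these symmetries the cocycle condition need only be tested on increasing triples of basis vectors.\<close>

lemma cocycle_defect_symmetries:
  assumes "alternating N" "alternating C"
  shows "cocycle_defect N C b a d m = - cocycle_defect N C a b d m"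
    and "cocycle_defect N C a d b m = - cocycle_defect N C a b d m"
    and "cocycle_defect N C a a d m = 0"
proof -
  note anti = assms[unfolded alternating_def]
  have N: "N i j k = - N j i k" "N i i k = 0" for i j k
    using anti(1) by blast+
  have C: "C i j k = - C j i k" "C i i k = 0" for i j k
    using anti(2) by blast+
  show "cocycle_defect N C b a d m = - cocycle_defect N C a b d m"
    unfolding cocycle_defect_def by (simp add: C(1)[of b a] N(1)[of b a] sum_negf)
  show "cocycle_defect N C a d b m = - cocycle_defect N C a b d m"
    unfolding cocycle_defect_def by (simp add: C(1)[of d b] N(1)[of d b] sum_negf)
  show "cocycle_defect N C a a d m = 0"
    unfolding cocycle_defect_def by (simp add: C(2) N(2))
qed

fun ordered_pairs :: "('a \<Rightarrow> 'a \<Rightarrow> bool) \<Rightarrow> 'a list \<Rightarrow> bool" where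
  "ordered_pairs P [] = True"
| "ordered_pairs P (b # bs) = (list_all (P b) bs \<and> ordered_pairs P bs)"

fun ordered_triples :: "('a \<Rightarrow> 'a \<Rightarrow> 'a \<Rightarrow> bool) \<Rightarrow> 'a list \<Rightarrow> bool" where
  "ordered_triples P [] = True"
| "ordered_triples P (a # as) = (ordered_pairs (P a) as \<and> ordered_triples P as)"

lemma ordered_pairs_all:
  assumes "ordered_pairs P xs" "\<And>a b. P a b \<Longrightarrow> P b a" "\<And>a. P a a"
    and "a \<in> set xs" "b \<in> set xs"
  shows "P a b"
  using assms by (induction xs) (auto simp: list_all_iff)

lemma ordered_triples_all:
  assumes "ordered_triples P xs"
    and swap: "\<And>a b d. P a b d \<Longrightarrow> P b a d" "\<And>a b d. P a b d \<Longrightarrow> P a d b"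
    and rep: "\<And>a d. P a a d"
    and "a \<in> set xs" "b \<in> set xs" "d \<in> set xs"
  shows "P a b d"
  using assms(1,5,6,7)
proof (induction xs arbitrary: a b d)
  case (Cons x xs)
  have pair: "P x b d" if "b \<in> set xs" "d \<in> set xs" for b d
    by (rule ordered_pairs_all[of "P x" xs])
      (use Cons.prems(1) that in \<open>auto intro: swap(2) swap(1)[OF swap(2)[OF rep]]\<close>)
  have x: "P x b d" if "b \<in> set (x # xs)" "d \<in> set (x # xs)" for b d
    using that pair[of b d] swap(2)[OF rep[of x b]] rep[of x d] by auto
  show ?case
  proof (cases "a = x \<or> b = x \<or> d = x")
    case True
    then show ?thesis
      using x[of b d] swap(1)[OF x[of a d]] Cons.prems
        swap(2)[OF swap(1)[OF x[of a b]]] by auto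
  next
    case False
    then show ?thesis
      using Cons by auto
  qed
qed simp

text \<open>A sparse vector may list the same coordinate several times, so entries are added up before they are
  compared with zero.\<close>

fun vanishes_from :: "idx \<Rightarrow> trit \<Rightarrow> (idx \<times> trit) list \<Rightarrow> bool" where
  "vanishes_from m t [] = (t = Zero)"
| "vanishes_from m t ((k, u) # xs) =
     (if k = m then vanishes_from m (trit_add t u) xs else vanishes_from m t xs)"

fun vanishes :: "(idx \<times> trit) list \<Rightarrow> bool" where
  "vanishes [] = True"
| "vanishes ((k, t) # xs) = (vanishes_from k t xs \<and> vanishes (filter (\<lambda>(k', u). k' \<noteq> k) xs))"

text \<open>The three summands of the differential in which the bracket is applied to a value of the cochain
  are of the form \<open>apply_row\<close>, the other three of the form \<open>apply_table\<close>.\<close>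

fun apply_row :: "trit \<Rightarrow> (idx \<times> trit) list \<Rightarrow> row \<Rightarrow> (idx \<times> trit) list" where
  "apply_row s [] r = []"
| "apply_row s ((k, t) # xs) r =
     map (\<lambda>(m, u). (m, trit_mult (trit_mult s t) u)) (entries k r) @ apply_row s xs r"

fun apply_table ::
    "trit \<Rightarrow> (idx \<times> trit) list \<Rightarrow> idx \<Rightarrow> (idx \<Rightarrow> row) \<Rightarrow> (idx \<times> trit) list" where
  "apply_table s [] d C = []"
| "apply_table s ((k, t) # xs) d C =
     map (\<lambda>(m, u). (m, trit_mult (trit_mult s t) u)) (entries d (C k)) @ apply_table s xs d C"

text \<open>The rows of \<open>a\<close> and \<open>b\<close> and the values on \<open>a, b\<close> are passed along the loops over ordered
  triples so that each is evaluated only once.\<close>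

fun test_third where
  "test_third R C a b Ra Rb Ca Cb Rab Cab [] = True"
| "test_third R C a b Ra Rb Ca Cb Rab Cab (d # ds) =
     (vanishes (apply_row Pos (entries d Cb) Ra @ apply_row Neg (entries d Ca) Rb
        @ apply_row Pos Cab (R d) @ apply_table Neg Rab d C
        @ apply_table Pos (entries d Ra) b C @ apply_table Neg (entries d Rb) a C)
      \<and> test_third R C a b Ra Rb Ca Cb Rab Cab ds)"

fun test_second where
  "test_second R C a Ra Ca [] = True"
| "test_second R C a Ra Ca (b # bs) =
     (test_third R C a b Ra (R b) Ca (C b) (entries b Ra) (entries b Ca) bs
      \<and> test_second R C a Ra Ca bs)"

fun cocycle_test :: "(idx \<Rightarrow> row) \<Rightarrow> (idx \<Rightarrow> row) \<Rightarrow> idx list \<Rightarrow> bool" where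
  "cocycle_test R C [] = True"
| "cocycle_test R C (a # as) = (test_second R C a (R a) (C a) as \<and> cocycle_test R C as)"

definition alternating_test :: "(idx \<Rightarrow> row) \<Rightarrow> bool" where
  "alternating_test R \<longleftrightarrow> list_all (\<lambda>a. list_all (\<lambda>b.
     vanishes (entries b (R a) @ entries a (R b))) all_idx) all_idx"

lemma vec_coef_apply_row:
  "vec_coef (apply_row s xs r) m = tval s * (\<Sum>k\<in>UNIV. row_coef r k m * vec_coef xs k)"
  by (induction s xs r rule: apply_row.induct)
    (auto simp: vec_coef_scale distrib_left distrib_right sum.distrib sum_delta_mult' algebra_simps)

lemma vec_coef_apply_table:
  "vec_coef (apply_table s xs d C) m = tval s * (\<Sum>k\<in>UNIV. vec_coef xs k * table_coef C k d m)"
  by (induction s xs d C rule: apply_table.induct)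
    (auto simp: vec_coef_scale distrib_left distrib_right sum.distrib sum_delta_mult' algebra_simps)

context char3_field
begin

lemma vanishes_from_sound: "vanishes_from m t xs \<Longrightarrow> tval t + vec_coef xs m = (0 :: 'k)"
  by (induction m t xs rule: vanishes_from.induct) (auto split: if_splits simp: add.assoc)

lemma vec_coef_filter:
  "k \<noteq> m \<Longrightarrow> vec_coef (filter (\<lambda>(k', u). k' \<noteq> k) xs) m = vec_coef xs m"
  by (induction xs) auto

lemma vanishes_sound: "vanishes xs \<Longrightarrow> vec_coef xs m = (0 :: 'k)"
  by (induction xs rule: vanishes.induct) (auto simp: vanishes_from_sound vec_coef_filter)

lemma alternating_test_sound:
  assumes "alternating_test R"
  shows "alternating (table_coef R :: idx \<Rightarrow> idx \<Rightarrow> idx \<Rightarrow> 'k)"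
proof -
  have *: "table_coef R a b m + table_coef R b a m = (0 :: 'k)" for a b m
    using assms vanishes_sound[of "entries b (R a) @ entries a (R b)" m]
    by (auto simp: alternating_test_def list_all_iff set_all_idx)
  have "table_coef R a a m = (0 :: 'k)" for a m
  proof -
    have "2 * table_coef R a a m = (0 :: 'k)"
      using *[of a a m] by simp
    then show ?thesis
      by (simp add: two_eq_minus_1)
  qed
  with * show ?thesis
    unfolding alternating_def by (auto simp: eq_neg_iff_add_eq_0)
qed

lemma test_third_sound:
  "test_third R C a b (R a) (R b) (C a) (C b) (entries b (R a)) (entries b (C a)) ds \<Longrightarrow>
   list_all (\<lambda>d. \<forall>m. cocycle_defect (table_coef R) (table_coef C) a b d m = (0 :: 'k)) ds"
proof (induction ds)
  case (Cons d ds)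
  have "cocycle_defect (table_coef R) (table_coef C) a b d m = (0 :: 'k)" for m
    using Cons.prems
      vanishes_sound[of "apply_row Pos (entries d (C b)) (R a)
        @ apply_row Neg (entries d (C a)) (R b) @ apply_row Pos (entries b (C a)) (R d)
        @ apply_table Neg (entries b (R a)) d C @ apply_table Pos (entries d (R a)) b C
        @ apply_table Neg (entries d (R b)) a C" m]
    by (simp add: cocycle_defect_def vec_coef_apply_row vec_coef_apply_table algebra_simps)
  with Cons show ?case by simp
qed simp

lemma test_second_sound:
  "test_second R C a (R a) (C a) bs \<Longrightarrow>
   ordered_pairs (\<lambda>b d. \<forall>m. cocycle_defect (table_coef R) (table_coef C) a b d m = (0 :: 'k)) bs"
  by (induction bs) (use test_third_sound in auto)

lemma cocycle_test_ordered:
  "cocycle_test R C as \<Longrightarrow>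
   ordered_triples (\<lambda>a b d. \<forall>m. cocycle_defect (table_coef R) (table_coef C) a b d m = (0 :: 'k)) as"
  by (induction as) (use test_second_sound in auto)

lemma cocycle_test_sound:
  assumes "cocycle_test R C all_idx" "alternating_test R" "alternating_test C"
  shows "cocycle_defect (table_coef R) (table_coef C) a b d m = (0 :: 'k)"
proof -
  note alt = assms(2,3)[THEN alternating_test_sound]
  have "\<forall>m. cocycle_defect (table_coef R) (table_coef C) a b d m = (0 :: 'k)"
  proof (rule ordered_triples_all[OF cocycle_test_ordered[OF assms(1)]])
    fix a b d
    let ?Z = "\<lambda>a b d. \<forall>m. cocycle_defect (table_coef R) (table_coef C) a b d m = (0 :: 'k)"
    show "?Z a b d \<Longrightarrow> ?Z b a d"
      by (subst cocycle_defect_symmetries(1)[OF alt]) simp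
    show "?Z a b d \<Longrightarrow> ?Z a d b"
      by (subst cocycle_defect_symmetries(2)[OF alt]) simp
    show "?Z a a d"
      by (simp add: cocycle_defect_symmetries(3)[OF alt])
  qed (simp_all add: set_all_idx)
  then show ?thesis ..
qed

end


section \<open>The multiplication table and the cocycles\<close>

text \<open>The row of \<open>a\<close> is the operator \<open>[a, -]\<close>. The entries follow from the Chevalley relations and the
  definitions of the \<open>x\<^sub>k\<close> and \<open>y\<^sub>k\<close> by the derivation property of the bracket; they are justified below,
  by the Jacobi identity for the table and by the computation of the Cartan ideal.\<close>

primrec structure_row :: "idx \<Rightarrow> row" where
  "structure_row X1 = [
     (X2, X4, Pos), (X5, X6, Neg), (X7, X8, Neg), (X12, X13, Neg), (Y1, H1, Pos), (Y4, Y2, Pos),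
     (Y6, Y5, Neg), (Y8, Y7, Neg), (Y13, Y12, Neg), (H1, X1, Pos), (H2, X1, Pos)]"
| "structure_row X2 = [
     (X1, X4, Neg), (X3, X5, Pos), (X8, X9, Pos), (X11, X12, Pos), (Y2, H2, Pos), (Y4, Y1, Neg),
     (Y5, Y3, Pos), (Y9, Y8, Pos), (Y12, Y11, Pos), (H1, X2, Pos), (H2, X2, Pos), (H3, X2, Pos)]"
| "structure_row X3 = [
     (X2, X5, Neg), (X4, X6, Pos), (X5, X7, Pos), (X6, X8, Pos), (X9, X10, Pos), (X10, X11, Neg),
     (Y3, H3, Pos), (Y5, Y2, Neg), (Y6, Y4, Pos), (Y7, Y5, Neg), (Y8, Y6, Neg), (Y10, Y9, Neg),
     (Y11, Y10, Neg), (H2, X3, Pos)]"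
| "structure_row X4 = [
     (X3, X6, Neg), (X7, X9, Pos), (X11, X13, Neg), (Y1, X2, Neg), (Y2, X1, Pos), (Y4, H1, Neg),
     (Y4, H2, Neg), (Y6, Y3, Pos), (Y9, Y7, Neg), (Y13, Y11, Pos), (H1, X4, Neg), (H2, X4, Neg),
     (H3, X4, Pos)]"
| "structure_row X5 = [
     (X1, X6, Pos), (X3, X7, Neg), (X6, X9, Pos), (X8, X10, Neg), (X10, X12, Neg), (Y2, X3, Neg),
     (Y3, X2, Pos), (Y5, H2, Neg), (Y5, H3, Neg), (Y6, Y1, Neg), (Y7, Y3, Neg), (Y9, Y6, Pos),
     (Y10, Y8, Neg), (Y12, Y10, Pos), (H1, X5, Pos), (H2, X5, Neg), (H3, X5, Pos)]"
| "structure_row X6 = [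
     (X3, X8, Neg), (X5, X9, Neg), (X7, X10, Pos), (X10, X13, Neg), (Y1, X5, Pos), (Y3, X4, Neg),
     (Y4, X3, Neg), (Y5, X1, Pos), (Y6, H1, Pos), (Y6, H2, Pos), (Y6, H3, Pos), (Y8, Y3, Pos),
     (Y9, Y5, Pos), (Y10, Y7, Neg), (Y13, Y10, Neg), (H1, X6, Neg), (H3, X6, Pos)]"
| "structure_row X7 = [
     (X1, X8, Pos), (X4, X9, Neg), (X6, X10, Neg), (X8, X11, Pos), (X9, X12, Pos), (Y3, X5, Pos),
     (Y5, X3, Pos), (Y7, H2, Neg), (Y7, H3, Pos), (Y8, Y1, Neg), (Y9, Y4, Pos), (Y10, Y6, Neg),
     (Y11, Y8, Neg), (Y12, Y9, Neg), (H1, X7, Pos), (H3, X7, Pos)]"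
| "structure_row X8 = [
     (X2, X9, Neg), (X5, X10, Pos), (X7, X11, Neg), (X9, X13, Pos), (Y1, X7, Pos), (Y3, X6, Pos),
     (Y6, X3, Neg), (Y7, X1, Pos), (Y8, H1, Pos), (Y8, H2, Pos), (Y8, H3, Neg), (Y9, Y2, Neg),
     (Y10, Y5, Neg), (Y11, Y7, Neg), (Y13, Y9, Pos), (H1, X8, Neg), (H2, X8, Pos), (H3, X8, Pos)]"
| "structure_row X9 = [
     (X3, X10, Neg), (X7, X12, Neg), (X8, X13, Neg), (Y2, X8, Neg), (Y4, X7, Pos), (Y5, X6, Neg),
     (Y6, X5, Neg), (Y7, X4, Neg), (Y8, X2, Pos), (Y9, H1, Neg), (Y9, H2, Pos), (Y9, H3, Pos),
     (Y10, Y3, Neg), (Y12, Y7, Pos), (Y13, Y8, Pos), (H2, X9, Neg), (H3, X9, Neg)]"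
| "structure_row X10 = [
     (X3, X11, Pos), (X5, X12, Pos), (X6, X13, Pos), (Y3, X9, Pos), (Y5, X8, Pos), (Y6, X7, Pos),
     (Y7, X6, Pos), (Y8, X5, Pos), (Y9, X3, Pos), (Y10, H1, Neg), (Y10, H2, Pos), (Y11, Y3, Neg),
     (Y12, Y5, Neg), (Y13, Y6, Neg), (H3, X10, Neg)]"
| "structure_row X11 = [
     (X2, X12, Neg), (X4, X13, Pos), (Y3, X10, Pos), (Y7, X8, Pos), (Y8, X7, Pos),
     (Y10, X3, Pos), (Y11, H1, Pos), (Y11, H2, Neg), (Y11, H3, Pos), (Y12, Y2, Neg),
     (Y13, Y4, Pos), (H2, X11, Pos), (H3, X11, Neg)]"
| "structure_row X12 = [
     (X1, X13, Pos), (Y2, X11, Neg), (Y5, X10, Neg), (Y7, X9, Pos), (Y9, X7, Neg),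
     (Y10, X5, Pos), (Y11, X2, Pos), (Y12, H1, Neg), (Y12, H3, Neg), (Y13, Y1, Neg),
     (H1, X12, Pos), (H2, X12, Neg)]"
| "structure_row X13 = [
     (Y1, X12, Pos), (Y4, X11, Neg), (Y6, X10, Pos), (Y8, X9, Neg), (Y9, X8, Neg),
     (Y10, X6, Pos), (Y11, X4, Neg), (Y12, X1, Pos), (Y13, H1, Neg), (Y13, H3, Pos),
     (H1, X13, Neg)]"
| "structure_row Y1 = [
     (X1, H1, Neg), (X4, X2, Pos), (X6, X5, Neg), (X8, X7, Neg), (X13, X12, Neg), (Y2, Y4, Pos),
     (Y5, Y6, Neg), (Y7, Y8, Neg), (Y12, Y13, Neg), (H1, Y1, Neg), (H2, Y1, Neg)]"
| "structure_row Y2 = [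
     (X2, H2, Neg), (X4, X1, Neg), (X5, X3, Pos), (X9, X8, Pos), (X12, X11, Pos), (Y1, Y4, Neg),
     (Y3, Y5, Pos), (Y8, Y9, Pos), (Y11, Y12, Pos), (H1, Y2, Neg), (H2, Y2, Neg), (H3, Y2, Neg)]"
| "structure_row Y3 = [
     (X3, H3, Neg), (X5, X2, Neg), (X6, X4, Pos), (X7, X5, Neg), (X8, X6, Neg), (X10, X9, Neg),
     (X11, X10, Neg), (Y2, Y5, Neg), (Y4, Y6, Pos), (Y5, Y7, Pos), (Y6, Y8, Pos), (Y9, Y10, Pos),
     (Y10, Y11, Neg), (H2, Y3, Neg)]"
| "structure_row Y4 = [
     (X1, Y2, Neg), (X2, Y1, Pos), (X4, H1, Pos), (X4, H2, Pos), (X6, X3, Pos), (X9, X7, Neg),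
     (X13, X11, Pos), (Y3, Y6, Neg), (Y7, Y9, Pos), (Y11, Y13, Neg), (H1, Y4, Pos),
     (H2, Y4, Pos), (H3, Y4, Neg)]"
| "structure_row Y5 = [
     (X2, Y3, Neg), (X3, Y2, Pos), (X5, H2, Pos), (X5, H3, Pos), (X6, X1, Neg), (X7, X3, Neg),
     (X9, X6, Pos), (X10, X8, Neg), (X12, X10, Pos), (Y1, Y6, Pos), (Y3, Y7, Neg), (Y6, Y9, Pos),
     (Y8, Y10, Neg), (Y10, Y12, Neg), (H1, Y5, Neg), (H2, Y5, Pos), (H3, Y5, Neg)]"
| "structure_row Y6 = [
     (X1, Y5, Pos), (X3, Y4, Neg), (X4, Y3, Neg), (X5, Y1, Pos), (X6, H1, Neg), (X6, H2, Neg),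
     (X6, H3, Neg), (X8, X3, Pos), (X9, X5, Pos), (X10, X7, Neg), (X13, X10, Neg), (Y3, Y8, Neg),
     (Y5, Y9, Neg), (Y7, Y10, Pos), (Y10, Y13, Neg), (H1, Y6, Pos), (H3, Y6, Neg)]"
| "structure_row Y7 = [
     (X3, Y5, Pos), (X5, Y3, Pos), (X7, H2, Pos), (X7, H3, Neg), (X8, X1, Neg), (X9, X4, Pos),
     (X10, X6, Neg), (X11, X8, Neg), (X12, X9, Neg), (Y1, Y8, Pos), (Y4, Y9, Neg),
     (Y6, Y10, Neg), (Y8, Y11, Pos), (Y9, Y12, Pos), (H1, Y7, Neg), (H3, Y7, Neg)]"
| "structure_row Y8 = [
     (X1, Y7, Pos), (X3, Y6, Pos), (X6, Y3, Neg), (X7, Y1, Pos), (X8, H1, Neg), (X8, H2, Neg),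
     (X8, H3, Pos), (X9, X2, Neg), (X10, X5, Neg), (X11, X7, Neg), (X13, X9, Pos), (Y2, Y9, Neg),
     (Y5, Y10, Pos), (Y7, Y11, Neg), (Y9, Y13, Pos), (H1, Y8, Pos), (H2, Y8, Neg), (H3, Y8, Neg)]"
| "structure_row Y9 = [
     (X2, Y8, Neg), (X4, Y7, Pos), (X5, Y6, Neg), (X6, Y5, Neg), (X7, Y4, Neg), (X8, Y2, Pos),
     (X9, H1, Pos), (X9, H2, Neg), (X9, H3, Neg), (X10, X3, Neg), (X12, X7, Pos), (X13, X8, Pos),
     (Y3, Y10, Neg), (Y7, Y12, Neg), (Y8, Y13, Neg), (H2, Y9, Pos), (H3, Y9, Pos)]"
| "structure_row Y10 = [
     (X3, Y9, Pos), (X5, Y8, Pos), (X6, Y7, Pos), (X7, Y6, Pos), (X8, Y5, Pos), (X9, Y3, Pos),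
     (X10, H1, Pos), (X10, H2, Neg), (X11, X3, Neg), (X12, X5, Neg), (X13, X6, Neg),
     (Y3, Y11, Pos), (Y5, Y12, Pos), (Y6, Y13, Pos), (H3, Y10, Pos)]"
| "structure_row Y11 = [
     (X3, Y10, Pos), (X7, Y8, Pos), (X8, Y7, Pos), (X10, Y3, Pos), (X11, H1, Neg),
     (X11, H2, Pos), (X11, H3, Neg), (X12, X2, Neg), (X13, X4, Pos), (Y2, Y12, Neg),
     (Y4, Y13, Pos), (H2, Y11, Neg), (H3, Y11, Pos)]"
| "structure_row Y12 = [
     (X2, Y11, Neg), (X5, Y10, Neg), (X7, Y9, Pos), (X9, Y7, Neg), (X10, Y5, Pos),
     (X11, Y2, Pos), (X12, H1, Pos), (X12, H3, Pos), (X13, X1, Neg), (Y1, Y13, Pos),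
     (H1, Y12, Neg), (H2, Y12, Pos)]"
| "structure_row Y13 = [
     (X1, Y12, Pos), (X4, Y11, Neg), (X6, Y10, Pos), (X8, Y9, Neg), (X9, Y8, Neg),
     (X10, Y6, Pos), (X11, Y4, Neg), (X12, Y1, Pos), (X13, H1, Pos), (X13, H3, Neg),
     (H1, Y13, Pos)]"
| "structure_row H1 = [
     (X1, X1, Neg), (X2, X2, Neg), (X4, X4, Pos), (X5, X5, Neg), (X6, X6, Pos), (X7, X7, Neg),
     (X8, X8, Pos), (X12, X12, Neg), (X13, X13, Pos), (Y1, Y1, Pos), (Y2, Y2, Pos),
     (Y4, Y4, Neg), (Y5, Y5, Pos), (Y6, Y6, Neg), (Y7, Y7, Pos), (Y8, Y8, Neg), (Y12, Y12, Pos),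
     (Y13, Y13, Neg)]"
| "structure_row H2 = [
     (X1, X1, Neg), (X2, X2, Neg), (X3, X3, Neg), (X4, X4, Pos), (X5, X5, Pos), (X8, X8, Neg),
     (X9, X9, Pos), (X11, X11, Neg), (X12, X12, Pos), (Y1, Y1, Pos), (Y2, Y2, Pos),
     (Y3, Y3, Pos), (Y4, Y4, Neg), (Y5, Y5, Neg), (Y8, Y8, Pos), (Y9, Y9, Neg), (Y11, Y11, Pos),
     (Y12, Y12, Neg)]"
| "structure_row H3 = [
     (X2, X2, Neg), (X4, X4, Neg), (X5, X5, Neg), (X6, X6, Neg), (X7, X7, Neg), (X8, X8, Neg),
     (X9, X9, Pos), (X10, X10, Pos), (X11, X11, Pos), (Y2, Y2, Pos), (Y4, Y4, Pos),
     (Y5, Y5, Pos), (Y6, Y6, Pos), (Y7, Y7, Pos), (Y8, Y8, Pos), (Y9, Y9, Neg), (Y10, Y10, Neg),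
     (Y11, Y11, Neg)]"

type_synonym term_list = "(idx \<times> idx \<times> idx \<times> trit) list"

text \<open>The entry \<open>(u, v, w, t)\<close> of a term list stands for the cochain \<open>t u \<otimes> v\<^sup>* \<and> w\<^sup>*\<close>.\<close>

fun wedge_row :: "term_list \<Rightarrow> idx \<Rightarrow> row" where
  "wedge_row [] a = []"
| "wedge_row ((u, v, w, t) # L) a =
     (if v = a then [(w, u, t)] else []) @ (if w = a then [(v, u, trit_neg t)] else []) @ wedge_row L a"

text \<open>The four cocycles of negative degree, with 2 written as -1.\<close>

definition terms_m18 :: term_list where
  "terms_m18 = [
     (Y3, X12, X13, Neg), (Y5, X11, X13, Neg), (Y6, X11, X12, Neg), (Y7, X10, X13, Pos),
     (Y8, X10, X12, Pos), (Y9, X10, X11, Pos), (Y10, X7, X13, Neg), (Y10, X8, X12, Pos),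
     (Y10, X9, X11, Neg), (Y11, X5, X13, Neg), (Y11, X6, X12, Pos), (Y11, X9, X10, Neg),
     (Y12, X3, X13, Neg), (Y12, X6, X11, Pos), (Y12, X8, X10, Neg), (Y13, X3, X12, Neg),
     (Y13, X5, X11, Pos), (Y13, X7, X10, Neg)]"

definition terms_m9 :: term_list where
  "terms_m9 = [
     (X3, X1, X13, Neg), (X5, X4, X13, Pos), (X7, X6, X13, Pos), (Y1, X4, X10, Pos),
     (Y1, X6, X9, Neg), (Y1, X13, Y3, Neg), (Y4, X1, X10, Pos), (Y4, X6, X8, Pos),
     (Y4, X13, Y5, Pos), (Y6, X1, X9, Pos), (Y6, X4, X8, Pos), (Y6, X13, Y7, Neg),
     (Y8, X4, X6, Neg), (Y9, X1, X6, Pos), (Y10, X1, X4, Neg), (Y13, X1, Y3, Pos),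
     (Y13, X4, Y5, Pos), (Y13, X6, Y7, Pos)]"

definition terms_m6 :: term_list where
  "terms_m6 = [
     (X1, X2, X10, Neg), (X1, X5, X9, Neg), (X1, X12, Y3, Neg), (X3, X12, Y1, Pos),
     (X6, X2, X12, Neg), (X8, X5, X12, Pos), (Y2, X5, X7, Neg), (Y2, X10, Y1, Neg),
     (Y2, X12, Y6, Neg), (Y5, X2, X7, Neg), (Y5, X9, Y1, Pos), (Y5, X12, Y8, Neg),
     (Y7, X2, X5, Pos), (Y9, X5, Y1, Neg), (Y10, X2, Y1, Neg), (Y12, X2, Y6, Neg),
     (Y12, X5, Y8, Pos), (Y12, Y1, Y3, Neg)]"

definition terms_m3 :: term_list where
  "terms_m3 = [
     (X2, X3, X7, Neg), (X2, X10, Y4, Pos), (X2, X11, Y6, Neg), (X4, X3, X8, Pos),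
     (X4, X10, Y2, Pos), (X4, X11, Y5, Pos), (X5, X11, Y4, Neg), (X6, X11, Y2, Pos),
     (X9, X3, X11, Pos), (Y3, X7, Y2, Neg), (Y3, X8, Y4, Neg), (Y3, X11, Y9, Neg),
     (Y7, X3, Y2, Neg), (Y8, X3, Y4, Pos), (Y10, Y2, Y4, Pos), (Y11, X3, Y9, Pos),
     (Y11, Y2, Y6, Pos), (Y11, Y4, Y5, Pos)]"

text \<open>The Chevalley involution sends the basis vector \<open>i\<close> to \<open>flip_sign i\<close> times the basis vector
  \<open>flip i\<close>. The sign is -1 on the generators and multiplicative along the brackets that define the other
  basis vectors.\<close>

primrec flip :: "idx \<Rightarrow> idx" where
  "flip X1 = Y1" | "flip X2 = Y2" | "flip X3 = Y3" | "flip X4 = Y4"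
| "flip X5 = Y5" | "flip X6 = Y6" | "flip X7 = Y7" | "flip X8 = Y8"
| "flip X9 = Y9" | "flip X10 = Y10" | "flip X11 = Y11" | "flip X12 = Y12"
| "flip X13 = Y13" | "flip Y1 = X1" | "flip Y2 = X2" | "flip Y3 = X3"
| "flip Y4 = X4" | "flip Y5 = X5" | "flip Y6 = X6" | "flip Y7 = X7"
| "flip Y8 = X8" | "flip Y9 = X9" | "flip Y10 = X10" | "flip Y11 = X11"
| "flip Y12 = X12" | "flip Y13 = X13" | "flip H1 = H1" | "flip H2 = H2"
| "flip H3 = H3"

primrec flip_sign :: "idx \<Rightarrow> trit" where
  "flip_sign X1 = Neg" | "flip_sign X2 = Neg" | "flip_sign X3 = Neg"
| "flip_sign X4 = Pos" | "flip_sign X5 = Pos" | "flip_sign X6 = Neg"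
| "flip_sign X7 = Neg" | "flip_sign X8 = Pos" | "flip_sign X9 = Neg"
| "flip_sign X10 = Pos" | "flip_sign X11 = Neg" | "flip_sign X12 = Pos"
| "flip_sign X13 = Neg" | "flip_sign Y1 = Neg" | "flip_sign Y2 = Neg"
| "flip_sign Y3 = Neg" | "flip_sign Y4 = Pos" | "flip_sign Y5 = Pos"
| "flip_sign Y6 = Neg" | "flip_sign Y7 = Neg" | "flip_sign Y8 = Pos"
| "flip_sign Y9 = Neg" | "flip_sign Y10 = Pos" | "flip_sign Y11 = Neg"
| "flip_sign Y12 = Pos" | "flip_sign Y13 = Neg" | "flip_sign H1 = Neg"
| "flip_sign H2 = Neg" | "flip_sign H3 = Neg"

definition flip_terms :: "term_list \<Rightarrow> term_list" where
  "flip_terms = map (\<lambda>(u, v, w, t). (flip u, flip v, flip w,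
     trit_mult t (trit_mult (flip_sign u) (trit_mult (flip_sign v) (flip_sign w)))))"

text \<open>The sparse vector tested for zero is \<open>\<omega>([a, b]) - [\<omega>(a), \<omega>(b)]\<close>.\<close>

definition flip_test :: bool where
  "flip_test \<longleftrightarrow> list_all (\<lambda>a. list_all (\<lambda>b. vanishes
     (map (\<lambda>(m, t). (flip m, trit_mult (flip_sign m) t)) (entries b (structure_row a))
      @ map (\<lambda>(m, t). (m, trit_mult (trit_neg (trit_mult (flip_sign a) (flip_sign b))) t))
          (entries (flip b) (structure_row (flip a))))) all_idx) all_idx"

lemma alternating_test_structure: "alternating_test structure_row"
  by code_simp

lemma flip_test: flip_test
  by code_simp

lemma alternating_test_m18: "alternating_test (wedge_row terms_m18)"
  by code_simp

lemma alternating_test_m9: "alternating_test (wedge_row terms_m9)"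
  by code_simp

lemma alternating_test_m6: "alternating_test (wedge_row terms_m6)"
  by code_simp

lemma alternating_test_m3: "alternating_test (wedge_row terms_m3)"
  by code_simp

text \<open>The bracket is a 2-cochain, and the cocycle condition for it is twice the Jacobi identity.\<close>

lemma cocycle_test_structure: "cocycle_test structure_row structure_row all_idx"
  by code_simp

lemma cocycle_test_m18: "cocycle_test structure_row (wedge_row terms_m18) all_idx"
  by code_simp

lemma cocycle_test_m9: "cocycle_test structure_row (wedge_row terms_m9) all_idx"
  by code_simp

lemma cocycle_test_m6: "cocycle_test structure_row (wedge_row terms_m6) all_idx"
  by code_simp

lemma cocycle_test_m3: "cocycle_test structure_row (wedge_row terms_m3) all_idx"
  by code_simp


section \<open>Triangular decomposition of the presented algebra\<close>

lemma fbr_single: "fbr (Poly_Mapping.single u a) (Poly_Mapping.single v b) = Poly_Mapping.single (Br u v) (a * b)"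
  by (simp add: fbr_superset[of "{u}" "{v}"])

lemma sum_single_keys:
  "(\<Sum>w\<in>Poly_Mapping.keys p. Poly_Mapping.single w (Poly_Mapping.lookup p w)) = p"
proof (rule poly_mapping_eqI)
  fix w
  show "Poly_Mapping.lookup (\<Sum>w\<in>Poly_Mapping.keys p. Poly_Mapping.single w (Poly_Mapping.lookup p w)) w
      = Poly_Mapping.lookup p w"
    by (simp add: lookup_sum lookup_single when_def in_keys_iff)
qed

lemma mem_span_words:
  fixes p :: "('a, 'k::field) free_alg"
  assumes "\<And>w. w \<in> Poly_Mapping.keys p \<Longrightarrow> Poly_Mapping.single w 1 \<in> free.span S"
  shows "p \<in> free.span S"
proof -
  have "(\<Sum>w\<in>Poly_Mapping.keys p. fscl (Poly_Mapping.lookup p w) (Poly_Mapping.single w 1)) \<in> free.span S"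
    using assms by (intro free.span_sum free.span_scale)
  then show ?thesis
    by (simp add: fscl_single sum_single_keys)
qed

text \<open>Nonassociative words in the \<open>x\<^sub>i\<close> alone (for \<open>True\<close>) or in the \<open>y\<^sub>i\<close> alone (for \<open>False\<close>).\<close>

primrec side_word :: "bool \<Rightarrow> 'n chevalley word \<Rightarrow> bool" where
  "side_word s (Gen g) = (case g of GX i \<Rightarrow> s | GY i \<Rightarrow> \<not> s | GH i \<Rightarrow> False)"
| "side_word s (Br u v) = (side_word s u \<and> side_word s v)"

lemma side_word_degree:
  "side_word True w \<Longrightarrow> word_degree w > 0" "side_word False w \<Longrightarrow> word_degree w < 0"
  by (induction w) (auto split: chevalley.splits)

text \<open>These words span the degree \<open>d\<close> part of \<open>n\<^sub>- + h + n\<^sub>+\<close>. The aim is to show that modulo the relations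
  they span everything of degree \<open>d\<close>.\<close>

definition triangular_words :: "int \<Rightarrow> 'n chevalley word set" where
  "triangular_words d = {w. (side_word True w \<or> side_word False w \<or> w \<in> range (\<lambda>i. Gen (GH i)))
                            \<and> word_degree w = d}"

lemma triangular_words_sides:
  "d > 0 \<Longrightarrow> triangular_words d = {w. side_word True w \<and> word_degree w = d}"
  "d < 0 \<Longrightarrow> triangular_words d = {w. side_word False w \<and> word_degree w = d}"
  "triangular_words 0 = range (\<lambda>i. Gen (GH i))"
  by (auto simp: triangular_words_def dest: side_word_degree)

context
  fixes A :: "'k::field ^ 'n ^ 'n"
begin

abbreviation "rels \<equiv> presentation_ideal (chevalley_relations A)"

lemma is_ideal_rels: "is_ideal rels"
  by (simp add: presentation_ideal_def is_ideal_ideal_gen)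

lemma subspace_rels: "free.subspace rels"
  using is_ideal_rels by (simp add: is_ideal_def)

lemma chevalley_relations_subset: "chevalley_relations A \<subseteq> rels"
  unfolding presentation_ideal_def ideal_gen_def by blast

lemma chevalley_mem_rels:
  "fbr (gen (GX i)) (gen (GY j)) - (if i = j then gen (GH i) else 0) \<in> rels"
  "fbr (gen (GH i)) (gen (GH j)) \<in> rels"
  "fbr (gen (GH i)) (gen (GX j)) - fscl (A $ i $ j) (gen (GX j)) \<in> rels"
  "fbr (gen (GH i)) (gen (GY j)) - fscl (- (A $ i $ j)) (gen (GY j)) \<in> rels"
  by (rule subsetD[OF chevalley_relations_subset], simp only: chevalley_relations_def Un_iff mem_Collect_eq,
      metis)+

lemma fbr_self_mem_rels: "fbr p p \<in> rels"
  unfolding presentation_ideal_def ideal_gen_def by blast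

lemma jacobi_mem_rels: "fbr p (fbr q r) + fbr q (fbr r p) + fbr r (fbr p q) \<in> rels"
  unfolding presentation_ideal_def ideal_gen_def by blast

lemma anticommute_mem_rels: "fbr p q + fbr q p \<in> rels"
proof -
  have "fbr (p + q) (p + q) - fbr p p - fbr q q \<in> rels"
    by (intro free.subspace_diff[OF subspace_rels] fbr_self_mem_rels)
  then show ?thesis
    by (simp add: fbr_add_left fbr_add_right algebra_simps)
qed

text \<open>The Jacobi identity in the form in which it is used for inductions over words: bracketing with \<open>p\<close> is a
  derivation.\<close>

lemma derivation_mem_rels:
  "fbr p (fbr q r) - fbr (fbr p q) r - fbr q (fbr p r) \<in> rels"
proof -
  have "fbr q (fbr r p + fbr p r) \<in> rels"
    using is_ideal_rels anticommute_mem_rels unfolding is_ideal_def by blast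
  then have "(fbr p (fbr q r) + fbr q (fbr r p) + fbr r (fbr p q)) - fbr q (fbr r p + fbr p r)
      - (fbr r (fbr p q) + fbr (fbr p q) r) \<in> rels"
    by (intro free.subspace_diff[OF subspace_rels] jacobi_mem_rels anticommute_mem_rels)
  then show ?thesis
    by (simp add: fbr_add_right algebra_simps)
qed

definition triangular :: "int \<Rightarrow> ('n chevalley, 'k) free_alg set" where
  "triangular d = free.span ((\<lambda>w. Poly_Mapping.single w 1) ` triangular_words d \<union> rels)"

lemma subspace_triangular: "free.subspace (triangular d)"
  by (simp add: triangular_def)

lemmas triangular_add = free.subspace_add[OF subspace_triangular]
  and triangular_diff = free.subspace_diff[OF subspace_triangular]
  and triangular_scale = free.subspace_scale[OF subspace_triangular]

lemma rels_triangular: "r \<in> rels \<Longrightarrow> r \<in> triangular d"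
  by (simp add: triangular_def free.span_base)

lemma word_triangular: "w \<in> triangular_words d \<Longrightarrow> Poly_Mapping.single w 1 \<in> triangular d"
  by (simp add: triangular_def free.span_base)

lemma triangular_cong:
  assumes "p - q \<in> rels" "q \<in> triangular d"
  shows "p \<in> triangular d"
  using triangular_add[OF rels_triangular[OF assms(1)] assms(2)] by simp

lemma fbr_triangular_right:
  assumes "q \<in> triangular d"
    and "\<And>w. w \<in> triangular_words d \<Longrightarrow> fbr p (Poly_Mapping.single w 1) \<in> triangular e"
  shows "fbr p q \<in> triangular e"
  using assms(1) unfolding triangular_def
proof (induction rule: free.span_induct_alt)
  case base
  show ?case by (simp add: free.span_zero)
next
  case (step c x y)
  have "fbr p x \<in> triangular e"
    using step.hyps assms(2) is_ideal_rels rels_triangular unfolding is_ideal_def by blast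
  then show ?case
    using step.IH unfolding triangular_def
    by (simp add: fbr_add_right fbr_fscl_right free.span_add free.span_scale)
qed

lemma triangular_anticommute: "fbr p q \<in> triangular d \<Longrightarrow> fbr q p \<in> triangular d"
proof (rule triangular_cong)
  show "fbr q p - fscl (- 1) (fbr p q) \<in> rels"
    using anticommute_mem_rels[of q p] by simp
qed (rule triangular_scale)

lemma fbr_triangular_left:
  assumes "q \<in> triangular d"
    and "\<And>w. w \<in> triangular_words d \<Longrightarrow> fbr (Poly_Mapping.single w 1) p \<in> triangular e"
  shows "fbr q p \<in> triangular e"
  using assms by (blast intro: triangular_anticommute fbr_triangular_right)

lemma triangular_derivation:
  assumes "fbr (fbr p q) r \<in> triangular d" "fbr q (fbr p r) \<in> triangular d"
  shows "fbr p (fbr q r) \<in> triangular d"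
proof (rule triangular_cong)
  show "fbr p (fbr q r) - (fbr (fbr p q) r + fbr q (fbr p r)) \<in> rels"
    using derivation_mem_rels[of p q r] by (simp add: algebra_simps)
qed (rule triangular_add[OF assms])

lemma triangular_commutator:
  assumes "fbr p (fbr q r) \<in> triangular d" "fbr q (fbr p r) \<in> triangular d"
  shows "fbr (fbr p q) r \<in> triangular d"
proof (rule triangular_cong)
  have "fscl (- 1) (fbr p (fbr q r) - fbr (fbr p q) r - fbr q (fbr p r)) \<in> rels"
    by (rule free.subspace_scale[OF subspace_rels derivation_mem_rels])
  then show "fbr (fbr p q) r - (fbr p (fbr q r) - fbr q (fbr p r)) \<in> rels"
    by (simp add: algebra_simps)
qed (rule triangular_diff[OF assms])

lemma fbr_same_side:
  assumes "p \<in> triangular a" "q \<in> triangular b" "a > 0 \<and> b > 0 \<or> a < 0 \<and> b < 0"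
  shows "fbr p q \<in> triangular (a + b)"
proof (rule fbr_triangular_left[OF assms(1)], rule fbr_triangular_right[OF assms(2)])
  fix u v :: "'n chevalley word"
  assume "u \<in> triangular_words a" "v \<in> triangular_words b"
  then have "Br u v \<in> triangular_words (a + b)"
    using assms(3) by (auto simp: triangular_words_sides)
  then show "fbr (Poly_Mapping.single u 1) (Poly_Mapping.single v 1) \<in> triangular (a + b)"
    by (simp add: fbr_single word_triangular)
qed

lemma side_word_triangular:
  "side_word s w \<Longrightarrow> Poly_Mapping.single w 1 \<in> triangular (word_degree w)"
  by (rule word_triangular) (cases s; auto simp: triangular_words_def)

lemma side_words_same_sign:
  "side_word s u \<Longrightarrow> side_word s v \<Longrightarrow>
   word_degree u > 0 \<and> word_degree v > 0 \<or> word_degree u < 0 \<and> word_degree v < 0"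
  by (cases s) (auto dest: side_word_degree)

lemma cartan_generator_side:
  "fbr (gen (GH i)) (gen (GX j)) \<in> triangular 1" "fbr (gen (GH i)) (gen (GY j)) \<in> triangular (- 1)"
proof -
  have X: "gen (GX j) \<in> triangular 1" and Y: "gen (GY j) \<in> triangular (- 1)" for j
    using side_word_triangular[of True "Gen (GX j)"] side_word_triangular[of False "Gen (GY j)"]
    by (simp_all add: gen_def)
  show "fbr (gen (GH i)) (gen (GX j)) \<in> triangular 1"
    "fbr (gen (GH i)) (gen (GY j)) \<in> triangular (- 1)"
    by (rule triangular_cong[OF chevalley_mem_rels(3) triangular_scale[OF X]],
        rule triangular_cong[OF chevalley_mem_rels(4) triangular_scale[OF Y]])
qed

lemma opposite_generators:
  "fbr (gen (GX i)) (gen (GY j)) \<in> triangular 0"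
proof (rule triangular_cong[OF chevalley_mem_rels(1)])
  show "(if i = j then gen (GH i) else 0) \<in> triangular 0"
    using word_triangular[of "Gen (GH i)" 0] free.subspace_0[OF subspace_triangular]
    by (auto simp: triangular_words_sides gen_def)
qed

text \<open>The brackets \<open>[h\<^sub>i, -]\<close> are derivations that preserve the degree on generators, hence on all words.\<close>

lemma cartan_side_word:
  "side_word s w \<Longrightarrow> fbr (gen (GH i)) (Poly_Mapping.single w 1) \<in> triangular (word_degree w)"
proof (induction w)
  case (Gen g)
  then show ?case
    by (cases g) (simp_all add: cartan_generator_side flip: gen_def)
next
  case (Br u v)
  have "fbr (gen (GH i)) (fbr (Poly_Mapping.single u 1) (Poly_Mapping.single v 1))
      \<in> triangular (word_degree u + word_degree v)"
  proof (rule triangular_derivation)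
    show "fbr (fbr (gen (GH i)) (Poly_Mapping.single u 1)) (Poly_Mapping.single v 1)
        \<in> triangular (word_degree u + word_degree v)"
      using Br.prems
      by (intro fbr_same_side[OF Br.IH(1) side_word_triangular[of s v]] side_words_same_sign[of s])
        simp_all
    show "fbr (Poly_Mapping.single u 1) (fbr (gen (GH i)) (Poly_Mapping.single v 1))
        \<in> triangular (word_degree u + word_degree v)"
      using Br.prems
      by (intro fbr_same_side[OF side_word_triangular[of s u] Br.IH(2)] side_words_same_sign[of s])
        simp_all
  qed
  then show ?case
    by (simp add: fbr_single)
qed

lemma fbr_triangular_side_word:
  assumes "p \<in> triangular a" "side_word s w" "a = 0 \<or> a > 0 \<and> s \<or> a < 0 \<and> \<not> s"
  shows "fbr p (Poly_Mapping.single w 1) \<in> triangular (a + word_degree w)"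
proof (cases "a = 0")
  case True
  show ?thesis
  proof (rule fbr_triangular_left[OF assms(1)])
    fix u :: "'n chevalley word" assume "u \<in> triangular_words a"
    then obtain i where "u = Gen (GH i)"
      using True by (auto simp: triangular_words_sides)
    then show "fbr (Poly_Mapping.single u 1) (Poly_Mapping.single w 1) \<in> triangular (a + word_degree w)"
      using cartan_side_word[OF assms(2), of i] True by (simp add: gen_def)
  qed
next
  case False
  then show ?thesis
    using assms side_word_degree[of w] by (cases s) (auto intro!: fbr_same_side side_word_triangular)
qed

definition side_generator :: "bool \<Rightarrow> 'n \<Rightarrow> 'n chevalley" where
  "side_generator s i = (if s then GX i else GY i)"

text \<open>Induction over the word with the derivation property of the bracket with the opposite generator. Where
  that bracket reduces a factor of degree \<open>\<plusminus>1\<close> to the Cartan part, the previous lemma applies to the other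
  factor.\<close>

lemma opposite_side_word:
  "side_word s w \<Longrightarrow> fbr (gen (side_generator (\<not> s) i)) (Poly_Mapping.single w 1)
     \<in> triangular (word_degree w + (if s then - 1 else 1))"
proof (induction w)
  case (Gen g)
  then show ?case
    by (cases g; cases s)
      (simp_all add: side_generator_def opposite_generators
         triangular_anticommute[OF opposite_generators] flip: gen_def)
next
  case (Br u v)
  let ?g = "gen (side_generator (\<not> s) i)" and ?e = "if s then - 1 else 1 :: int"
  let ?u = "Poly_Mapping.single u 1" and ?v = "Poly_Mapping.single v 1"
  have deg: "word_degree w + ?e = 0 \<or> word_degree w + ?e > 0 \<and> s \<or> word_degree w + ?e < 0 \<and> \<not> s"
    if "side_word s w" for w :: "'n chevalley word"
    using that side_word_degree[of w] by (cases s) auto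
  have "fbr ?g (fbr ?u ?v) \<in> triangular (word_degree u + word_degree v + ?e)"
  proof (rule triangular_derivation)
    show "fbr (fbr ?g ?u) ?v \<in> triangular (word_degree u + word_degree v + ?e)"
      using fbr_triangular_side_word[OF Br.IH(1) _ deg, of v] Br.prems
      by (simp add: ac_simps)
    have "fbr (fbr ?g ?v) ?u \<in> triangular (word_degree u + word_degree v + ?e)"
      using fbr_triangular_side_word[OF Br.IH(2) _ deg, of u] Br.prems
      by (simp add: ac_simps)
    then show "fbr ?u (fbr ?g ?v) \<in> triangular (word_degree u + word_degree v + ?e)"
      by (rule triangular_anticommute)
  qed
  then show ?case
    by (simp add: fbr_single)
qed

lemma generator_triangular_word:
  assumes "w \<in> triangular_words d"
  shows "fbr (gen g) (Poly_Mapping.single w 1) \<in> triangular (d + word_degree (Gen g))"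
proof -
  consider (pos) "side_word True w" | (neg) "side_word False w" | (cartan) j where "w = Gen (GH j)"
    using assms by (auto simp: triangular_words_def)
  note cases = this
  have d: "d = word_degree w"
    using assms by (simp add: triangular_words_def)
  show ?thesis
  proof (cases g)
    case (GX i)
    show ?thesis
    proof (cases rule: cases)
      case pos
      have "Poly_Mapping.single (Br (Gen g) w) 1 \<in> triangular (word_degree (Br (Gen g) w))"
        using pos GX by (intro side_word_triangular[of True]) simp
      then show ?thesis
        by (simp add: d gen_def fbr_single add.commute)
    next
      case neg
      then show ?thesis
        using opposite_side_word[OF neg, of i] GX by (simp add: d side_generator_def)
    next
      case (cartan j)
      then show ?thesis
        using triangular_anticommute[OF cartan_generator_side(1)[of j i]] GX d by (simp add: gen_def)
    qed
  next
    case (GY i)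
    show ?thesis
    proof (cases rule: cases)
      case neg
      have "Poly_Mapping.single (Br (Gen g) w) 1 \<in> triangular (word_degree (Br (Gen g) w))"
        using neg GY by (intro side_word_triangular[of False]) simp
      then show ?thesis
        by (simp add: d gen_def fbr_single add.commute)
    next
      case pos
      then show ?thesis
        using opposite_side_word[OF pos, of i] GY by (simp add: d side_generator_def)
    next
      case (cartan j)
      then show ?thesis
        using triangular_anticommute[OF cartan_generator_side(2)[of j i]] GY d by (simp add: gen_def)
    qed
  next
    case (GH i)
    then show ?thesis
      using d by (cases rule: cases)
        (auto simp: cartan_side_word rels_triangular[OF chevalley_mem_rels(2)] simp flip: gen_def)
  qed
qed

text \<open>Bracketing with \<open>[u, v]\<close> is the commutator of bracketing with \<open>u\<close> and with \<open>v\<close>, so generators suffice.\<close>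

lemma fbr_word_triangular:
  "p \<in> triangular d \<Longrightarrow> fbr (Poly_Mapping.single w 1) p \<in> triangular (d + word_degree w)"
proof (induction w arbitrary: p d)
  case (Gen g)
  then show ?case
    by (rule fbr_triangular_right) (use generator_triangular_word in \<open>simp add: gen_def\<close>)
next
  case (Br u v)
  have "fbr (fbr (Poly_Mapping.single u 1) (Poly_Mapping.single v 1)) p
      \<in> triangular (d + (word_degree u + word_degree v))"
    using Br.IH(1)[OF Br.IH(2)[OF Br.prems]] Br.IH(2)[OF Br.IH(1)[OF Br.prems]]
    by (intro triangular_commutator) (simp_all add: ac_simps)
  then show ?case
    by (simp add: fbr_single)
qed

lemma word_mem_triangular: "Poly_Mapping.single w 1 \<in> triangular (word_degree w)"
proof (induction w)
  case (Gen g)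
  show ?case
    by (rule word_triangular) (cases g; auto simp: triangular_words_def)
next
  case (Br u v)
  show ?case
    using fbr_word_triangular[OF Br.IH(2), of u] by (simp add: fbr_single add.commute)
qed

text \<open>For an ideal containing the relations, this reduces the question which elements of degree 0 it contains
  to its intersection with the span of the \<open>h\<^sub>i\<close>.\<close>

lemma degree_0_cartan_mod_rels:
  assumes "\<And>w. w \<in> Poly_Mapping.keys p \<Longrightarrow> word_degree w = 0"
  obtains h r where "h \<in> free.span (range (\<lambda>i. gen (GH i)))" "r \<in> rels" "p = h + r"
proof -
  have "p \<in> triangular 0"
    unfolding triangular_def by (rule mem_span_words)
      (use assms word_mem_triangular in \<open>metis triangular_def\<close>)
  then have "p \<in> free.span (range (\<lambda>i. gen (GH i)) \<union> rels)"
    by (simp add: triangular_def triangular_words_sides gen_def image_image)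
  moreover have "free.span rels = rels"
    using subspace_rels by (simp only: free.span_eq_iff)
  ultimately show ?thesis
    using that unfolding free.span_Un by auto
qed

end


section \<open>A model with the given multiplication table\<close>

abbreviation structure_const :: "idx \<Rightarrow> idx \<Rightarrow> idx \<Rightarrow> 'k::field" where
  "structure_const \<equiv> table_coef structure_row"

definition unit :: "idx \<Rightarrow> idx \<Rightarrow> 'k::field" where
  "unit i = (\<lambda>j. if j = i then 1 else 0)"

lemma unit_apply: "unit i j = (if j = i then 1 else 0)"
  by (simp add: unit_def)

definition table_bracket :: "(idx \<Rightarrow> 'k::field) \<Rightarrow> (idx \<Rightarrow> 'k) \<Rightarrow> idx \<Rightarrow> 'k" where
  "table_bracket u v m = (\<Sum>a\<in>UNIV. \<Sum>b\<in>UNIV. u a * v b * structure_const a b m)"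

lemma table_bracket_sum_left:
  "table_bracket (\<lambda>a. \<Sum>i\<in>I. c i * f i a) v m = (\<Sum>i\<in>I. c i * table_bracket (f i) v m)"
proof -
  have "table_bracket (\<lambda>a. \<Sum>i\<in>I. c i * f i a) v m
      = (\<Sum>a\<in>UNIV. \<Sum>b\<in>UNIV. \<Sum>i\<in>I. c i * (f i a * v b * structure_const a b m))"
    by (simp add: table_bracket_def sum_distrib_right mult.assoc)
  also have "\<dots> = (\<Sum>a\<in>UNIV. \<Sum>i\<in>I. \<Sum>b\<in>UNIV. c i * (f i a * v b * structure_const a b m))"
    by (intro sum.cong refl sum.swap)
  also have "\<dots> = (\<Sum>i\<in>I. \<Sum>a\<in>UNIV. \<Sum>b\<in>UNIV. c i * (f i a * v b * structure_const a b m))"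
    by (rule sum.swap)
  finally show ?thesis
    by (simp add: table_bracket_def sum_distrib_left)
qed

lemma table_bracket_sum_right:
  "table_bracket u (\<lambda>a. \<Sum>i\<in>I. c i * f i a) m = (\<Sum>i\<in>I. c i * table_bracket u (f i) m)"
proof -
  have "table_bracket u (\<lambda>a. \<Sum>i\<in>I. c i * f i a) m
      = (\<Sum>a\<in>UNIV. \<Sum>b\<in>UNIV. \<Sum>i\<in>I. c i * (u a * f i b * structure_const a b m))"
    by (simp add: table_bracket_def sum_distrib_right sum_distrib_left ac_simps)
  also have "\<dots> = (\<Sum>a\<in>UNIV. \<Sum>i\<in>I. \<Sum>b\<in>UNIV. c i * (u a * f i b * structure_const a b m))"
    by (intro sum.cong refl sum.swap)
  also have "\<dots> = (\<Sum>i\<in>I. \<Sum>a\<in>UNIV. \<Sum>b\<in>UNIV. c i * (u a * f i b * structure_const a b m))"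
    by (rule sum.swap)
  finally show ?thesis
    by (simp add: table_bracket_def sum_distrib_left)
qed

lemma sum_unit_mult [simp]: "(\<Sum>k\<in>UNIV. unit i k * g k) = g i"
  using sum_delta_mult[of i 1 g] by (simp add: unit_def eq_commute)

lemma table_bracket_unit_left: "table_bracket (unit a) v m = (\<Sum>b\<in>UNIV. structure_const a b m * v b)"
proof -
  have "table_bracket (unit a) v m = (\<Sum>k\<in>UNIV. unit a k * (\<Sum>b\<in>UNIV. structure_const k b m * v b))"
    by (simp add: table_bracket_def sum_distrib_left ac_simps del: sum_unit_mult)
  then show ?thesis by simp
qed

lemma table_bracket_unit_unit: "table_bracket (unit a) (unit b) = structure_const a b"
  by (rule ext) (simp add: table_bracket_unit_left mult.commute[of _ "unit b _"])

context char3_field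
begin

lemma alternating_structure: "alternating (structure_const :: idx \<Rightarrow> idx \<Rightarrow> idx \<Rightarrow> 'k)"
  by (rule alternating_test_sound[OF alternating_test_structure])

lemma structure_anticommute: "structure_const a b m = - (structure_const b a m :: 'k)"
  using alternating_structure unfolding alternating_def by blast

lemma eq_minus_self: "x = - x \<Longrightarrow> x = (0 :: 'k)"
proof -
  assume "x = - x"
  then have "2 * x = 0"
    by (simp add: eq_neg_iff_add_eq_0)
  then show "x = 0"
    by (simp add: two_eq_minus_1)
qed

lemma table_bracket_self: "table_bracket u u m = (0 :: 'k)"
proof (rule eq_minus_self)
  have "table_bracket u u m = (\<Sum>b\<in>UNIV. \<Sum>a\<in>UNIV. u a * u b * structure_const a b m)"
    unfolding table_bracket_def by (rule sum.swap)
  also have "\<dots> = (\<Sum>b\<in>UNIV. \<Sum>a\<in>UNIV. - (u b * u a * structure_const b a m))"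
  proof (intro sum.cong refl)
    fix a b
    show "u a * u b * structure_const a b m = - (u b * u a * structure_const b a m)"
      by (subst structure_anticommute) simp
  qed
  also have "\<dots> = - table_bracket u u m"
    by (simp add: table_bracket_def sum_negf)
  finally show "table_bracket u u m = - table_bracket u u m" .
qed

text \<open>The Jacobi sum occurs twice in the cocycle condition for the bracket, once from the terms \<open>[a, [b, d]]\<close>
  and once from the terms \<open>[[a, b], d]\<close>; an element vanishes if its double does, because \<open>2 = -1\<close>.\<close>

lemma structure_jacobi:
  "(\<Sum>k\<in>UNIV. structure_const b d k * structure_const a k m)
   + (\<Sum>k\<in>UNIV. structure_const d a k * structure_const b k m)
   + (\<Sum>k\<in>UNIV. structure_const a b k * structure_const d k m) = (0 :: 'k)"
proof -
  let ?N = "structure_const :: idx \<Rightarrow> idx \<Rightarrow> idx \<Rightarrow> 'k"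
  let ?T = "\<lambda>a b d. \<Sum>k\<in>UNIV. ?N b d k * ?N a k m"
  have e1: "(\<Sum>k\<in>UNIV. ?N a k m * ?N b d k) = ?T a b d"
    by (simp add: sum_negf mult.commute)
  have e2: "(\<Sum>k\<in>UNIV. ?N b k m * ?N a d k) = - ?T b d a"
    by (simp add: structure_anticommute[of a d] sum_negf mult.commute)
  have e3: "(\<Sum>k\<in>UNIV. ?N d k m * ?N a b k) = ?T d a b"
    by (simp add: sum_negf mult.commute)
  have e4: "(\<Sum>k\<in>UNIV. ?N a b k * ?N k d m) = - ?T d a b"
    by (simp add: structure_anticommute[of _ d] sum_negf mult.commute)
  have e5: "(\<Sum>k\<in>UNIV. ?N a d k * ?N k b m) = ?T b d a"
    by (simp add: structure_anticommute[of a d] structure_anticommute[of _ b] sum_negf mult.commute)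
  have e6: "(\<Sum>k\<in>UNIV. ?N b d k * ?N k a m) = - ?T a b d"
    by (simp add: structure_anticommute[of _ a] sum_negf mult.commute)
  have "cocycle_defect ?N ?N a b d m = 0"
    by (rule cocycle_test_sound[OF cocycle_test_structure alternating_test_structure
          alternating_test_structure])
  then have zero: "?T a b d - - ?T b d a + ?T d a b - - ?T d a b + ?T b d a - - ?T a b d = 0"
    by (simp only: cocycle_defect_def e1 e2 e3 e4 e5 e6)
  have double: "x - - y + z - - z + y - - x = - (x + y + z)" for x y z :: 'k
  proof -
    have "x - - y + z - - z + y - - x = 2 * (x + y + z)"
      by (simp add: algebra_simps)
    then show ?thesis
      by (simp add: two_eq_minus_1)
  qed
  show ?thesis
    using trans[OF zero[symmetric] double] by (simp only: neg_0_equal_iff_equal)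
qed

lemma table_bracket_nested:
  "table_bracket u (table_bracket v w) m = (\<Sum>a\<in>UNIV. \<Sum>b\<in>UNIV. \<Sum>d\<in>UNIV.
     u a * v b * w d * (\<Sum>k\<in>UNIV. structure_const b d k * structure_const a k m))"
proof -
  have "table_bracket u (table_bracket v w) m = (\<Sum>a\<in>UNIV. \<Sum>k\<in>UNIV. \<Sum>b\<in>UNIV. \<Sum>d\<in>UNIV.
      u a * v b * w d * (structure_const b d k * structure_const a k m))"
    by (simp add: table_bracket_def sum_distrib_left sum_distrib_right ac_simps)
  also have "\<dots> = (\<Sum>a\<in>UNIV. \<Sum>b\<in>UNIV. \<Sum>k\<in>UNIV. \<Sum>d\<in>UNIV.
      u a * v b * w d * (structure_const b d k * structure_const a k m))"
    by (intro sum.cong refl sum.swap)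
  also have "\<dots> = (\<Sum>a\<in>UNIV. \<Sum>b\<in>UNIV. \<Sum>d\<in>UNIV. \<Sum>k\<in>UNIV.
      u a * v b * w d * (structure_const b d k * structure_const a k m))"
    by (intro sum.cong refl sum.swap)
  finally show ?thesis
    by (simp add: sum_distrib_left)
qed

lemma table_bracket_jacobi: "table_bracket u (table_bracket v w) m + table_bracket v (table_bracket w u) m + table_bracket w (table_bracket u v) m = (0 :: 'k)"
proof -
  let ?T = "\<lambda>a b d. (\<Sum>k\<in>UNIV. structure_const b d k * structure_const a k m) :: 'k"
  have 1: "table_bracket v (table_bracket w u) m
      = (\<Sum>a\<in>UNIV. \<Sum>b\<in>UNIV. \<Sum>d\<in>UNIV. u a * v b * w d * ?T b d a)"
  proof -
    have "table_bracket v (table_bracket w u) m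
        = (\<Sum>b\<in>UNIV. \<Sum>d\<in>UNIV. \<Sum>a\<in>UNIV. u a * v b * w d * ?T b d a)"
      unfolding table_bracket_nested by (intro sum.cong refl) (simp only: ac_simps)
    also have "\<dots> = (\<Sum>b\<in>UNIV. \<Sum>a\<in>UNIV. \<Sum>d\<in>UNIV. u a * v b * w d * ?T b d a)"
      by (intro sum.cong refl sum.swap)
    also have "\<dots> = (\<Sum>a\<in>UNIV. \<Sum>b\<in>UNIV. \<Sum>d\<in>UNIV. u a * v b * w d * ?T b d a)"
      by (rule sum.swap)
    finally show ?thesis .
  qed
  have 2: "table_bracket w (table_bracket u v) m
      = (\<Sum>a\<in>UNIV. \<Sum>b\<in>UNIV. \<Sum>d\<in>UNIV. u a * v b * w d * ?T d a b)"
  proof -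
    have "table_bracket w (table_bracket u v) m
        = (\<Sum>d\<in>UNIV. \<Sum>a\<in>UNIV. \<Sum>b\<in>UNIV. u a * v b * w d * ?T d a b)"
      unfolding table_bracket_nested by (intro sum.cong refl) (simp only: ac_simps)
    also have "\<dots> = (\<Sum>a\<in>UNIV. \<Sum>d\<in>UNIV. \<Sum>b\<in>UNIV. u a * v b * w d * ?T d a b)"
      by (rule sum.swap)
    also have "\<dots> = (\<Sum>a\<in>UNIV. \<Sum>b\<in>UNIV. \<Sum>d\<in>UNIV. u a * v b * w d * ?T d a b)"
      by (intro sum.cong refl sum.swap)
    finally show ?thesis .
  qed
  have "table_bracket u (table_bracket v w) m + table_bracket v (table_bracket w u) m + table_bracket w (table_bracket u v) m
      = (\<Sum>a\<in>UNIV. \<Sum>b\<in>UNIV. \<Sum>d\<in>UNIV. u a * v b * w d * (?T a b d + ?T b d a + ?T d a b))"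
    unfolding table_bracket_nested[of u] 1 2 by (simp only: sum.distrib distrib_left)
  then show ?thesis
    by (simp only: structure_jacobi mult_zero_right sum.neutral_const)
qed

end

primrec generator_idx :: "3 chevalley \<Rightarrow> idx" where
  "generator_idx (GX i) = (if i = 1 then X1 else if i = 2 then X2 else X3)"
| "generator_idx (GY i) = (if i = 1 then Y1 else if i = 2 then Y2 else Y3)"
| "generator_idx (GH i) = (if i = 1 then H1 else if i = 2 then H2 else H3)"

primrec eval_word :: "3 chevalley word \<Rightarrow> idx \<Rightarrow> 'k::field" where
  "eval_word (Gen g) = unit (generator_idx g)"
| "eval_word (Br u v) = table_bracket (eval_word u) (eval_word v)"

definition eval :: "(3 chevalley, 'k::field) free_alg \<Rightarrow> idx \<Rightarrow> 'k" where
  "eval p m = (\<Sum>w\<in>Poly_Mapping.keys p. Poly_Mapping.lookup p w * eval_word w m)"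

lemma eval_superset:
  "finite A \<Longrightarrow> Poly_Mapping.keys p \<subseteq> A \<Longrightarrow> eval p m = (\<Sum>w\<in>A. Poly_Mapping.lookup p w * eval_word w m)"
  unfolding eval_def by (intro sum.mono_neutral_left) (auto simp: in_keys_iff)

lemma eval_add: "eval (p + q) m = eval p m + eval q m"
proof -
  let ?A = "Poly_Mapping.keys p \<union> Poly_Mapping.keys q"
  have "Poly_Mapping.keys (p + q) \<subseteq> ?A" by (rule Poly_Mapping.keys_add)
  then show ?thesis
    by (simp add: eval_superset[of ?A] lookup_add distrib_right sum.distrib)
qed

lemma eval_fscl: "eval (fscl a p) m = a * eval p m"
  by (simp add: eval_superset[OF _ keys_fscl] eval_def[of p] sum_distrib_left mult.assoc)

lemma eval_0 [simp]: "eval 0 m = 0"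
  by (simp add: eval_def)

lemma eval_diff: "eval (p - q) m = eval p m - eval q m"
  using eval_add[of "p - q" q m] by simp

lemma eval_sum: "eval (\<Sum>i\<in>I. f i) m = (\<Sum>i\<in>I. eval (f i) m)"
  by (induction I rule: infinite_finite_induct) (simp_all add: eval_add)

lemma eval_single: "eval (Poly_Mapping.single w a) m = a * eval_word w m"
  by (simp add: eval_superset[of "{w}"])

lemma eval_gen: "eval (gen g) = unit (generator_idx g)"
  by (rule ext) (simp add: gen_def eval_single)

lemma eval_fbr: "eval (fbr p q) = table_bracket (eval p) (eval q)"
proof
  fix m
  have "eval p = (\<lambda>a. \<Sum>u\<in>Poly_Mapping.keys p. Poly_Mapping.lookup p u * eval_word u a)"
    "eval q = (\<lambda>a. \<Sum>u\<in>Poly_Mapping.keys q. Poly_Mapping.lookup q u * eval_word u a)"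
    by (rule ext, rule eval_def)+
  then have "table_bracket (eval p) (eval q) m
      = (\<Sum>u\<in>Poly_Mapping.keys p. \<Sum>v\<in>Poly_Mapping.keys q.
          Poly_Mapping.lookup p u * Poly_Mapping.lookup q v * table_bracket (eval_word u) (eval_word v) m)"
    by (simp add: table_bracket_sum_left table_bracket_sum_right sum_distrib_left mult.assoc)
  then show "eval (fbr p q) m = table_bracket (eval p) (eval q) m"
    by (simp add: fbr_def eval_sum eval_single)
qed

primrec idx_degree :: "idx \<Rightarrow> int" where
  "idx_degree X1 = 1" | "idx_degree X2 = 1" | "idx_degree X3 = 1" | "idx_degree X4 = 2"
| "idx_degree X5 = 2" | "idx_degree X6 = 3" | "idx_degree X7 = 3" | "idx_degree X8 = 4"
| "idx_degree X9 = 5" | "idx_degree X10 = 6" | "idx_degree X11 = 7" | "idx_degree X12 = 8"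
| "idx_degree X13 = 9" | "idx_degree Y1 = - 1" | "idx_degree Y2 = - 1" | "idx_degree Y3 = - 1"
| "idx_degree Y4 = - 2" | "idx_degree Y5 = - 2" | "idx_degree Y6 = - 3" | "idx_degree Y7 = - 3"
| "idx_degree Y8 = - 4" | "idx_degree Y9 = - 5" | "idx_degree Y10 = - 6" | "idx_degree Y11 = - 7"
| "idx_degree Y12 = - 8" | "idx_degree Y13 = - 9" | "idx_degree H1 = 0" | "idx_degree H2 = 0"
| "idx_degree H3 = 0"

lemma row_coef_nonzeroE:
  assumes "row_coef r j m \<noteq> 0"
  obtains t where "(j, m, t) \<in> set r"
  using assms by (induction r j m rule: row_coef.induct) (auto split: if_splits)

lemma structure_row_degree:
  "(b, m, t) \<in> set (structure_row a) \<Longrightarrow> idx_degree m = idx_degree a + idx_degree b"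
proof -
  have "list_all (\<lambda>(b, m, t). idx_degree m = idx_degree a + idx_degree b) (structure_row a)"
    by (cases a) simp_all
  then show "(b, m, t) \<in> set (structure_row a) \<Longrightarrow> idx_degree m = idx_degree a + idx_degree b"
    by (auto simp: list_all_iff)
qed

lemma table_bracket_nonzeroE:
  assumes "table_bracket u v m \<noteq> 0"
  obtains a b where "u a \<noteq> 0" "v b \<noteq> 0" "idx_degree m = idx_degree a + idx_degree b"
proof -
  obtain a where "(\<Sum>b\<in>UNIV. u a * v b * structure_const a b m) \<noteq> 0"
    using assms unfolding table_bracket_def by (rule sum.not_neutral_contains_not_neutral)
  then obtain b where "u a * v b * structure_const a b m \<noteq> 0"
    by (rule sum.not_neutral_contains_not_neutral)
  then show ?thesis
    using that[of a b] by (auto elim: row_coef_nonzeroE dest: structure_row_degree)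
qed

lemma generator_idx_degree: "idx_degree (generator_idx g) = word_degree (Gen g)"
  by (cases g) auto

lemma eval_word_degree: "eval_word w m \<noteq> 0 \<Longrightarrow> idx_degree m = word_degree w"
proof (induction w arbitrary: m)
  case (Gen g)
  then show ?case
    using generator_idx_degree[of g] by (auto simp: unit_def split: if_splits)
next
  case (Br u v)
  then show ?case
    by (auto elim!: table_bracket_nonzeroE)
qed

lemma eval_hom_component: "eval (hom_component d p) m = (if idx_degree m = d then eval p m else 0)"
proof -
  have "eval (hom_component d p) m
      = (\<Sum>w\<in>{w \<in> Poly_Mapping.keys p. word_degree w = d}. Poly_Mapping.lookup p w * eval_word w m)"
    by (simp add: hom_component_def eval_sum eval_single)
  also have "\<dots> = (\<Sum>w\<in>Poly_Mapping.keys p.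
      if idx_degree m = d then Poly_Mapping.lookup p w * eval_word w m else 0)"
    using eval_word_degree[of _ m] by (intro sum.mono_neutral_cong_left) auto
  finally show ?thesis
    by (simp add: eval_def)
qed

text \<open>The kernel of the homomorphism from the free algebra onto the table algebra; it turns out to be the
  Cartan ideal.\<close>

definition eval_kernel :: "(3 chevalley, 'k::field) free_alg set" where
  "eval_kernel = {p. eval p = (\<lambda>m. 0)}"

lemma table_bracket_zero [simp]: "table_bracket (\<lambda>m. 0) v = (\<lambda>m. 0)" "table_bracket u (\<lambda>m. 0) = (\<lambda>m. 0)"
  by (simp_all add: table_bracket_def fun_eq_iff)

lemma is_ideal_eval_kernel: "is_ideal eval_kernel"
  unfolding is_ideal_def free.subspace_def
  by (auto simp: eval_kernel_def eval_fbr) (auto simp: eval_add eval_fscl fun_eq_iff)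

lemma homogeneous_eval_kernel: "homogeneous eval_kernel"
  by (auto simp: homogeneous_def eval_kernel_def eval_hom_component fun_eq_iff)

lemma generator_idx_GH_inject: "generator_idx (GH i) = generator_idx (GH j) \<longleftrightarrow> i = j"
  using exhaust_3[of i] exhaust_3[of j] by auto

lemma span_cartan_eval_kernel:
  assumes "p \<in> free.span (range (\<lambda>i. gen (GH i)))" "p \<in> eval_kernel"
  shows "p = 0"
proof -
  have *: "\<forall>w. Poly_Mapping.lookup p w
      = (case w of Gen (GH i) \<Rightarrow> eval p (generator_idx (GH i)) | _ \<Rightarrow> 0)"
    using assms(1)
  proof (induction rule: free.span_induct_alt)
    case base
    show ?case
      by (auto split: word.splits chevalley.splits)
  next
    case (step c x y)
    then obtain j where "x = gen (GH j)" by blast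
    then have "\<forall>w. Poly_Mapping.lookup x w
        = (case w of Gen (GH i) \<Rightarrow> eval x (generator_idx (GH i)) | _ \<Rightarrow> 0)"
      by (auto simp: eval_single unit_def gen_def lookup_single when_def generator_idx_GH_inject
          simp del: generator_idx.simps split: word.splits chevalley.splits)
    with step.IH show ?case
      by (auto simp: lookup_add eval_add eval_fscl split: word.splits chevalley.splits)
  qed
  then show ?thesis
    using assms(2) by (intro poly_mapping_eqI)
      (auto simp: eval_kernel_def split: word.splits chevalley.splits)
qed

text \<open>For a basis vector \<open>m\<close> of nonzero degree, a generator \<open>g\<close> of opposite sign and an index \<open>k\<close> such that \<open>m\<close>
  is the only basis vector whose bracket with \<open>g\<close> involves \<open>k\<close>. Such a choice exists because the
  root spaces are one-dimensional and \<open>[g, m] \<noteq> 0\<close> for some \<open>g\<close>.\<close>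

primrec separator :: "idx \<Rightarrow> (3 chevalley \<times> idx) option" where
  "separator X1 = Some (GY 1, H1)" | "separator X2 = Some (GY 2, H2)"
| "separator X3 = Some (GY 3, H3)" | "separator X4 = Some (GY 1, X2)"
| "separator X5 = Some (GY 2, X3)" | "separator X6 = Some (GY 1, X5)"
| "separator X7 = Some (GY 3, X5)" | "separator X8 = Some (GY 1, X7)"
| "separator X9 = Some (GY 2, X8)" | "separator X10 = Some (GY 3, X9)"
| "separator X11 = Some (GY 3, X10)" | "separator X12 = Some (GY 2, X11)"
| "separator X13 = Some (GY 1, X12)" | "separator Y1 = Some (GX 1, H1)"
| "separator Y2 = Some (GX 2, H2)" | "separator Y3 = Some (GX 3, H3)"
| "separator Y4 = Some (GX 1, Y2)" | "separator Y5 = Some (GX 2, Y3)"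
| "separator Y6 = Some (GX 1, Y5)" | "separator Y7 = Some (GX 3, Y5)"
| "separator Y8 = Some (GX 1, Y7)" | "separator Y9 = Some (GX 2, Y8)"
| "separator Y10 = Some (GX 3, Y9)" | "separator Y11 = Some (GX 3, Y10)"
| "separator Y12 = Some (GX 2, Y11)" | "separator Y13 = Some (GX 1, Y12)"
| "separator H1 = None" | "separator H2 = None"
| "separator H3 = None"

lemma separator_exists:
  assumes "idx_degree m \<noteq> 0"
  obtains g k t where "preimages k (structure_row (generator_idx g)) = [(m, t)]" "t \<noteq> Zero"
    "nat \<bar>idx_degree m + word_degree (Gen g)\<bar> < nat \<bar>idx_degree m\<bar>"
proof -
  obtain g k where gk: "separator m = Some (g, k)"
    using assms by (cases m) auto
  then have "\<exists>t. preimages k (structure_row (generator_idx g)) = [(m, t)] \<and> t \<noteq> Zero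
      \<and> nat \<bar>idx_degree m + word_degree (Gen g)\<bar> < nat \<bar>idx_degree m\<bar>"
    by (cases m) auto
  then show ?thesis
    using that by blast
qed

text \<open>Induction on the absolute value of the degree of a homogeneous element \<open>p\<close> of the ideal. In degree 0, \<open>p\<close>
  is a combination of the \<open>h\<^sub>i\<close> modulo the relations, so it lies in the relations by the assumption on the
  intersection. In degree \<open>d \<noteq> 0\<close>, the brackets of \<open>p\<close> with the generators that lower \<open>\<bar>d\<bar>\<close> are mapped to
  zero by the induction hypothesis, and a separating generator then recovers each coordinate of \<open>p\<close>.\<close>

lemma homogeneous_ideal_le_eval_kernel:
  fixes I :: "(3 chevalley, 'k::field) free_alg set"
  assumes I: "is_ideal I" and hom: "homogeneous I" and R: "presentation_ideal (chevalley_relations A) \<subseteq> I"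
    and cartan: "I \<inter> free.span (range (\<lambda>i. gen (GH i))) \<subseteq> presentation_ideal (chevalley_relations A)"
    and R_kernel: "presentation_ideal (chevalley_relations A) \<subseteq> eval_kernel"
  shows "I \<subseteq> eval_kernel"
proof -
  have subI: "free.subspace I"
    using I by (simp add: is_ideal_def)
  have homog: "eval p m = 0" if "p \<in> I" "\<And>w. w \<in> Poly_Mapping.keys p \<Longrightarrow> word_degree w = d" for p d m
    using that
  proof (induction "nat \<bar>d\<bar>" arbitrary: p d m rule: less_induct)
    case less
    show ?case
    proof (cases "d = 0")
      case True
      then obtain h r where hr: "h \<in> free.span (range (\<lambda>i. gen (GH i)))"
        "r \<in> presentation_ideal (chevalley_relations A)" "p = h + r"
        using degree_0_cartan_mod_rels[of p A] less.prems by blast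
      then have "p - r \<in> I"
        using less.prems R by (intro free.subspace_diff[OF subI]) auto
      then have "h \<in> presentation_ideal (chevalley_relations A)"
        using hr cartan by auto
      then have "p \<in> eval_kernel"
        using hr R_kernel free.subspace_add[OF subspace_rels] by blast
      then show ?thesis
        by (simp add: eval_kernel_def)
    next
      case False
      show ?thesis
      proof (rule ccontr)
        assume nz: "eval p m \<noteq> 0"
        then obtain w where "w \<in> Poly_Mapping.keys p" "Poly_Mapping.lookup p w * eval_word w m \<noteq> 0"
          unfolding eval_def by (rule sum.not_neutral_contains_not_neutral)
        then have m: "idx_degree m = d"
          using less.prems(2) eval_word_degree[of w m] by auto
        then obtain g k t where gk: "preimages k (structure_row (generator_idx g)) = [(m, t)]" "t \<noteq> Zero"
          "nat \<bar>d + word_degree (Gen g)\<bar> < nat \<bar>d\<bar>"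
          using separator_exists[of m] False by metis
        have "Poly_Mapping.keys (fbr (gen g) p) \<subseteq> Br (Gen g) ` Poly_Mapping.keys p"
        proof -
          have "fbr (gen g) p = (\<Sum>v\<in>Poly_Mapping.keys p.
              Poly_Mapping.single (Br (Gen g) v) (Poly_Mapping.lookup p v))"
            by (simp add: fbr_superset[of "{Gen g}" "Poly_Mapping.keys p"] gen_def)
          then show ?thesis
            by (auto simp: in_keys_iff lookup_sum lookup_single when_def
                elim!: sum.not_neutral_contains_not_neutral split: if_splits)
        qed
        then have "\<And>w. w \<in> Poly_Mapping.keys (fbr (gen g) p) \<Longrightarrow> word_degree w = d + word_degree (Gen g)"
          using less.prems(2) by fastforce
        moreover have "fbr (gen g) p \<in> I"
          using I less.prems(1) by (simp add: is_ideal_def)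
        ultimately have "eval (fbr (gen g) p) k = 0"
          using less.hyps gk(3) by blast
        then have "combination [(m, t)] (eval p) = 0"
          by (simp only: eval_fbr eval_gen table_bracket_unit_left combination_preimages gk(1))
        then show False
          using nz gk(2) by simp
      qed
    qed
  qed
  show ?thesis
  proof
    fix p assume p: "p \<in> I"
    have "eval p m = 0" for m
    proof -
      have "Poly_Mapping.keys (hom_component (idx_degree m) p)
          \<subseteq> {w \<in> Poly_Mapping.keys p. word_degree w = idx_degree m}"
        unfolding hom_component_def
        by (rule subsetI) (auto simp: in_keys_iff lookup_sum lookup_single when_def
            elim!: sum.not_neutral_contains_not_neutral split: if_splits)
      moreover have "hom_component (idx_degree m) p \<in> I"
        using hom p by (simp add: homogeneous_def)
      ultimately have "eval (hom_component (idx_degree m) p) m = 0"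
        using homog by blast
      then show ?thesis
        by (simp add: eval_hom_component)
    qed
    then show "p \<in> eval_kernel"
      by (simp add: eval_kernel_def fun_eq_iff)
  qed
qed

context char3_field
begin

lemma relations_eval_kernel:
  "presentation_ideal (chevalley_relations br3_cartan) \<subseteq> (eval_kernel :: (3 chevalley, 'k) free_alg set)"
proof -
  have jac: "fbr p p \<in> eval_kernel"
    "fbr p (fbr q r) + fbr q (fbr r p) + fbr r (fbr p q) \<in> eval_kernel"
    for p q r :: "(3 chevalley, 'k) free_alg"
    by (simp_all add: eval_kernel_def eval_fbr fun_eq_iff eval_add table_bracket_self table_bracket_jacobi)
  have minus_minus_1: "- (1 :: 'k) - 1 = 1"
    by (simp add: two_eq_minus_1)
  have "fbr (gen (GX i)) (gen (GY j)) - (if i = j then gen (GH i) else 0)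
        \<in> (eval_kernel :: (3 chevalley, 'k) free_alg set)"
    "fbr (gen (GH i)) (gen (GH j)) \<in> (eval_kernel :: (3 chevalley, 'k) free_alg set)"
    "fbr (gen (GH i)) (gen (GX j)) - fscl (br3_cartan $ i $ j) (gen (GX j))
        \<in> (eval_kernel :: (3 chevalley, 'k) free_alg set)"
    "fbr (gen (GH i)) (gen (GY j)) - fscl (- (br3_cartan $ i $ j)) (gen (GY j))
        \<in> (eval_kernel :: (3 chevalley, 'k) free_alg set)" for i j
    using exhaust_3[of i] exhaust_3[of j] unfolding eval_kernel_def mem_Collect_eq
    by (auto simp: fun_eq_iff eval_diff eval_fscl eval_fbr eval_gen table_bracket_unit_unit unit_apply
        br3_cartan_def two_eq_minus_1)
  then have "chevalley_relations br3_cartan \<subseteq> (eval_kernel :: (3 chevalley, 'k) free_alg set)"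
    unfolding chevalley_relations_def by (intro Un_least subsetI) (simp only: mem_Collect_eq, metis)+
  then show ?thesis
    unfolding presentation_ideal_def ideal_gen_def
    using jac by (intro Inter_lower) (auto simp: is_ideal_eval_kernel)
qed

text \<open>The kernel is one of the ideals whose sum is the Cartan ideal, and it contains all of them.\<close>

lemma cartan_ideal_br3: "cartan_ideal br3_cartan = (eval_kernel :: (3 chevalley, 'k) free_alg set)"
proof
  let ?R = "presentation_ideal (chevalley_relations br3_cartan) :: (3 chevalley, 'k) free_alg set"
  have "free.subspace (eval_kernel :: (3 chevalley, 'k) free_alg set)"
    by (rule conjunct1[OF is_ideal_eval_kernel[unfolded is_ideal_def]])
  then show "cartan_ideal br3_cartan \<subseteq> (eval_kernel :: (3 chevalley, 'k) free_alg set)"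
    unfolding cartan_ideal_def Let_def
    using homogeneous_ideal_le_eval_kernel relations_eval_kernel
    by (intro free.span_minimal Un_least Sup_least) auto
  have "0 \<in> ?R"
    by (rule free.subspace_0[OF subspace_rels])
  then have "eval_kernel \<inter> free.span (range (\<lambda>i. gen (GH i))) \<subseteq> ?R"
    by (auto dest: span_cartan_eval_kernel)
  then have "eval_kernel \<in> {I. is_ideal I \<and> homogeneous I \<and> ?R \<subseteq> I
      \<and> I \<inter> free.span (range (\<lambda>i. gen (GH i))) \<subseteq> ?R}"
    by (simp add: is_ideal_eval_kernel homogeneous_eval_kernel relations_eval_kernel)
  then show "eval_kernel \<subseteq> (cartan_ideal br3_cartan :: (3 chevalley, 'k) free_alg set)"
    unfolding cartan_ideal_def Let_def
    by (intro order.trans[OF _ free.span_superset] le_supI2 Union_upper)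
qed

end


section \<open>Coordinates on the Brown algebra\<close>

text \<open>In characteristic 3 the value does not depend on the representative, because the Cartan ideal is the
  kernel of the evaluation.\<close>

definition coord :: "'k::field br3 \<Rightarrow> idx \<Rightarrow> 'k" where
  "coord X = eval (rep_br3 X)"

primrec basis_vec :: "idx \<Rightarrow> 'k::field br3" where
  "basis_vec X1 = br3_x 1" | "basis_vec X2 = br3_x 2" | "basis_vec X3 = br3_x 3"
| "basis_vec X4 = br3_x 4" | "basis_vec X5 = br3_x 5" | "basis_vec X6 = br3_x 6"
| "basis_vec X7 = br3_x 7" | "basis_vec X8 = br3_x 8" | "basis_vec X9 = br3_x 9"
| "basis_vec X10 = br3_x 10" | "basis_vec X11 = br3_x 11" | "basis_vec X12 = br3_x 12"
| "basis_vec X13 = br3_x 13" | "basis_vec Y1 = br3_y 1" | "basis_vec Y2 = br3_y 2"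
| "basis_vec Y3 = br3_y 3" | "basis_vec Y4 = br3_y 4" | "basis_vec Y5 = br3_y 5"
| "basis_vec Y6 = br3_y 6" | "basis_vec Y7 = br3_y 7" | "basis_vec Y8 = br3_y 8"
| "basis_vec Y9 = br3_y 9" | "basis_vec Y10 = br3_y 10" | "basis_vec Y11 = br3_y 11"
| "basis_vec Y12 = br3_y 12" | "basis_vec Y13 = br3_y 13" | "basis_vec H1 = br3_h 1"
| "basis_vec H2 = br3_h 2" | "basis_vec H3 = br3_h 3"

lemma br3_basis_eq: "br3_basis = map basis_vec all_idx"
  by (simp add: br3_basis_def all_idx_def upt_rec numeral_eq_Suc)

lemma set_br3_basis: "set br3_basis = range basis_vec"
  by (simp add: br3_basis_eq set_all_idx)

lemma brackets_of_basis_vec: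
  "basis_vec X4 = br3_br (basis_vec X1) (basis_vec X2)" "basis_vec X5 = br3_br (basis_vec X2) (basis_vec X3)"
  "basis_vec X6 = br3_br (basis_vec X3) (basis_vec X4)" "basis_vec X7 = br3_br (basis_vec X3) (basis_vec X5)"
  "basis_vec X8 = br3_br (basis_vec X3) (basis_vec X6)" "basis_vec X9 = br3_br (basis_vec X5) (basis_vec X6)"
  "basis_vec X10 = br3_br (basis_vec X6) (basis_vec X7)" "basis_vec X11 = br3_br (basis_vec X7) (basis_vec X8)"
  "basis_vec X12 = br3_br (basis_vec X7) (basis_vec X9)" "basis_vec X13 = br3_br (basis_vec X8) (basis_vec X9)"
  "basis_vec Y4 = br3_br (basis_vec Y1) (basis_vec Y2)" "basis_vec Y5 = br3_br (basis_vec Y2) (basis_vec Y3)"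
  "basis_vec Y6 = br3_br (basis_vec Y3) (basis_vec Y4)" "basis_vec Y7 = br3_br (basis_vec Y3) (basis_vec Y5)"
  "basis_vec Y8 = br3_br (basis_vec Y3) (basis_vec Y6)" "basis_vec Y9 = br3_br (basis_vec Y5) (basis_vec Y6)"
  "basis_vec Y10 = br3_br (basis_vec Y6) (basis_vec Y7)" "basis_vec Y11 = br3_br (basis_vec Y7) (basis_vec Y8)"
  "basis_vec Y12 = br3_br (basis_vec Y7) (basis_vec Y9)" "basis_vec Y13 = br3_br (basis_vec Y8) (basis_vec Y9)"
  by (simp_all add: br3_x_def br3_y_def root_vectors_def Let_def)

lemma generators_basis_vec: "br3_gen g = basis_vec (generator_idx g)"
proof (cases g)
  case (GX i)
  then show ?thesis
    using exhaust_3[of i] by (auto simp: br3_x_def root_vectors_def Let_def)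
next
  case (GY i)
  then show ?thesis
    using exhaust_3[of i] by (auto simp: br3_y_def root_vectors_def Let_def)
next
  case (GH i)
  then show ?thesis
    using exhaust_3[of i] by (auto simp: br3_h_def)
qed

text \<open>Every basis vector is an iterated bracket of generators; this makes the Chevalley involution unique.\<close>

lemma basis_vec_induct:
  assumes gen: "\<And>g. P (br3_gen g)" and br: "\<And>X Y. P X \<Longrightarrow> P Y \<Longrightarrow> P (br3_br X Y)"
  shows "P (basis_vec i)"
proof -
  have g: "P (basis_vec X1)" "P (basis_vec X2)" "P (basis_vec X3)" "P (basis_vec Y1)" "P (basis_vec Y2)"
    "P (basis_vec Y3)" "P (basis_vec H1)" "P (basis_vec H2)" "P (basis_vec H3)"
    using gen[of "GX 1"] gen[of "GX 2"] gen[of "GX 3"] gen[of "GY 1"] gen[of "GY 2"] gen[of "GY 3"]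
      gen[of "GH 1"] gen[of "GH 2"] gen[of "GH 3"]
    by (simp_all add: generators_basis_vec del: basis_vec.simps)
  have x: "P (basis_vec X4)" "P (basis_vec X5)" "P (basis_vec Y4)" "P (basis_vec Y5)"
    by (simp_all only: brackets_of_basis_vec br g)
  have x': "P (basis_vec X6)" "P (basis_vec X7)" "P (basis_vec Y6)" "P (basis_vec Y7)"
    using g x by (simp_all only: brackets_of_basis_vec(3,4,13,14) br)
  have x'': "P (basis_vec X8)" "P (basis_vec X9)" "P (basis_vec X10)"
    "P (basis_vec Y8)" "P (basis_vec Y9)" "P (basis_vec Y10)"
    using g x x' by (simp_all only: brackets_of_basis_vec(5,6,7,15,16,17) br)
  have "P (basis_vec X11)" "P (basis_vec X12)" "P (basis_vec X13)"
    "P (basis_vec Y11)" "P (basis_vec Y12)" "P (basis_vec Y13)"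
    using g x' x'' by (simp_all only: brackets_of_basis_vec(8,9,10,18,19,20) br)
  with g x x' x'' show ?thesis
    by (cases i) (simp_all del: basis_vec.simps)
qed

context char3_field
begin

lemma coord_abs: "coord (abs_br3 p :: 'k br3) = eval p"
proof -
  have "cartan_rel br3_cartan (rep_br3 (abs_br3 p :: 'k br3)) p"
    by (rule Quotient3_rep_abs[OF Quotient3_br3 cartan_rel_refl])
  then have "rep_br3 (abs_br3 p :: 'k br3) - p \<in> eval_kernel"
    by (simp add: cartan_rel_def cartan_ideal_br3)
  then show ?thesis
    by (auto simp: eval_kernel_def coord_def fun_eq_iff eval_diff)
qed

lemma abs_rep_br3: "abs_br3 (rep_br3 X) = (X :: 'k br3)"
  by (rule Quotient3_abs_rep[OF Quotient3_br3])

lemma coord_inject: "coord X = coord Y \<longleftrightarrow> X = (Y :: 'k br3)"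
proof
  assume "coord X = coord Y"
  then have "rep_br3 X - rep_br3 Y \<in> (eval_kernel :: (3 chevalley, 'k) free_alg set)"
    by (simp add: eval_kernel_def coord_def fun_eq_iff eval_diff)
  then have "cartan_rel br3_cartan (rep_br3 X) (rep_br3 Y)"
    by (simp add: cartan_rel_def cartan_ideal_br3)
  then have "abs_br3 (rep_br3 X) = abs_br3 (rep_br3 Y)"
    by (simp add: br3.abs_eq_iff)
  then show "X = Y"
    by (simp add: abs_rep_br3)
qed simp

lemma coord_add: "coord (X + Y :: 'k br3) m = coord X m + coord Y m"
proof -
  have "X + Y = abs_br3 (rep_br3 X + rep_br3 Y)"
    by (metis abs_rep_br3 plus_br3.abs_eq)
  then show ?thesis
    by (simp add: coord_abs eval_add coord_def[of X] coord_def[of Y])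
qed

lemma coord_scl: "coord (br3_scl a X :: 'k br3) m = a * coord X m"
proof -
  have "br3_scl a X = abs_br3 (fscl a (rep_br3 X))"
    by (metis abs_rep_br3 br3_scl.abs_eq)
  then show ?thesis
    by (simp add: coord_abs eval_fscl coord_def[of X])
qed

lemma coord_br: "coord (br3_br X Y :: 'k br3) = table_bracket (coord X) (coord Y)"
proof -
  have "br3_br X Y = abs_br3 (fbr (rep_br3 X) (rep_br3 Y))"
    by (metis abs_rep_br3 br3_br.abs_eq)
  then show ?thesis
    by (simp add: coord_abs eval_fbr coord_def[of X] coord_def[of Y])
qed

lemma coord_0 [simp]: "coord (0 :: 'k br3) m = 0"
  using coord_scl[of 0 0 m] by simp

lemma coord_minus: "coord (- X :: 'k br3) m = - coord X m"
  using coord_add[of X "- X" m] by (simp add: eq_neg_iff_add_eq_0 add.commute)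

lemma coord_diff: "coord (X - Y :: 'k br3) m = coord X m - coord Y m"
  using coord_add[of X "- Y" m] by (simp add: coord_minus)

lemma coord_sum: "coord (\<Sum>i\<in>I. f i :: 'k br3) m = (\<Sum>i\<in>I. coord (f i) m)"
  by (induction I rule: infinite_finite_induct) (simp_all add: coord_add)

lemma br3_eqI: "(\<And>m. coord X m = coord Y m) \<Longrightarrow> X = (Y :: 'k br3)"
  using coord_inject[of X Y] by (simp add: fun_eq_iff)

lemma coord_gen: "coord (br3_gen g :: 'k br3) = unit (generator_idx g)"
  by (simp add: br3_gen.abs_eq coord_abs eval_gen)

lemma coord_basis_vec: "coord (basis_vec i :: 'k br3) = unit i"
proof -
  let ?e = "\<lambda>i. coord (basis_vec i :: 'k br3)"
  have g: "?e X1 = unit X1" "?e X2 = unit X2" "?e X3 = unit X3" "?e Y1 = unit Y1" "?e Y2 = unit Y2"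
    "?e Y3 = unit Y3" "?e H1 = unit H1" "?e H2 = unit H2" "?e H3 = unit H3"
    using coord_gen[of "GX 1"] coord_gen[of "GX 2"] coord_gen[of "GX 3"] coord_gen[of "GY 1"]
      coord_gen[of "GY 2"] coord_gen[of "GY 3"] coord_gen[of "GH 1"] coord_gen[of "GH 2"]
      coord_gen[of "GH 3"]
    by (simp_all add: generators_basis_vec del: basis_vec.simps)
  note rules = coord_br table_bracket_unit_unit
  have x: "?e X4 = unit X4" "?e X5 = unit X5" "?e Y4 = unit Y4" "?e Y5 = unit Y5"
    by (simp_all only: brackets_of_basis_vec rules g) (rule ext, simp add: unit_apply)+
  have x': "?e X6 = unit X6" "?e X7 = unit X7" "?e Y6 = unit Y6" "?e Y7 = unit Y7"
    by (simp_all only: brackets_of_basis_vec(3,4,13,14) rules g x) (rule ext, simp add: unit_apply)+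
  have x'': "?e X8 = unit X8" "?e X9 = unit X9" "?e X10 = unit X10"
    "?e Y8 = unit Y8" "?e Y9 = unit Y9" "?e Y10 = unit Y10"
    by (simp_all only: brackets_of_basis_vec(5,6,7,15,16,17) rules g x x') (rule ext, simp add: unit_apply)+
  have "?e X11 = unit X11" "?e X12 = unit X12" "?e X13 = unit X13"
    "?e Y11 = unit Y11" "?e Y12 = unit Y12" "?e Y13 = unit Y13"
    by (simp_all only: brackets_of_basis_vec(8,9,10,18,19,20) rules g x' x'') (rule ext, simp add: unit_apply)+
  with g x x' x'' show ?thesis
    by (cases i) (simp_all only:)
qed

lemma basis_expansion: "(\<Sum>i\<in>UNIV. br3_scl (coord X i) (basis_vec i)) = (X :: 'k br3)"
proof (rule br3_eqI)
  fix m
  have "coord (\<Sum>i\<in>UNIV. br3_scl (coord X i) (basis_vec i)) m = (\<Sum>i\<in>UNIV. unit m i * coord X i)"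
    unfolding coord_sum coord_scl coord_basis_vec by (intro sum.cong refl) (auto simp: unit_apply)
  then show "coord (\<Sum>i\<in>UNIV. br3_scl (coord X i) (basis_vec i)) m = coord X m"
    by simp
qed

lemma inj_basis_vec: "inj (basis_vec :: idx \<Rightarrow> 'k br3)"
proof (rule injI)
  fix i j assume "basis_vec i = (basis_vec j :: 'k br3)"
  then have "unit i i = (unit j i :: 'k)"
    by (metis coord_basis_vec)
  then show "i = j"
    by (simp add: unit_apply split: if_splits)
qed

lemma distinct_br3_basis: "distinct (br3_basis :: 'k br3 list)"
proof -
  have "distinct all_idx"
    by (simp add: all_idx_def)
  then show ?thesis
    unfolding br3_basis_eq distinct_map using inj_basis_vec inj_on_subset by blast
qed

lemma independent_br3_basis: "br3.independent (set (br3_basis :: 'k br3 list))"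
proof (rule br3.independent_if_scalars_zero)
  fix f :: "'k br3 \<Rightarrow> 'k" and x
  assume sum: "(\<Sum>v\<in>set br3_basis. br3_scl (f v) v) = 0" and "x \<in> (set br3_basis :: 'k br3 set)"
  then obtain i where i: "x = basis_vec i"
    unfolding set_br3_basis by blast
  have "0 = coord (\<Sum>j\<in>UNIV. br3_scl (f (basis_vec j)) (basis_vec j)) i"
    using sum by (simp add: set_br3_basis sum.reindex[OF inj_basis_vec])
  also have "\<dots> = (\<Sum>j\<in>UNIV. unit i j * f (basis_vec j))"
    unfolding coord_sum coord_scl coord_basis_vec by (intro sum.cong refl) (auto simp: unit_apply)
  finally show "f x = 0"
    by (simp add: i)
qed simp

lemma span_br3_basis: "br3.span (set (br3_basis :: 'k br3 list)) = UNIV"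
proof -
  have "X \<in> br3.span (set br3_basis)" for X :: "'k br3"
  proof -
    have "(\<Sum>i\<in>UNIV. br3_scl (coord X i) (basis_vec i)) \<in> br3.span (set br3_basis)"
      by (intro br3.span_sum br3.span_scale br3.span_base) (simp add: set_br3_basis)
    then show ?thesis
      by (simp add: basis_expansion)
  qed
  then show ?thesis by blast
qed

lemma dim_br3: "br3.dim (UNIV :: 'k br3 set) = 29"
proof -
  have "br3.dim (UNIV :: 'k br3 set) = card (set (br3_basis :: 'k br3 list))"
    by (rule br3.dim_eq_card[OF _ independent_br3_basis]) (simp add: span_br3_basis)
  then show ?thesis
    using distinct_br3_basis by (simp add: distinct_card) (simp add: br3_basis_eq all_idx_def)
qed

lemma hat_basis_vec: "hat (basis_vec i) X = coord (X :: 'k br3) i"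
proof -
  have "br3.representation (set br3_basis) X = (\<lambda>v. \<Sum>j\<in>UNIV. coord X j * (if v = basis_vec j then 1 else 0))"
  proof (subst basis_expansion[of X, symmetric], rule ext)
    fix v
    have span: "Y \<in> br3.span (set br3_basis)" for Y :: "'k br3"
      by (simp add: span_br3_basis)
    have mem: "(basis_vec j :: 'k br3) \<in> set br3_basis" for j
      by (simp add: set_br3_basis)
    show "br3.representation (set br3_basis) (\<Sum>j\<in>UNIV. br3_scl (coord X j) (basis_vec j)) v
        = (\<Sum>j\<in>UNIV. coord X j * (if v = basis_vec j then 1 else 0))"
      by (simp add: br3.representation_sum[OF independent_br3_basis] span
          br3.representation_scale[OF independent_br3_basis]
          br3.representation_basis[OF independent_br3_basis mem] eq_commute[of v])
  qed
  moreover have "(\<Sum>j\<in>UNIV. coord X j * (if basis_vec i = (basis_vec j :: 'k br3) then 1 else 0))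
      = (\<Sum>j\<in>UNIV. unit i j * coord X j)"
    by (intro sum.cong refl) (auto simp: unit_apply inj_eq[OF inj_basis_vec])
  ultimately show ?thesis
    by (simp add: hat_def)
qed

end


section \<open>Second cohomology of a Lie algebra\<close>

context lie_algebra
begin

lemma linear_iff:
  "Vector_Spaces.linear scl scl f \<longleftrightarrow>
     (\<forall>X Y. f (X + Y) = f X + f Y) \<and> (\<forall>a X. f (scl a X) = scl a (f X))"
  using vector_space_axioms module_axioms
  by (simp add: linear_iff_module_hom module_hom_def module_hom_axioms_def)

lemma cochain1_iff:
  "f \<in> cochain1 \<longleftrightarrow> (\<forall>X Y. f (X + Y) = f X + f Y) \<and> (\<forall>a X. f (scl a X) = scl a (f X))"
  by (simp add: cochain1_def linear_iff)

lemma cochain2_iff: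
  "c \<in> cochain2 \<longleftrightarrow>
     (\<forall>X Y Z. c X (Y + Z) = c X Y + c X Z) \<and> (\<forall>a X Y. c X (scl a Y) = scl a (c X Y)) \<and>
     (\<forall>X Y Z. c (X + Y) Z = c X Z + c Y Z) \<and> (\<forall>a X Y. c (scl a X) Y = scl a (c X Y)) \<and>
     (\<forall>X. c X X = 0)"
  by (auto simp: cochain2_def linear_iff)

lemma bilinear_cochain2:
  assumes "c \<in> cochain2"
  shows "c X (Y + Z) = c X Y + c X Z" "c X (scl a Y) = scl a (c X Y)"
    "c (X + Y) Z = c X Z + c Y Z" "c (scl a X) Y = scl a (c X Y)" "c X X = 0"
  using assms unfolding cochain2_iff by blast+

lemma alternating_cochain2:
  assumes "c \<in> cochain2"
  shows "c X Y = - c Y X"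
proof -
  have "c (X + Y) (X + Y) = c X Y + c Y X"
    unfolding bilinear_cochain2(1,3)[OF assms] by (simp add: bilinear_cochain2(5)[OF assms])
  then have "c X Y + c Y X = 0"
    by (simp add: bilinear_cochain2(5)[OF assms])
  then show ?thesis
    by (simp only: eq_neg_iff_add_eq_0)
qed

lemma br_cochain2: "br \<in> cochain2"
  by (simp add: cochain2_iff br_add_left br_add_right br_scl_left br_scl_right br_self)

lemmas br_anticommute = alternating_cochain2[OF br_cochain2]

lemma br_zero_right [simp]: "br X 0 = 0" and br_zero_left [simp]: "br 0 X = 0"
  using br_scl_right[of X 0 0] br_scl_left[of 0 0 X] by simp_all

lemma br_minus_right: "br X (- Y) = - br X Y" and br_minus_left: "br (- X) Y = - br X Y"
  using br_scl_right[of X "- 1" Y] br_scl_left[of "- 1" X Y] by simp_all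

lemma br_diff_right: "br X (Y - Z) = br X Y - br X Z" and br_diff_left: "br (Y - Z) X = br Y X - br Z X"
  using br_add_right[of X Y "- Z"] br_add_left[of Y "- Z" X] by (simp_all add: br_minus_right br_minus_left)

lemma br_br_left: "br (br X Y) Z = br X (br Y Z) - br Y (br X Z)"
  using jacobi[of X Y Z] br_anticommute[of Z X] br_anticommute[of Z "br X Y"]
  by (simp add: br_minus_right algebra_simps eq_neg_iff_add_eq_0)

lemma d1_cochain2:
  assumes "f \<in> cochain1"
  shows "d1 f \<in> cochain2"
proof -
  have "f (X + Y) = f X + f Y" "f (scl a X) = scl a (f X)" for a X Y
    using assms by (simp_all add: cochain1_iff)
  moreover from this(2)[of 0] have "f 0 = 0" by simp
  ultimately show ?thesis
    by (simp add: cochain2_iff d1_def br_add_left br_add_right br_scl_left br_scl_right br_self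
        scale_right_diff_distrib)
qed

lemma d2_d1:
  assumes "f \<in> cochain1"
  shows "d2 (d1 f) X Y Z = 0"
proof -
  have f_add: "f (X + Y) = f X + f Y" and f_scl: "f (scl a X) = scl a (f X)" for a X Y
    using assms by (simp_all add: cochain1_iff)
  have f_minus: "f (- X) = - f X" for X
    using f_scl[of "- 1" X] by simp
  have f_0: "f 0 = 0"
    using f_scl[of 0 0] by simp
  have "f (br X (br Y Z) + br Y (br Z X) + br Z (br X Y)) = 0"
    by (simp only: jacobi f_0)
  then have jac: "f (br X (br Y Z)) + f (br Y (br Z X)) + f (br Z (br X Y)) = 0"
    by (simp only: f_add)
  have "f (br (br X Y) Z) = - f (br Z (br X Y))" "f (br (br Y Z) X) = - f (br X (br Y Z))"
    by (simp_all only: br_anticommute[of "br _ _"] f_minus)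
  moreover have "br (br X Z) Y = br Y (br Z X)"
    using br_anticommute[of "br X Z" Y] br_anticommute[of Z X] by (simp add: br_minus_right)
  ultimately have "f (br (br X Y) Z) - f (br (br X Z) Y) + f (br (br Y Z) X) = 0"
    using jac by (simp add: neg_eq_iff_add_eq_0 algebra_simps)
  then show ?thesis
    by (simp add: d2_def d1_def br_add_right br_diff_right br_br_left[of _ _ "f _"] algebra_simps)
qed

lemma B2_subset_Z2: "B2 \<subseteq> Z2"
  by (auto simp: B2_def Z2_def d1_cochain2 d2_d1)

lemma d1_add: "d1 (\<lambda>X. f X + g X) = d1 f + d1 g"
  and d1_scl: "d1 (\<lambda>X. scl a (f X)) = cochain_scl a (d1 f)"
  by (simp_all add: fun_eq_iff d1_def br_add_right br_scl_right cochain_scl_def scale_right_diff_distrib)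

lemma B2_add: "b \<in> B2 \<Longrightarrow> b' \<in> B2 \<Longrightarrow> b + b' \<in> B2"
proof -
  assume "b \<in> B2" "b' \<in> B2"
  then obtain f g where fg: "f \<in> cochain1" "g \<in> cochain1" "b = d1 f" "b' = d1 g"
    by (auto simp: B2_def)
  then have "(\<lambda>X. f X + g X) \<in> cochain1" "b + b' = d1 (\<lambda>X. f X + g X)"
    by (auto simp: cochain1_iff d1_add scale_right_distrib)
  then show ?thesis
    by (simp add: B2_def)
qed

lemma B2_scl: "b \<in> B2 \<Longrightarrow> cochain_scl a b \<in> B2"
proof -
  assume "b \<in> B2"
  then obtain f where f: "f \<in> cochain1" "b = d1 f"
    by (auto simp: B2_def)
  then have "(\<lambda>X. scl a (f X)) \<in> cochain1" "cochain_scl a b = d1 (\<lambda>X. scl a (f X))"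
    by (auto simp: cochain1_iff d1_scl scale_right_distrib mult.commute)
  then show ?thesis
    by (simp add: B2_def)
qed

lemma B2_minus: "b \<in> B2 \<Longrightarrow> - b \<in> B2"
  using B2_scl[of b "- 1"] by (simp add: cochain_scl_def fun_Compl_def)

lemma Z2_add: "b \<in> Z2 \<Longrightarrow> b' \<in> Z2 \<Longrightarrow> b + b' \<in> Z2"
proof -
  assume b: "b \<in> Z2" "b' \<in> Z2"
  have "d2 (b + b') X Y Z = d2 b X Y Z + d2 b' X Y Z" for X Y Z
    by (simp add: d2_def br_add_right algebra_simps)
  then show ?thesis
    using b by (simp add: Z2_def cochain2_iff scale_right_distrib algebra_simps)
qed

lemma Z2_scl: "b \<in> Z2 \<Longrightarrow> cochain_scl a b \<in> Z2"
proof -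
  assume b: "b \<in> Z2"
  have "d2 (cochain_scl a b) X Y Z = scl a (d2 b X Y Z)" for X Y Z
    by (simp add: d2_def cochain_scl_def br_scl_right scale_right_diff_distrib scale_right_distrib)
  then show ?thesis
    using b by (simp add: Z2_def cochain2_iff cochain_scl_def scale_right_distrib mult.commute)
qed

lemma Z2_minus: "b \<in> Z2 \<Longrightarrow> - b \<in> Z2"
  using Z2_scl[of b "- 1"] by (simp add: cochain_scl_def fun_Compl_def)

lemma Z2_diff: "b \<in> Z2 \<Longrightarrow> b' \<in> Z2 \<Longrightarrow> b - b' \<in> Z2"
  using Z2_add[of b "- b'"] Z2_minus[of b'] by simp

lemma coh_class_eqI:
  assumes "c - c' \<in> B2"
  shows "coh_class c = coh_class c'"
proof -
  have "e - c \<in> B2 \<longleftrightarrow> e - c' \<in> B2" for e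
    using B2_add[OF _ assms, of "e - c"] B2_add[OF _ B2_minus[OF assms], of "e - c'"] by auto
  then show ?thesis
    by (simp add: coh_class_def)
qed

lemma subspace_Z2: "module.subspace cochain_scl Z2"
proof -
  interpret cochains: vector_space cochain_scl
    by (rule vector_space_cochain_scl)
  have "0 \<in> Z2"
    by (simp add: Z2_def cochain2_iff d2_def)
  then show ?thesis
    by (simp add: cochains.subspace_def Z2_add Z2_scl)
qed

lemma H2_eq_class_span:
  assumes "S \<subseteq> Z2" "\<And>c. c \<in> Z2 \<Longrightarrow> \<exists>s\<in>module.span cochain_scl S. c - s \<in> B2"
  shows "H2 = class_span S"
proof -
  interpret cochains: vector_space cochain_scl
    by (rule vector_space_cochain_scl)
  have "cochains.span S \<subseteq> Z2"
    by (rule cochains.span_minimal[OF assms(1) subspace_Z2])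
  moreover have "coh_class c \<in> coh_class ` cochains.span S" if "c \<in> Z2" for c
    using assms(2)[OF that] coh_class_eqI by auto
  ultimately show ?thesis
    unfolding H2_def class_span_def by blast
qed

definition lie_derivative :: "'g \<Rightarrow> ('g \<Rightarrow> 'g \<Rightarrow> 'g) \<Rightarrow> 'g \<Rightarrow> 'g \<Rightarrow> 'g" where
  "lie_derivative H c X Y = br H (c X Y) - c (br H X) Y - c X (br H Y)"

text \<open>Cartan's formula: \<open>L\<^sub>H = d i\<^sub>H + i\<^sub>H d\<close>, and the second term vanishes on cocycles.\<close>

lemma lie_derivative_B2:
  assumes "c \<in> Z2"
  shows "lie_derivative H c \<in> B2"
proof -
  have c: "c \<in> cochain2" and d2: "d2 c H X Y = 0" for X Y
    using assms by (simp_all add: Z2_def)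
  have "d2 c H X Y = lie_derivative H c X Y - d1 (c H) X Y" for X Y
    by (simp add: d2_def d1_def lie_derivative_def alternating_cochain2[OF c, of "br H Y" X]
        alternating_cochain2[OF c, of "br X Y" H])
  then have "lie_derivative H c = d1 (c H)"
    by (simp add: fun_eq_iff d2)
  moreover have "c H \<in> cochain1"
    using c by (simp add: cochain1_iff cochain2_iff)
  ultimately show ?thesis
    by (simp add: B2_def)
qed

lemma lie_automorphism_inv:
  assumes "lie_automorphism f"
  shows "f (inv f X) = X" "inv f (X + Y) = inv f X + inv f Y" "inv f (scl a X) = scl a (inv f X)"
    "inv f (br X Y) = br (inv f X) (inv f Y)"
proof -
  have f: "f (X + Y) = f X + f Y" "f (scl a X) = scl a (f X)" "f (br X Y) = br (f X) (f Y)" and "bij f"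
    for X Y a
    using assms by (simp_all add: lie_automorphism_def linear_iff)
  then have inv: "f (inv f X) = X" "inv f (f X) = X" for X
    by (simp_all add: bij_is_surj surj_f_inv_f bij_is_inj)
  show "f (inv f X) = X"
    by (rule inv)
  show "inv f (X + Y) = inv f X + inv f Y" "inv f (scl a X) = scl a (inv f X)"
    "inv f (br X Y) = br (inv f X) (inv f Y)"
    using inv(2)[of "inv f X + inv f Y"] inv(2)[of "scl a (inv f X)"] inv(2)[of "br (inv f X) (inv f Y)"]
    by (simp_all add: f inv(1))
qed

lemma act_cochain_cochain2:
  assumes "lie_automorphism f" "c \<in> cochain2"
  shows "act_cochain f c \<in> cochain2"
proof -
  have f: "f (X + Y) = f X + f Y" "f (scl a X) = scl a (f X)" for X Y a
    using assms(1) by (simp_all add: lie_automorphism_def linear_iff)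
  have "f 0 = 0"
    using f(2)[of 0 0] by simp
  then show ?thesis
    by (simp add: cochain2_iff act_cochain_def lie_automorphism_inv[OF assms(1)] f
        bilinear_cochain2[OF assms(2)])
qed

lemma act_cochain_Z2:
  assumes "lie_automorphism f" "c \<in> Z2"
  shows "act_cochain f c \<in> Z2"
proof -
  note inv = lie_automorphism_inv[OF assms(1)]
  have f: "f (X + Y) = f X + f Y" "f (scl a X) = scl a (f X)" "f (br X Y) = br (f X) (f Y)" for X Y a
    using assms(1) by (simp_all add: lie_automorphism_def linear_iff)
  have f_0: "f 0 = 0" and f_minus: "f (- X) = - f X" for X
    using f(2)[of 0 0] f(2)[of "- 1" X] by simp_all
  have f_diff: "f (X - Y) = f X - f Y" for X Y
    using f(1)[of X "- Y"] by (simp add: f_minus)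
  have "d2 (act_cochain f c) X Y Z = f (d2 c (inv f X) (inv f Y) (inv f Z))" for X Y Z
    by (simp add: d2_def act_cochain_def f f_diff inv)
  then show ?thesis
    using assms by (simp add: Z2_def act_cochain_cochain2 f_0)
qed

end


section \<open>Cochains of the Brown algebra in coordinates\<close>

definition cochain_coord :: "('k::field br3 \<Rightarrow> 'k br3 \<Rightarrow> 'k br3) \<Rightarrow> idx \<Rightarrow> idx \<Rightarrow> idx \<Rightarrow> 'k" where
  "cochain_coord c a b m = coord (c (basis_vec a) (basis_vec b)) m"

definition cochain_of_terms :: "term_list \<Rightarrow> 'k::field br3 \<Rightarrow> 'k br3 \<Rightarrow> 'k br3" where
  "cochain_of_terms L =
     sum_list (map (\<lambda>(u, v, w, t). wedge_term (tval t) (basis_vec u) (basis_vec v) (basis_vec w)) L)"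

lemma flip_flip [simp]: "flip (flip i) = i"
  by (cases i) simp_all

lemma flip_sign_flip [simp]: "flip_sign (flip i) = flip_sign i"
  by (cases i) simp_all

lemma flip_sign_square [simp]: "tval (flip_sign i) * (tval (flip_sign i) * x) = (x :: 'k::field)"
  by (cases i) simp_all

lemma flip_eq_iff: "flip i = j \<longleftrightarrow> i = flip j"
  by auto

lemma bij_flip: "bij flip"
  by (rule involuntory_imp_bij) simp

lemma flip_generator:
  "flip (generator_idx (GX i)) = generator_idx (GY i)" "flip (generator_idx (GY i)) = generator_idx (GX i)"
  "flip (generator_idx (GH i)) = generator_idx (GH i)" "flip_sign (generator_idx g) = Neg"
  by (auto split: chevalley.splits) (cases g; auto)

definition omega_map :: "'k::field br3 \<Rightarrow> 'k br3" where
  "omega_map X = (\<Sum>i\<in>UNIV. br3_scl (tval (flip_sign i) * coord X (flip i)) (basis_vec i))"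

context char3_field
begin

lemma linear_zero_on_basis:
  assumes add: "\<And>X Y :: 'k br3. f (X + Y) = f X + f Y" and scl: "\<And>a X. f (br3_scl a X) = br3_scl a (f X)"
    and zero: "\<And>i. f (basis_vec i) = (0 :: 'k br3)"
  shows "f X = 0"
proof -
  have f_0: "f 0 = 0"
    using scl[of 0 0] by simp
  have "f (\<Sum>i\<in>I. g i) = (\<Sum>i\<in>I. f (g i))" for g :: "idx \<Rightarrow> 'k br3" and I
    by (induction I rule: infinite_finite_induct) (simp_all add: f_0 add)
  then have "f (\<Sum>i\<in>UNIV. br3_scl (coord X i) (basis_vec i)) = 0"
    by (simp add: scl zero)
  then show ?thesis
    by (simp add: basis_expansion)
qed

lemma coord_linear:
  assumes add: "\<And>X Y :: 'k br3. f (X + Y) = f X + f Y" and scl: "\<And>a X. f (br3_scl a X) = br3_scl a (f X)"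
  shows "coord (f X :: 'k br3) m = (\<Sum>i\<in>UNIV. coord X i * coord (f (basis_vec i)) m)"
proof -
  have f_0: "f 0 = 0"
    using scl[of 0 0] by simp
  have "f (\<Sum>i\<in>I. g i) = (\<Sum>i\<in>I. f (g i))" for g :: "idx \<Rightarrow> 'k br3" and I
    by (induction I rule: infinite_finite_induct) (simp_all add: f_0 add)
  then have "f (\<Sum>i\<in>UNIV. br3_scl (coord X i) (basis_vec i)) = (\<Sum>i\<in>UNIV. br3_scl (coord X i) (f (basis_vec i)))"
    by (simp add: scl)
  then show ?thesis
    by (simp add: basis_expansion coord_sum coord_scl)
qed

lemma coord_br_basis_vec:
  "coord (br3_br (basis_vec a) X :: 'k br3) m = (\<Sum>k\<in>UNIV. structure_const a k m * coord X k)"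
  by (simp add: coord_br coord_basis_vec table_bracket_unit_left)

lemma coord_br_basis_vec_basis_vec:
  "coord (br3_br (basis_vec a) (basis_vec b) :: 'k br3) = structure_const a b"
  by (simp add: coord_br coord_basis_vec table_bracket_unit_unit)

lemma cochain_coord_alternating:
  assumes "(c :: 'k br3 \<Rightarrow> _) \<in> br3.cochain2"
  shows "alternating (cochain_coord c)"
proof -
  have "cochain_coord c a b m = - cochain_coord c b a m" for a b m
    unfolding cochain_coord_def by (subst br3.alternating_cochain2[OF assms]) (rule coord_minus)
  moreover have "cochain_coord c a a m = 0" for a m
    by (simp add: cochain_coord_def br3.bilinear_cochain2(5)[OF assms])
  ultimately show ?thesis
    unfolding alternating_def by blast
qed

lemma coord_cochain_br_left:
  assumes "(c :: 'k br3 \<Rightarrow> _) \<in> br3.cochain2"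
  shows "coord (c (br3_br (basis_vec a) (basis_vec b)) (basis_vec d)) m
    = (\<Sum>k\<in>UNIV. structure_const a b k * cochain_coord c k d m)"
proof -
  have "coord (c (br3_br (basis_vec a) (basis_vec b)) (basis_vec d)) m = (\<Sum>k\<in>UNIV.
      coord (br3_br (basis_vec a) (basis_vec b)) k * coord (c (basis_vec k) (basis_vec d)) m)"
    by (rule coord_linear) (simp_all add: br3.bilinear_cochain2[OF assms])
  then show ?thesis
    by (simp only: coord_br_basis_vec_basis_vec cochain_coord_def)
qed

lemma coord_d2_basis_vec:
  assumes "(c :: 'k br3 \<Rightarrow> _) \<in> br3.cochain2"
  shows "coord (br3.d2 c (basis_vec a) (basis_vec b) (basis_vec d)) m
    = cocycle_defect structure_const (cochain_coord c) a b d m"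
  by (simp add: br3.d2_def coord_add coord_diff coord_br_basis_vec coord_cochain_br_left[OF assms]
      cocycle_defect_def flip: cochain_coord_def)

lemma cochain2_eqI:
  assumes c: "(c :: 'k br3 \<Rightarrow> _) \<in> br3.cochain2" and e: "e \<in> br3.cochain2"
    and eq: "\<And>a b m. cochain_coord c a b m = cochain_coord e a b m"
  shows "c = e"
proof (intro ext)
  fix X Y
  note bilin = br3.bilinear_cochain2[OF c] br3.bilinear_cochain2[OF e] br3.scale_right_diff_distrib
  have 0: "c (basis_vec a) (basis_vec b) - e (basis_vec a) (basis_vec b) = 0" for a b
    using eq by (intro br3_eqI) (simp add: cochain_coord_def coord_diff)
  have 1: "c (basis_vec a) Y - e (basis_vec a) Y = 0" for a
    by (rule linear_zero_on_basis[of "\<lambda>Y. c (basis_vec a) Y - e (basis_vec a) Y"])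
      (simp_all only: bilin 0 add_diff_add)
  have "c X Y - e X Y = 0"
    by (rule linear_zero_on_basis[of "\<lambda>X. c X Y - e X Y"]) (simp_all only: bilin 1 add_diff_add)
  then show "c X Y = e X Y"
    by simp
qed

lemma Z2_iff_cocycle_defect:
  assumes c: "(c :: 'k br3 \<Rightarrow> _) \<in> br3.cochain2"
  shows "c \<in> br3.Z2 \<longleftrightarrow> (\<forall>a b d m. cocycle_defect structure_const (cochain_coord c) a b d m = 0)"
proof
  assume "c \<in> br3.Z2"
  then have "br3.d2 c X Y Z = 0" for X Y Z
    by (simp add: br3.Z2_def)
  then show "\<forall>a b d m. cocycle_defect structure_const (cochain_coord c) a b d m = 0"
    by (simp flip: coord_d2_basis_vec[OF c])
next
  assume defect: "\<forall>a b d m. cocycle_defect structure_const (cochain_coord c) a b d m = 0"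
  note lin = br3.d2_def br3.bilinear_cochain2[OF c] br3.br_add_left br3.br_add_right br3.br_scl_left
    br3.br_scl_right br3.scale_right_diff_distrib br3.scale_right_distrib algebra_simps
  have 0: "br3.d2 c (basis_vec a) (basis_vec b) (basis_vec d) = 0" for a b d
    using defect by (intro br3_eqI) (simp add: coord_d2_basis_vec[OF c])
  have 1: "br3.d2 c (basis_vec a) (basis_vec b) Z = 0" for a b Z
    by (rule linear_zero_on_basis[of "br3.d2 c (basis_vec a) (basis_vec b)"]) (simp_all only: 0, simp_all add: lin)
  have 2: "br3.d2 c (basis_vec a) Y Z = 0" for a Y Z
    by (rule linear_zero_on_basis[of "\<lambda>Y. br3.d2 c (basis_vec a) Y Z"]) (simp_all only: 1, simp_all add: lin)
  have "br3.d2 c X Y Z = 0" for X Y Z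
    by (rule linear_zero_on_basis[of "\<lambda>X. br3.d2 c X Y Z"]) (simp_all only: 2, simp_all add: lin)
  then show "c \<in> br3.Z2"
    by (simp add: br3.Z2_def c)
qed

lemma wedge_term_cochain2:
  "wedge_term a (u :: 'k br3) (basis_vec v) (basis_vec w) \<in> br3.cochain2"
  unfolding br3.cochain2_iff
  by (auto simp: wedge_term_def hat_basis_vec coord_add coord_scl algebra_simps
      simp flip: br3.scale_left_distrib br3.scale_left_diff_distrib)

lemma zero_cochain2: "(0 :: 'k br3 \<Rightarrow> _) \<in> br3.cochain2"
  by (simp add: br3.cochain2_iff)

lemma add_cochain2:
  "c \<in> br3.cochain2 \<Longrightarrow> (e :: 'k br3 \<Rightarrow> _) \<in> br3.cochain2 \<Longrightarrow> c + e \<in> br3.cochain2"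
  by (simp add: br3.cochain2_iff br3.scale_right_distrib algebra_simps)

lemma cochain_of_terms_Nil: "cochain_of_terms [] = (0 :: 'k br3 \<Rightarrow> _)"
  by (simp only: cochain_of_terms_def list.map sum_list.Nil)

lemma cochain_of_terms_Cons:
  "cochain_of_terms ((u, v, w, t) # L)
    = wedge_term (tval t) (basis_vec u) (basis_vec v) (basis_vec w) + (cochain_of_terms L :: 'k br3 \<Rightarrow> _)"
  by (simp only: cochain_of_terms_def list.map sum_list.Cons prod.case)

lemma cochain_of_terms_cochain2: "(cochain_of_terms L :: 'k br3 \<Rightarrow> _) \<in> br3.cochain2"
proof (induction L)
  case (Cons p L)
  then show ?case
    by (cases p) (simp only: cochain_of_terms_Cons add_cochain2[OF wedge_term_cochain2])
qed (simp only: cochain_of_terms_Nil zero_cochain2)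

lemma cochain_coord_add: "cochain_coord (c + e) a b m = cochain_coord c a b m + (cochain_coord e a b m :: 'k)"
  by (simp add: cochain_coord_def coord_add)

lemma cochain_coord_diff: "cochain_coord (c - e) a b m = cochain_coord c a b m - (cochain_coord e a b m :: 'k)"
  by (simp add: cochain_coord_def coord_diff)

lemma cochain_coord_scl: "cochain_coord (br3.cochain_scl t c) a b m = t * (cochain_coord c a b m :: 'k)"
  by (simp add: cochain_coord_def br3.cochain_scl_def coord_scl)

lemma row_coef_append: "row_coef (r @ s) j m = row_coef r j m + row_coef s j m"
  by (induction r j m rule: row_coef.induct) auto

lemma cochain_coord_of_terms:
  "cochain_coord (cochain_of_terms L :: 'k br3 \<Rightarrow> _) a b m = table_coef (wedge_row L) a b m"
proof (induction L a rule: wedge_row.induct)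
  case (1 a)
  show ?case
    by (simp add: cochain_of_terms_Nil cochain_coord_def)
next
  case (2 u v w t L a)
  have "cochain_coord (wedge_term (tval t) (basis_vec u) (basis_vec v) (basis_vec w) :: 'k br3 \<Rightarrow> _) a b m
      = row_coef ((if v = a then [(w, u, t)] else []) @ (if w = a then [(v, u, trit_neg t)] else [])) b m"
    by (auto simp: cochain_coord_def wedge_term_def hat_basis_vec coord_scl coord_basis_vec unit_apply)
  with "2.IH" show ?case
    by (simp only: cochain_of_terms_Cons cochain_coord_add wedge_row.simps row_coef_append add.assoc)
qed

lemma cochain_of_terms_Z2:
  assumes "cocycle_test structure_row (wedge_row L) all_idx" "alternating_test (wedge_row L)"
  shows "(cochain_of_terms L :: 'k br3 \<Rightarrow> _) \<in> br3.Z2"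
proof -
  have "cochain_coord (cochain_of_terms L :: 'k br3 \<Rightarrow> _) = table_coef (wedge_row L)"
    by (intro ext) (rule cochain_coord_of_terms)
  then show ?thesis
    using cocycle_test_sound[OF assms(1) alternating_test_structure assms(2)]
    by (simp add: Z2_iff_cocycle_defect[OF cochain_of_terms_cochain2])
qed

lemma cocycles_of_terms:
  "c_m18 = (cochain_of_terms terms_m18 :: 'k br3 \<Rightarrow> _)" "c_m9 = (cochain_of_terms terms_m9 :: 'k br3 \<Rightarrow> _)"
  "c_m6 = (cochain_of_terms terms_m6 :: 'k br3 \<Rightarrow> _)" "c_m3 = (cochain_of_terms terms_m3 :: 'k br3 \<Rightarrow> _)"
  by (simp_all only: cochain_of_terms_def terms_m18_def terms_m9_def terms_m6_def terms_m3_def c_m18_def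
      c_m9_def c_m6_def c_m3_def list.map prod.case sum_list.Cons sum_list.Nil tval.simps basis_vec.simps
      two_eq_minus_1 add.assoc add_0_right)

lemma cocycles_Z2:
  "(c_m18 :: 'k br3 \<Rightarrow> _) \<in> br3.Z2" "(c_m9 :: 'k br3 \<Rightarrow> _) \<in> br3.Z2"
  "(c_m6 :: 'k br3 \<Rightarrow> _) \<in> br3.Z2" "(c_m3 :: 'k br3 \<Rightarrow> _) \<in> br3.Z2"
  unfolding cocycles_of_terms
  by (intro cochain_of_terms_Z2 cocycle_test_m18 cocycle_test_m9 cocycle_test_m6 cocycle_test_m3
      alternating_test_m18 alternating_test_m9 alternating_test_m6 alternating_test_m3)+


section \<open>The Chevalley involution\<close>

lemma coord_omega_map: "coord (omega_map X :: 'k br3) m = tval (flip_sign m) * coord X (flip m)"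
proof -
  have "coord (omega_map X) m = (\<Sum>i\<in>UNIV. unit m i * (tval (flip_sign i) * coord X (flip i)))"
    unfolding omega_map_def coord_sum coord_scl coord_basis_vec
    by (intro sum.cong refl) (auto simp: unit_apply)
  then show ?thesis by simp
qed

lemma vec_coef_flip_map:
  "vec_coef (map (\<lambda>(m, t). (flip m, trit_mult (flip_sign m) t)) xs) m
    = (tval (flip_sign m) * vec_coef xs (flip m) :: 'k)"
  by (induction xs) (auto simp: flip_eq_iff distrib_left)

lemma vec_coef_scale_neg:
  "vec_coef (map (\<lambda>(m, u). (m, trit_mult (trit_neg t) u)) xs) m = (- tval t * vec_coef xs m :: 'k)"
  using vec_coef_scale[of "trit_neg t" xs m] by simp

lemma structure_flip:
  "tval (flip_sign m) * structure_const a b (flip m)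
    = (tval (flip_sign a) * tval (flip_sign b) * structure_const (flip a) (flip b) m :: 'k)"
  using flip_test vanishes_sound[of "map (\<lambda>(m, t). (flip m, trit_mult (flip_sign m) t)) (entries b (structure_row a))
      @ map (\<lambda>(m, t). (m, trit_mult (trit_neg (trit_mult (flip_sign a) (flip_sign b))) t))
          (entries (flip b) (structure_row (flip a)))" m]
  by (simp add: flip_test_def list_all_iff set_all_idx vec_coef_flip_map vec_coef_scale_neg)

lemma omega_map_br: "omega_map (br3_br X Y) = br3_br (omega_map X) (omega_map Y :: 'k br3)"
proof (rule br3_eqI)
  fix m
  let ?s = "\<lambda>i. tval (flip_sign i) :: 'k"
  have "coord (br3_br (omega_map X) (omega_map Y)) m = (\<Sum>a\<in>UNIV. \<Sum>b\<in>UNIV.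
      ?s a * coord X (flip a) * (?s b * coord Y (flip b)) * structure_const a b m)"
    by (simp add: coord_br table_bracket_def coord_omega_map)
  also have "\<dots> = (\<Sum>a\<in>UNIV. \<Sum>b\<in>UNIV.
      ?s (flip a) * coord X a * (?s (flip b) * coord Y b) * structure_const (flip a) (flip b) m)"
    by (subst (1 2) sum.reindex_bij_betw[OF bij_flip, symmetric]) simp
  also have "\<dots> = (\<Sum>a\<in>UNIV. \<Sum>b\<in>UNIV. ?s m * (coord X a * coord Y b * structure_const a b (flip m)))"
  proof (intro sum.cong refl)
    fix a b
    have "coord X a * coord Y b * (?s m * structure_const a b (flip m))
        = coord X a * coord Y b * (?s a * ?s b * structure_const (flip a) (flip b) m)"
      by (simp only: structure_flip)
    then show "?s (flip a) * coord X a * (?s (flip b) * coord Y b) * structure_const (flip a) (flip b) m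
        = ?s m * (coord X a * coord Y b * structure_const a b (flip m))"
      by (simp only: flip_sign_flip ac_simps)
  qed
  also have "\<dots> = coord (omega_map (br3_br X Y)) m"
    by (simp add: coord_omega_map coord_br table_bracket_def sum_distrib_left)
  finally show "coord (omega_map (br3_br X Y)) m = coord (br3_br (omega_map X) (omega_map Y)) m"
    by simp
qed

lemma omega_map_omega_map: "omega_map (omega_map X) = (X :: 'k br3)"
  by (rule br3_eqI) (simp add: coord_omega_map)

lemma lie_automorphism_omega_map: "br3.lie_automorphism (omega_map :: 'k br3 \<Rightarrow> _)"
  unfolding br3.lie_automorphism_def br3.linear_iff
proof (intro conjI allI)
  fix X Y :: "'k br3" and a
  show "omega_map (X + Y) = omega_map X + omega_map Y" "omega_map (br3_scl a X) = br3_scl a (omega_map X)"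
    by (rule br3_eqI, simp add: coord_omega_map coord_add coord_scl algebra_simps)+
  show "bij (omega_map :: 'k br3 \<Rightarrow> _)"
    by (rule involuntory_imp_bij) (rule omega_map_omega_map)
qed (rule omega_map_br)

text \<open>An automorphism is determined by its values on the generators.\<close>

lemma br3_omega_eq: "br3_omega = (omega_map :: 'k br3 \<Rightarrow> _)"
proof -
  have *: "omega_map (br3_gen g) = - (br3_gen g' :: 'k br3)"
    if "flip (generator_idx g) = generator_idx g'" for g g'
    by (rule br3_eqI) (auto simp: coord_omega_map coord_gen coord_minus unit_apply flip_eq_iff that
        flip_generator(4) simp del: generator_idx.simps)
  have gens: "omega_map (br3_gen (GX i)) = - (br3_gen (GY i) :: 'k br3)"
    "omega_map (br3_gen (GY i)) = - (br3_gen (GX i) :: 'k br3)"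
    "omega_map (br3_gen (GH i)) = - (br3_gen (GH i) :: 'k br3)" for i
    by (intro * flip_generator)+
  show ?thesis
    unfolding br3_omega_def
  proof (rule the_equality)
    fix f :: "'k br3 \<Rightarrow> 'k br3"
    assume f: "br3.lie_automorphism f \<and> (\<forall>i. f (br3_gen (GX i)) = - br3_gen (GY i) \<and>
      f (br3_gen (GY i)) = - br3_gen (GX i) \<and> f (br3_gen (GH i)) = - br3_gen (GH i))"
    have aut: "g (X + Y) = g X + g Y" "g (br3_scl a X) = br3_scl a (g X)" "g (br3_br X Y) = br3_br (g X) (g Y)"
      if "br3.lie_automorphism g" for g :: "'k br3 \<Rightarrow> 'k br3" and a X Y
      using that by (simp_all add: br3.lie_automorphism_def br3.linear_iff)
    note aut_f = aut[OF conjunct1[OF f]] and aut_omega = aut[OF lie_automorphism_omega_map]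
    have "f (br3_gen g) = omega_map (br3_gen g)" for g
      using f gens by (cases g) simp_all
    then have "f (basis_vec i) = omega_map (basis_vec i)" for i
      by (rule basis_vec_induct[where P = "\<lambda>X. f X = omega_map X"]) (simp add: aut_f omega_map_br)
    then have "f X - omega_map X = 0" for X
      by - (rule linear_zero_on_basis[of "\<lambda>X. f X - omega_map X"],
         simp_all add: aut_f aut_omega br3.scale_right_diff_distrib)
    then show "f = omega_map"
      by (simp add: fun_eq_iff)
  qed (simp add: gens lie_automorphism_omega_map)
qed

lemma cochain_coord_act_omega:
  assumes c: "(c :: 'k br3 \<Rightarrow> _) \<in> br3.cochain2"
  shows "cochain_coord (act_cochain br3_omega c) a b m
    = tval (flip_sign a) * tval (flip_sign b) * tval (flip_sign m) * cochain_coord c (flip a) (flip b) (flip m)"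
proof -
  have inv: "inv omega_map = (omega_map :: 'k br3 \<Rightarrow> _)"
    by (rule inv_unique_comp) (simp_all add: fun_eq_iff omega_map_omega_map)
  have "omega_map (basis_vec i) = br3_scl (tval (flip_sign i)) (basis_vec (flip i) :: 'k br3)" for i
    by (rule br3_eqI) (auto simp: coord_omega_map coord_scl coord_basis_vec unit_apply flip_eq_iff)
  then show ?thesis
    by (simp add: cochain_coord_def act_cochain_def br3_omega_eq inv coord_omega_map coord_scl
        br3.bilinear_cochain2[OF c] ac_simps)
qed

lemma table_coef_flip_terms:
  "table_coef (wedge_row (flip_terms L)) a b m = (tval (flip_sign a) * tval (flip_sign b) * tval (flip_sign m)
     * table_coef (wedge_row L) (flip a) (flip b) (flip m) :: 'k)"
  by (induction L) (auto simp: flip_terms_def row_coef_append flip_eq_iff distrib_left ac_simps)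

lemma act_omega_of_terms:
  "act_cochain br3_omega (cochain_of_terms L) = (cochain_of_terms (flip_terms L) :: 'k br3 \<Rightarrow> _)"
proof (rule cochain2_eqI)
  have "br3.lie_automorphism (br3_omega :: 'k br3 \<Rightarrow> _)"
    by (simp add: br3_omega_eq lie_automorphism_omega_map)
  then show "act_cochain br3_omega (cochain_of_terms L) \<in> (br3.cochain2 :: ('k br3 \<Rightarrow> _) set)"
    by (simp add: br3.act_cochain_cochain2 cochain_of_terms_cochain2)
qed (simp_all add: cochain_of_terms_cochain2 cochain_coord_act_omega cochain_coord_of_terms table_coef_flip_terms)

lemma omega_cocycles_Z2: "(c :: 'k br3 \<Rightarrow> _) \<in> br3.Z2 \<Longrightarrow> act_cochain br3_omega c \<in> br3.Z2"
  by (rule br3.act_cochain_Z2) (simp_all add: br3_omega_eq lie_automorphism_omega_map)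

end


section \<open>Restriction to weight zero\<close>

text \<open>The eigenvalues of \<open>h\<^sub>1, h\<^sub>2, h\<^sub>3\<close> on the basis vectors.\<close>

primrec weight :: "idx \<Rightarrow> trit \<times> trit \<times> trit" where
  "weight X1 = (Neg, Neg, Zero)" | "weight X2 = (Neg, Neg, Neg)"
| "weight X3 = (Zero, Neg, Zero)" | "weight X4 = (Pos, Pos, Neg)"
| "weight X5 = (Neg, Pos, Neg)" | "weight X6 = (Pos, Zero, Neg)"
| "weight X7 = (Neg, Zero, Neg)" | "weight X8 = (Pos, Neg, Neg)"
| "weight X9 = (Zero, Pos, Pos)" | "weight X10 = (Zero, Zero, Pos)"
| "weight X11 = (Zero, Neg, Pos)" | "weight X12 = (Neg, Pos, Zero)"
| "weight X13 = (Pos, Zero, Zero)" | "weight Y1 = (Pos, Pos, Zero)"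
| "weight Y2 = (Pos, Pos, Pos)" | "weight Y3 = (Zero, Pos, Zero)"
| "weight Y4 = (Neg, Neg, Pos)" | "weight Y5 = (Pos, Neg, Pos)"
| "weight Y6 = (Neg, Zero, Pos)" | "weight Y7 = (Pos, Zero, Pos)"
| "weight Y8 = (Neg, Pos, Pos)" | "weight Y9 = (Zero, Neg, Neg)"
| "weight Y10 = (Zero, Zero, Neg)" | "weight Y11 = (Zero, Pos, Neg)"
| "weight Y12 = (Pos, Neg, Zero)" | "weight Y13 = (Neg, Zero, Zero)"
| "weight H1 = (Zero, Zero, Zero)" | "weight H2 = (Zero, Zero, Zero)"
| "weight H3 = (Zero, Zero, Zero)"

fun weight_add :: "trit \<times> trit \<times> trit \<Rightarrow> trit \<times> trit \<times> trit \<Rightarrow> trit \<times> trit \<times> trit" where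
  "weight_add (p, q, r) (p', q', r') = (trit_add p p', trit_add q q', trit_add r r')"

lemma structure_const_cartan:
  "structure_const H1 i m = (if m = i then tval (fst (weight i)) else 0)"
  "structure_const H2 i m = (if m = i then tval (fst (snd (weight i))) else 0)"
  "structure_const H3 i m = (if m = i then tval (snd (snd (weight i))) else 0)"
  by (cases i; simp)+

context char3_field
begin

lemma cochain_coord_lie_derivative:
  assumes c: "(c :: 'k br3 \<Rightarrow> _) \<in> br3.cochain2"
    and eigen: "\<And>i m. structure_const h i m = (if m = i then w i else 0 :: 'k)"
  shows "cochain_coord (br3.lie_derivative (basis_vec h) c) a b m = (w m - w a - w b) * cochain_coord c a b m"
proof -
  have coord_h: "coord (br3_br (basis_vec h) X) m = w m * coord X m" for X :: "'k br3" and m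
  proof -
    have "coord (br3_br (basis_vec h) X) m = (\<Sum>k\<in>UNIV. (if m = k then w m else 0) * coord X k)"
      unfolding coord_br_basis_vec by (intro sum.cong refl) (simp add: eigen)
    then show ?thesis
      by (simp only: sum_delta_mult)
  qed
  have basis_h: "br3_br (basis_vec h) (basis_vec i) = br3_scl (w i) (basis_vec i :: 'k br3)" for i
    by (rule br3_eqI) (simp add: coord_h coord_scl coord_basis_vec unit_apply)
  show ?thesis
    by (simp add: br3.lie_derivative_def cochain_coord_def coord_add coord_diff coord_h basis_h
        br3.bilinear_cochain2[OF c] coord_scl algebra_simps)
qed

text \<open>The factor \<open>x = w m - w a - w b\<close> by which \<open>L\<^sub>h\<close> acts on the coordinate \<open>(a, b, m)\<close> is 0, 1 or -1, so
  \<open>1 - x\<^sup>2\<close> tells \<open>x = 0\<close> from \<open>x \<noteq> 0\<close>. The representative is \<open>c - L\<^sub>h (L\<^sub>h c)\<close>.\<close>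

lemma weight_projection:
  assumes c: "(c :: 'k br3 \<Rightarrow> _) \<in> br3.Z2"
    and eigen: "\<And>i m. structure_const h i m = (if m = i then tval (w i) else 0 :: 'k)"
  obtains c' where "c' \<in> br3.Z2" "c - c' \<in> br3.B2"
    "\<And>a b m. cochain_coord c' a b m = (if trit_add (w a) (w b) = w m then cochain_coord c a b m else 0)"
proof
  let ?L = "br3.lie_derivative (basis_vec h)"
  have Lc: "?L c \<in> br3.B2"
    by (rule br3.lie_derivative_B2[OF c])
  then have LLc: "?L (?L c) \<in> br3.B2"
    using br3.B2_subset_Z2 by (blast intro: br3.lie_derivative_B2)
  show "c - ?L (?L c) \<in> br3.Z2"
    using c LLc br3.B2_subset_Z2 by (blast intro: br3.Z2_diff)
  show "c - (c - ?L (?L c)) \<in> br3.B2"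
    using LLc by (simp del: fun_diff_def minus_apply)
  fix a b m
  let ?x = "tval (w m) - tval (w a) - tval (w b) :: 'k"
  have c2: "c \<in> br3.cochain2" "?L c \<in> br3.cochain2"
    using c Lc br3.B2_subset_Z2 by (auto simp: br3.Z2_def)
  have "cochain_coord (c - ?L (?L c)) a b m = (1 - ?x * ?x) * cochain_coord c a b m"
    unfolding cochain_coord_diff cochain_coord_lie_derivative[OF c2(2) eigen]
      cochain_coord_lie_derivative[OF c2(1) eigen]
    by (simp add: algebra_simps)
  moreover obtain t where t: "?x = tval t" "t = Zero \<longleftrightarrow> trit_add (w a) (w b) = w m"
  proof
    let ?t = "trit_add (w m) (trit_neg (trit_add (w a) (w b)))"
    show "?x = tval ?t"
      by simp
    show "?t = Zero \<longleftrightarrow> trit_add (w a) (w b) = w m"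
      by (cases "trit_add (w a) (w b)"; cases "w m") simp_all
  qed
  moreover have "1 - tval t * tval t = (if t = Zero then 1 else 0 :: 'k)"
    by (cases t) simp_all
  ultimately show "cochain_coord (c - ?L (?L c)) a b m
      = (if trit_add (w a) (w b) = w m then cochain_coord c a b m else 0)"
    by simp
qed

lemma weight_zero_part:
  assumes c: "(c :: 'k br3 \<Rightarrow> _) \<in> br3.Z2"
  obtains c' where "c' \<in> br3.Z2" "c - c' \<in> br3.B2"
    "\<And>a b m. cochain_coord c' a b m
       = (if weight_add (weight a) (weight b) = weight m then cochain_coord c a b m else 0)"
proof -
  obtain c1 where c1: "c1 \<in> br3.Z2" "c - c1 \<in> br3.B2"
    "\<And>a b m. cochain_coord c1 a b m
       = (if trit_add (fst (weight a)) (fst (weight b)) = fst (weight m) then cochain_coord c a b m else 0)"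
    using weight_projection[OF c, of H1 "\<lambda>i. fst (weight i)", OF structure_const_cartan(1)] by blast
  obtain c2 where c2: "c2 \<in> br3.Z2" "c1 - c2 \<in> br3.B2"
    "\<And>a b m. cochain_coord c2 a b m = (if trit_add (fst (snd (weight a))) (fst (snd (weight b)))
       = fst (snd (weight m)) then cochain_coord c1 a b m else 0)"
    using weight_projection[OF c1(1), of H2 "\<lambda>i. fst (snd (weight i))", OF structure_const_cartan(2)] by blast
  obtain c3 where c3: "c3 \<in> br3.Z2" "c2 - c3 \<in> br3.B2"
    "\<And>a b m. cochain_coord c3 a b m = (if trit_add (snd (snd (weight a))) (snd (snd (weight b)))
       = snd (snd (weight m)) then cochain_coord c2 a b m else 0)"
    using weight_projection[OF c2(1), of H3 "\<lambda>i. snd (snd (weight i))", OF structure_const_cartan(3)] by blast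
  have "c - c3 = (c - c1) + ((c1 - c2) + (c2 - c3))"
    by (simp add: fun_eq_iff)
  then have "c - c3 \<in> br3.B2"
    using c1(2) c2(2) c3(2) by (simp only: br3.B2_add)
  moreover have "cochain_coord c3 a b m
      = (if weight_add (weight a) (weight b) = weight m then cochain_coord c a b m else 0)" for a b m
    unfolding c3(3) c2(3) c1(3)
    by (cases "weight a"; cases "weight b"; cases "weight m") simp
  ultimately show ?thesis
    using that c3(1) by blast
qed

end


section \<open>Solving the cocycle equations\<close>

text \<open>Coordinates that can be prescribed by a coboundary: the action of the \<open>h\<^sub>i\<close> on the simple root
  vectors, the \<open>h\<^sub>i\<close>-coordinate of \<open>[x\<^sub>i, y\<^sub>i]\<close>, and the brackets that define the other \<open>x\<^sub>k\<close> and \<open>y\<^sub>k\<close>.\<close>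

definition normalized_triples :: "(idx \<times> idx \<times> idx) list" where
  "normalized_triples = [
     (X1, H1, X1), (X2, H1, X2), (X3, H1, X3), (X1, H2, X1), (X2, H2, X2), (X3, H2, X3),
     (X1, H3, X1), (X2, H3, X2), (X3, H3, X3), (X1, Y1, H1), (X2, Y2, H2), (X3, Y3, H3),
     (X1, X2, X4), (Y1, Y2, Y4), (X2, X3, X5), (Y2, Y3, Y5), (X3, X4, X6), (Y3, Y4, Y6),
     (X3, X5, X7), (Y3, Y5, Y7), (X3, X6, X8), (Y3, Y6, Y8), (X5, X6, X9), (Y5, Y6, Y9),
     (X6, X7, X10), (Y6, Y7, Y10), (X7, X8, X11), (Y7, Y8, Y11), (X7, X9, X12), (Y7, Y9, Y12),
     (X8, X9, X13), (Y8, Y9, Y13)]"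

text \<open>For each of the eight cocycles a coordinate at which it is 1 and the other seven are 0.\<close>

definition pivots :: "(idx \<times> idx \<times> idx) list" where
  "pivots = [
     (X10, X13, Y7), (X4, X13, X5), (X12, Y1, X3), (X10, Y4, X2), (Y10, Y13, X7), (Y1, Y13, Y3),
     (Y5, Y12, Y8), (Y3, Y7, Y2)]"

fun trit_coef :: "row \<Rightarrow> idx \<Rightarrow> idx \<Rightarrow> trit" where
  "trit_coef [] j m = Zero"
| "trit_coef ((j', m', t) # r) j m =
     (if j' = j then if m' = m then trit_add t (trit_coef r j m) else trit_coef r j m else trit_coef r j m)"

definition class_terms :: "term_list list" where
  "class_terms = [terms_m18, terms_m9, terms_m6, terms_m3,
     flip_terms terms_m18, flip_terms terms_m9, flip_terms terms_m6, flip_terms terms_m3]"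

lemma pivot_test:
  "map (\<lambda>L. map (\<lambda>(a, b, m). trit_coef (wedge_row L a) b m) pivots) class_terms
     = map (\<lambda>s. map (\<lambda>t. if s = t then Pos else Zero) [0..<8]) [0..<8]"
  by code_simp

lemma normalized_test:
  "list_all (\<lambda>L. list_all (\<lambda>(a, b, m). trit_coef (wedge_row L a) b m = Zero) normalized_triples) class_terms"
  by code_simp

text \<open>The linear form in the coordinates of a cochain whose value is the \<open>m\<close>-coordinate of the cocycle defect
  at \<open>a, b, d\<close>.\<close>

definition cocycle_equation :: "idx \<times> idx \<times> idx \<times> idx \<Rightarrow> (trit \<times> idx \<times> idx \<times> idx) list" where
  "cocycle_equation = (\<lambda>(a, b, d, m).
       map (\<lambda>(k, t). (t, b, d, k)) (preimages m (structure_row a))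
     @ map (\<lambda>(k, t). (trit_neg t, a, d, k)) (preimages m (structure_row b))
     @ map (\<lambda>(k, t). (t, a, b, k)) (preimages m (structure_row d))
     @ map (\<lambda>(k, t). (trit_neg t, k, d, m)) (entries b (structure_row a))
     @ map (\<lambda>(k, t). (t, k, b, m)) (entries d (structure_row a))
     @ map (\<lambda>(k, t). (trit_neg t, k, a, m)) (entries d (structure_row b)))"

fun form_value :: "(trit \<times> idx \<times> idx \<times> idx) list \<Rightarrow> (idx \<Rightarrow> idx \<Rightarrow> idx \<Rightarrow> 'k::field) \<Rightarrow> 'k" where
  "form_value [] C = 0"
| "form_value ((t, i, j, k) # f) C = tval t * C i j k + form_value f C"

lemma form_value_append: "form_value (f @ g) C = form_value f C + form_value g C"
  by (induction f C rule: form_value.induct) simp_all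

lemma combination_row: "(\<Sum>k\<in>UNIV. row_coef r j k * f k) = combination (entries j r) f"
  using combination_entries[of "entries j r" f] by simp

lemma form_value_map:
  "form_value (map (\<lambda>(k, t). (t, i, j, k)) xs) C = combination xs (\<lambda>k. C i j k)"
  "form_value (map (\<lambda>(k, t). (trit_neg t, i, j, k)) xs) C = - combination xs (\<lambda>k. C i j k)"
  "form_value (map (\<lambda>(k, t). (t, k, j, m)) xs) C = combination xs (\<lambda>k. C k j m)"
  "form_value (map (\<lambda>(k, t). (trit_neg t, k, j, m)) xs) C = - combination xs (\<lambda>k. C k j m)"
  by (induction xs) auto

lemma form_value_cocycle_equation:
  "form_value (cocycle_equation (a, b, d, m)) C = cocycle_defect structure_const C a b d m"
  by (simp add: cocycle_equation_def form_value_append form_value_map cocycle_defect_def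
      combination_preimages combination_row)

text \<open>Why a coordinate of a normalized cocycle of weight 0 vanishes: because it is a normalized
  coordinate or a pivot, or, for \<open>Step n a b d m\<close>, because in the \<open>m\<close>-coordinate of the cocycle equation at \<open>a, b, d\<close> all other
  coordinates vanish by reasons of level less than \<open>n\<close>. The level makes the elimination well-founded.\<close>

datatype reason = Base | Step nat idx idx idx idx

primrec level :: "reason \<Rightarrow> nat" where
  "level Base = 0"
| "level (Step n a b d m) = n"

text \<open>A triangular elimination for the cocycle equations of weight 0. The entry \<open>(b, m, r)\<close> in the row of \<open>a\<close>
  concerns the coordinate \<open>(a, b, m)\<close>, and there is an entry for each coordinate of weight 0 with \<open>a\<close> before \<open>b\<close>.
  Levels up to 10 occur.\<close>

primrec derivation :: "idx \<Rightarrow> (idx \<times> idx \<times> reason) list" where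
  "derivation X1 = [
     (X2, X4, Base), (X3, X12, Step 2 X1 X3 Y7 X9), (X4, Y10, Step 1 X1 X4 X12 X5),
     (X5, X6, Step 1 X1 X2 X3 X6), (X6, Y9, Step 2 X1 X2 X6 Y8), (X7, X8, Step 2 X1 X2 X7 X9),
     (X8, Y11, Step 1 X1 X3 X6 Y11), (X9, Y6, Step 2 X1 X2 X8 Y6),
     (X10, Y4, Step 2 X1 X2 X10 Y1), (X11, Y8, Step 1 X1 X3 X10 Y8),
     (X12, X13, Step 3 X1 X2 X11 X13), (X13, X3, Step 1 X1 X2 X13 X5), (Y1, H1, Base),
     (Y1, H2, Step 1 X1 X3 Y1 X3), (Y1, H3, Step 4 X1 X10 Y1 X10),
     (Y2, X10, Step 2 X1 X11 Y12 X10), (Y3, Y13, Step 2 X1 X2 Y5 Y13),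
     (Y4, Y2, Step 5 X1 Y1 Y2 Y2), (Y5, X9, Step 1 X1 Y5 Y13 Y8), (Y6, Y5, Step 5 X1 Y1 Y6 Y6),
     (Y7, X11, Step 1 X1 X4 Y9 X11), (Y8, Y7, Step 5 X1 Y1 Y7 Y7), (Y9, X5, Step 2 X1 X6 Y9 X9),
     (Y10, X2, Step 2 X1 X6 Y13 X2), (Y11, X7, Step 1 X1 X4 Y11 X9),
     (Y12, Y3, Step 1 X1 Y6 Y12 Y8), (Y13, Y12, Step 6 X1 Y1 Y13 Y13), (H1, X1, Base),
     (H2, X1, Base), (H3, X1, Base)]"
| "derivation X2 = [
     (X3, X5, Base), (X4, X10, Step 2 X2 X4 Y5 X8), (X5, Y7, Step 2 X2 X5 X11 X8),
     (X6, X11, Step 2 X2 X6 Y7 X8), (X7, Y5, Step 2 X2 X7 X9 X6), (X8, X9, Step 1 X2 X3 X6 X9),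
     (X9, Y13, Step 1 X2 X4 X7 Y13), (X10, X1, Step 2 X2 X10 X12 X13),
     (X11, X12, Step 2 X2 X3 X10 X12), (X12, X6, Step 1 X2 X12 Y4 X3),
     (X13, Y9, Step 1 X2 X4 X13 Y7), (Y1, Y10, Step 1 X2 X11 Y1 X3),
     (Y2, H1, Step 3 X1 X2 Y2 X1), (Y2, H2, Base), (Y2, H3, Step 4 X2 X10 Y2 X10),
     (Y3, X7, Step 1 X2 Y3 Y7 H2), (Y4, Y1, Step 4 X2 Y1 Y2 Y1), (Y5, Y3, Step 4 X2 Y2 Y3 Y3),
     (Y6, Y12, Step 2 X2 X11 Y6 Y2), (Y7, X3, Step 1 X2 Y5 Y7 Y2),
     (Y8, X13, Step 1 X2 X5 Y10 X13), (Y9, Y8, Step 5 X2 Y4 Y7 Y8),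
     (Y10, Y4, Step 2 X1 X2 Y10 Y2), (Y11, Y6, Step 2 X2 X10 Y11 X7),
     (Y12, Y11, Step 5 X2 Y4 Y12 Y13), (Y13, X8, Step 1 X2 X5 Y13 X10), (H1, X2, Base),
     (H2, X2, Base), (H3, X2, Base)]"
| "derivation X3 = [
     (X4, X6, Base), (X5, X7, Base), (X6, X8, Base), (X7, X2, Step 1 X6 X7 Y4 X2),
     (X8, X4, Step 2 X1 X3 X7 X4), (X9, X10, Step 2 X3 X4 X7 X10),
     (X10, X11, Step 1 X3 X6 X7 X11), (X11, X9, Step 2 X3 X7 X11 X12),
     (X12, Y13, Step 2 X1 X3 X12 Y12), (X13, Y12, Step 1 X3 X9 X13 Y7),
     (Y1, X13, Step 1 X3 Y1 Y13 H3), (Y2, Y7, Step 2 X1 X3 Y4 Y7),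
     (Y3, H1, Step 5 X3 X13 Y3 X13), (Y3, H2, Step 6 X1 X3 Y3 X1), (Y3, H3, Base),
     (Y4, Y8, Step 1 X10 Y4 Y9 Y8), (Y5, Y2, Step 7 X2 X3 Y5 H2), (Y6, Y4, Step 7 X3 Y3 Y4 Y4),
     (Y7, Y5, Step 6 X3 Y3 Y7 Y7), (Y8, Y6, Step 7 X1 X3 Y8 Y5), (Y9, Y11, Step 2 X3 X7 Y12 Y11),
     (Y10, Y9, Step 7 X3 Y7 Y10 Y12), (Y11, Y10, Step 7 X3 Y3 Y11 Y11),
     (Y12, Y1, Step 1 X3 Y7 Y12 Y8), (Y13, X1, Step 2 X2 X3 Y13 X4), (H1, X3, Base),
     (H2, X3, Base), (H3, X3, Base)]"
| "derivation X4 = [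
     (X5, X11, Step 2 X4 X5 Y7 X8), (X6, Y8, Step 1 X4 X13 Y10 Y8), (X7, X9, Step 1 X3 X4 X5 X9),
     (X8, Y6, Step 1 X4 X8 X9 X5), (X9, Y12, Step 1 X2 X4 X8 Y12),
     (X10, Y1, Step 1 X4 X10 X13 X12), (X11, X13, Step 2 X4 X7 X8 X13),
     (X12, Y9, Step 1 X2 X4 X12 Y8), (X13, X5, Base), (Y1, X2, Step 5 X1 X2 Y1 X2),
     (Y2, X1, Step 2 X4 X5 Y2 X6), (Y3, X8, Step 1 X4 Y3 Y7 X1), (Y4, H1, Step 4 X4 Y1 Y2 H1),
     (Y4, H2, Step 5 X4 X12 Y4 X12), (Y4, H3, Step 4 X4 X10 Y4 X10),
     (Y5, Y13, Step 1 X4 X13 Y5 H3), (Y6, Y3, Step 5 X4 Y4 Y6 Y6),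
     (Y7, X12, Step 1 X1 X4 Y8 X12), (Y8, X3, Step 2 X1 X2 Y8 X3), (Y9, Y7, Step 5 X4 Y4 Y7 Y7),
     (Y10, Y2, Step 1 X4 Y6 Y7 Y2), (Y11, Y5, Step 2 X4 X6 Y11 X1),
     (Y12, X7, Step 1 X1 X4 Y12 X8), (Y13, Y11, Step 6 X4 Y1 Y12 Y11),
     (H1, X4, Step 1 X1 X2 H1 X4), (H2, X4, Step 1 X1 X2 H2 X4), (H3, X4, Step 1 X1 X2 H3 X4)]"
| "derivation X5 = [
     (X6, X9, Base), (X7, Y2, Step 2 X5 X7 X12 X11), (X8, X10, Step 2 X3 X5 X8 X11),
     (X9, X1, Step 2 X5 X9 X12 X13), (X10, X12, Step 1 X5 X6 X7 X12),
     (X11, Y13, Step 2 X4 X5 X11 Y11), (X12, X8, Step 1 X6 X12 Y1 X8),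
     (X13, Y11, Step 1 X5 X8 X13 Y7), (Y1, Y9, Step 1 X12 Y1 Y10 Y9),
     (Y2, X3, Step 1 X2 X3 Y2 X3), (Y3, X2, Step 7 X5 Y2 Y3 H2), (Y4, X13, Step 2 X2 X3 Y4 X13),
     (Y5, H1, Step 5 X5 X13 Y5 X13), (Y5, H2, Step 6 X5 X11 Y5 X11),
     (Y5, H3, Step 5 X2 X3 Y5 H3), (Y6, Y1, Step 7 X5 Y1 Y5 Y1), (Y7, Y3, Step 6 X5 Y5 Y7 Y7),
     (Y8, Y12, Step 2 X5 X12 Y8 H1), (Y9, Y6, Step 7 X4 X5 Y9 Y3),
     (Y10, Y8, Step 7 X5 Y7 Y10 Y11), (Y11, Y4, Step 2 X1 X5 Y11 Y2),
     (Y12, Y10, Step 7 X5 Y5 Y12 Y12), (Y13, X4, Step 1 X5 Y1 Y13 X2),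
     (H1, X5, Step 1 X2 X3 H1 X5), (H2, X5, Step 1 X2 X3 H2 X5), (H3, X5, Step 1 X2 X3 H3 X5)]"
| "derivation X6 = [
     (X7, X10, Base), (X8, Y4, Step 2 X3 X4 X8 Y4), (X9, Y1, Step 2 X3 X4 X9 Y1),
     (X10, X13, Step 3 X3 X4 X10 X13), (X11, Y12, Step 2 X3 X4 X11 Y12),
     (X12, Y11, Step 2 X1 X5 X12 Y11), (X13, X7, Step 1 X3 X4 X13 X7),
     (Y1, X5, Step 5 X1 X6 Y1 X6), (Y2, X12, Step 2 X6 X8 Y9 X12), (Y3, X4, Step 7 X3 X4 Y3 X4),
     (Y4, X3, Step 5 X4 X6 Y4 X6), (Y5, X1, Step 7 X1 X5 Y5 X1), (Y6, H1, Step 8 X1 X5 Y6 H1),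
     (Y6, H2, Step 7 X1 X5 Y6 H2), (Y6, H3, Step 6 X1 X5 Y6 H3), (Y7, Y13, Step 2 X3 X4 Y7 Y13),
     (Y8, Y3, Step 7 X1 X5 Y8 Y3), (Y9, Y5, Step 7 X3 X4 Y9 Y5), (Y10, Y7, Step 8 X1 X5 Y10 Y7),
     (Y11, Y2, Step 1 X6 Y7 Y8 Y2), (Y12, X2, Step 1 X6 Y9 Y12 Y8),
     (Y13, Y10, Step 8 X1 X5 Y13 Y10), (H1, X6, Step 2 X3 X4 H1 X6),
     (H2, X6, Step 2 X1 X5 H2 X6), (H3, X6, Step 2 X1 X5 H3 X6)]"
| "derivation X7 = [
     (X8, X11, Base), (X9, X12, Base), (X10, Y13, Step 1 X7 X10 X13 H3),
     (X11, X1, Step 1 X3 X5 X11 X1), (X12, X4, Step 1 X3 X5 X12 X4),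
     (X13, Y10, Step 1 X6 X7 X13 Y7), (Y1, Y11, Step 1 X3 X5 Y1 Y11),
     (Y2, Y3, Step 2 X1 X7 Y4 Y3), (Y3, X5, Step 6 X3 X7 Y3 X7), (Y4, Y12, Step 1 X3 X5 Y4 Y12),
     (Y5, X3, Step 6 X5 X7 Y5 X7), (Y6, X13, Step 2 X3 X7 Y8 X13),
     (Y7, H1, Step 5 X7 X13 Y7 X13), (Y7, H2, Step 7 X3 X5 Y7 H2), (Y7, H3, Step 7 X3 X5 Y7 H3),
     (Y8, Y1, Step 8 X3 X5 Y8 Y1), (Y9, Y4, Step 8 X3 X5 Y9 Y4), (Y10, Y6, Step 8 X7 Y7 Y10 Y10),
     (Y11, Y8, Step 8 X3 X5 Y11 Y8), (Y12, Y9, Step 8 X3 X5 Y12 Y9),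
     (Y13, X6, Step 1 X7 Y1 Y13 X5), (H1, X7, Step 2 X3 X5 H1 X7), (H2, X7, Step 2 X3 X5 H2 X7),
     (H3, X7, Step 2 X3 X5 H3 X7)]"
| "derivation X8 = [
     (X9, X13, Base), (X10, Y12, Step 1 X8 X10 X13 X1), (X11, Y1, Step 1 X3 X6 X11 Y1),
     (X12, Y10, Step 2 X1 X7 X12 Y10), (X13, X2, Step 1 X1 X7 X13 X2),
     (Y1, X7, Step 5 X1 X7 Y1 X7), (Y2, Y13, Step 1 X1 X7 Y2 Y13), (Y3, X6, Step 7 X1 X7 Y3 X6),
     (Y4, Y3, Step 1 X5 X8 Y4 X2), (Y5, X12, Step 1 X8 Y5 Y12 H1), (Y6, X3, Step 7 X1 X7 Y6 X3),
     (Y7, X1, Step 8 X3 X6 Y7 X1), (Y8, H1, Step 9 X1 X7 Y8 H1), (Y8, H2, Step 8 X1 X7 Y8 H2),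
     (Y8, H3, Step 8 X1 X7 Y8 H3), (Y9, Y2, Step 8 X3 X6 Y9 Y2), (Y10, Y5, Step 9 X1 X7 Y10 Y5),
     (Y11, Y7, Step 8 X8 Y6 Y11 Y10), (Y12, X5, Step 1 X8 Y5 Y12 H2),
     (Y13, Y9, Step 9 X1 X7 Y13 Y9), (H1, X8, Step 3 X3 X6 H1 X8), (H2, X8, Step 3 X1 X7 H2 X8),
     (H3, X8, Step 3 X1 X7 H3 X8)]"
| "derivation X9 = [
     (X10, Y11, Step 1 X9 X10 X13 X4), (X11, Y10, Step 2 X3 X9 X11 Y9),
     (X12, Y4, Step 1 X2 X8 X12 Y4), (X13, Y2, Step 1 X4 X7 X13 Y2),
     (Y1, Y5, Step 1 X7 X9 Y1 X3), (Y2, X8, Step 2 X5 X6 Y2 X8), (Y3, X11, Step 1 X9 Y3 Y12 Y2),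
     (Y4, X7, Step 5 X4 X7 Y4 X7), (Y5, X6, Step 7 X4 X7 Y5 X6), (Y6, X5, Step 7 X4 X7 Y6 X5),
     (Y7, X4, Step 8 X5 X6 Y7 X4), (Y8, X2, Step 8 X5 X6 Y8 X2), (Y9, H1, Step 9 X1 X9 Y9 X1),
     (Y9, H2, Step 8 X5 X6 Y9 H2), (Y9, H3, Step 8 X4 X7 Y9 H3), (Y10, Y3, Step 9 X4 X7 Y10 Y3),
     (Y11, X3, Step 2 X2 X9 Y12 X3), (Y12, Y7, Step 8 X9 Y6 Y12 Y10),
     (Y13, Y8, Step 9 X1 X9 Y13 Y7), (H1, X9, Step 3 X4 X7 H1 X9), (H2, X9, Step 3 X4 X7 H2 X9),
     (H3, X9, Step 3 X4 X7 H3 X9)]"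
| "derivation X10 = [
     (X11, Y9, Step 1 X4 X10 X11 Y7), (X12, Y8, Step 1 X1 X10 X12 Y7), (X13, Y7, Base),
     (Y1, Y2, Step 1 X10 X12 Y1 X11), (Y2, X4, Step 1 X1 X10 Y4 X4),
     (Y3, X9, Step 7 X7 X10 Y3 X12), (Y4, X2, Base), (Y5, X8, Step 7 X7 X10 Y5 X11),
     (Y6, X7, Step 8 X1 X10 Y6 X8), (Y7, X6, Step 8 X7 X10 Y7 X10),
     (Y8, X5, Step 9 X1 X10 Y8 X6), (Y9, X3, Step 9 X4 X10 Y9 X6),
     (Y10, H1, Step 9 X6 X7 Y10 H1), (Y10, H2, Step 9 X3 X9 Y10 H2),
     (Y10, H3, Step 9 X6 X7 Y10 H3), (Y11, Y3, Step 9 X5 X8 Y11 Y3),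
     (Y12, Y5, Step 9 X3 X9 Y12 Y5), (Y13, Y6, Step 9 X6 X7 Y13 Y6),
     (H1, X10, Step 3 X6 X7 H1 X10), (H2, X10, Step 3 X6 X7 H2 X10),
     (H3, X10, Step 3 X6 X7 H3 X10)]"
| "derivation X11 = [
     (X12, Y6, Step 2 X1 X11 X12 Y5), (X13, Y5, Step 1 X11 X13 Y3 Y7),
     (Y1, Y7, Step 1 X3 X10 Y1 Y7), (Y2, X6, Step 2 X1 X11 Y4 X6),
     (Y3, X10, Step 7 X3 X11 Y3 X11), (Y4, X5, Step 1 X10 X11 Y4 X12),
     (Y5, X4, Step 2 X1 X11 Y6 X4), (Y6, X2, Step 1 X10 X11 Y13 X2),
     (Y7, X8, Step 8 X5 X11 Y7 X10), (Y8, X7, Step 8 X6 X11 Y8 X10),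
     (Y9, Y3, Step 2 X5 X11 Y9 X2), (Y10, X3, Step 9 X5 X11 Y10 X7),
     (Y11, H1, Step 10 X1 X11 Y11 X1), (Y11, H2, Step 9 X7 X8 Y11 H2),
     (Y11, H3, Step 9 X7 X8 Y11 H3), (Y12, Y2, Step 9 X7 X8 Y12 Y2),
     (Y13, Y4, Step 9 X11 Y8 Y9 Y4), (H1, X11, Step 4 X3 X10 H1 X11),
     (H2, X11, Step 4 X3 X10 H2 X11), (H3, X11, Step 4 X3 X10 H3 X11)]"
| "derivation X12 = [
     (X13, Y3, Step 1 X12 X13 Y5 Y7), (Y1, X3, Base), (Y2, X11, Step 2 X5 X10 Y2 X11),
     (Y3, X1, Step 2 X2 X12 Y3 X4), (Y4, Y7, Step 1 X3 X12 Y4 Y5),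
     (Y5, X10, Step 7 X5 X12 Y5 X12), (Y6, Y2, Step 1 X12 Y1 Y6 Y4),
     (Y7, X9, Step 8 X3 X12 Y7 X10), (Y8, Y5, Step 1 X7 X12 Y8 X3),
     (Y9, X7, Step 8 X6 X12 Y9 X10), (Y10, X5, Step 9 X3 X12 Y10 X7),
     (Y11, X2, Step 9 X7 X9 Y11 X2), (Y12, H1, Step 10 X6 X12 Y12 X6),
     (Y12, H2, Step 1 X3 X12 Y12 X3), (Y12, H3, Step 9 X7 X9 Y12 H3),
     (Y13, Y1, Step 9 X12 Y8 Y9 Y1), (H1, X12, Step 4 X5 X10 H1 X12),
     (H2, X12, Step 4 X2 X12 Y2 X12), (H3, X12, Step 4 X5 X10 H3 X12)]"
| "derivation X13 = [
     (Y1, X12, Step 5 X1 X13 Y1 X13), (Y2, Y8, Step 1 X1 X13 Y2 Y7),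
     (Y3, Y1, Step 1 X4 X13 Y3 X2), (Y4, X11, Step 5 X4 X13 Y4 X13),
     (Y5, Y4, Step 1 X4 X13 Y5 H2), (Y6, X10, Step 8 X1 X12 Y6 X10),
     (Y7, Y6, Step 1 X4 X13 Y7 Y3), (Y8, X9, Step 9 X1 X12 Y8 X9), (Y9, X8, Step 9 X1 X12 Y9 X8),
     (Y10, X6, Step 9 X7 X13 Y10 X10), (Y11, X4, Step 9 X8 X9 Y11 X4),
     (Y12, X1, Step 9 X8 X9 Y12 X1), (Y13, H1, Step 10 X1 X13 Y13 X1),
     (Y13, H2, Step 1 X3 X13 Y13 X3), (Y13, H3, Step 10 X1 X12 Y13 H3),
     (H1, X13, Step 4 X6 X10 H1 X13), (H2, X13, Step 4 X2 X13 Y2 X13),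
     (H3, X13, Step 4 X6 X10 H3 X13)]"
| "derivation Y1 = [
     (Y2, Y4, Base), (Y3, Y12, Step 1 X12 Y1 Y3 H3), (Y4, X10, Step 1 X11 Y1 Y13 X10),
     (Y5, Y6, Step 1 Y1 Y2 Y3 Y6), (Y6, X9, Step 1 X10 Y1 Y13 X9), (Y7, Y8, Step 2 Y1 Y2 Y7 Y9),
     (Y8, X11, Step 1 X2 Y1 Y9 X11), (Y9, X6, Step 1 Y1 Y8 Y9 Y3),
     (Y10, X4, Step 1 Y1 Y10 Y13 Y11), (Y11, X8, Step 1 X2 Y1 Y11 X9),
     (Y12, Y13, Step 3 Y1 Y2 Y11 Y13), (Y13, Y3, Base), (H1, Y1, Step 1 X1 Y1 H1 H1),
     (H2, Y1, Step 3 X1 Y1 H2 H1), (H3, Y1, Step 2 X1 Y1 H3 H1)]"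
| "derivation Y2 = [
     (Y3, Y5, Base), (Y4, Y10, Step 2 X5 Y2 Y4 Y8), (Y5, X7, Step 1 X11 Y5 Y12 X7),
     (Y6, Y11, Step 2 X1 Y4 Y6 Y11), (Y7, X5, Step 2 X3 Y2 Y7 X7), (Y8, Y9, Step 1 Y2 Y3 Y6 Y9),
     (Y9, X13, Step 1 X3 Y2 Y10 X13), (Y10, Y1, Step 2 X3 Y2 Y11 Y1),
     (Y11, Y12, Step 2 Y2 Y3 Y10 Y12), (Y12, Y6, Step 1 Y2 Y3 Y12 Y8),
     (Y13, X9, Step 1 X3 Y2 Y13 X10), (H1, Y2, Step 2 X2 Y2 H1 H2), (H2, Y2, Step 1 X2 Y2 H2 H2),
     (H3, Y2, Step 2 X2 Y2 H3 H2)]"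
| "derivation Y3 = [
     (Y4, Y6, Base), (Y5, Y7, Base), (Y6, Y8, Base), (Y7, Y2, Base),
     (Y8, Y4, Step 1 X1 Y3 Y8 Y2), (Y9, Y10, Step 2 Y3 Y4 Y7 Y10),
     (Y10, Y11, Step 1 Y3 Y6 Y7 Y11), (Y11, Y9, Step 1 Y3 Y7 Y11 Y12),
     (Y12, X13, Step 2 X1 Y3 Y13 X13), (Y13, X12, Step 1 Y3 Y9 Y13 X7),
     (H1, Y3, Step 2 X1 Y1 Y3 Y3), (H2, Y3, Step 3 X3 Y3 H2 H3), (H3, Y3, Step 1 X3 Y3 H3 H3)]"
| "derivation Y4 = [
     (Y5, Y11, Step 1 X10 Y4 Y12 Y11), (Y6, X8, Step 2 X2 Y4 Y6 X9),
     (Y7, Y9, Step 1 Y3 Y4 Y5 Y9), (Y8, X6, Step 2 X2 Y4 Y9 X6), (Y9, X12, Step 1 X3 Y4 Y10 X12),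
     (Y10, X1, Step 2 X2 Y4 Y10 X4), (Y11, Y13, Step 2 Y4 Y7 Y8 Y13),
     (Y12, X9, Step 1 X3 Y4 Y12 X10), (Y13, Y5, Step 1 X2 Y4 Y13 Y3),
     (H1, Y4, Step 3 Y1 Y2 H1 Y4), (H2, Y4, Step 4 Y3 Y4 H2 Y6), (H3, Y4, Step 3 Y1 Y2 H3 Y4)]"
| "derivation Y5 = [
     (Y6, Y9, Base), (Y7, X2, Step 1 Y5 Y7 Y12 Y11), (Y8, Y10, Step 2 Y3 Y5 Y8 Y11),
     (Y9, Y1, Step 1 Y5 Y9 Y12 Y13), (Y10, Y12, Step 1 Y5 Y6 Y7 Y12),
     (Y11, X13, Step 2 X3 Y7 Y11 X13), (Y12, Y8, Base), (Y13, X11, Step 1 Y5 Y8 Y13 X7),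
     (H1, Y5, Step 3 Y2 Y3 H1 Y5), (H2, Y5, Step 4 Y1 Y5 H2 Y6), (H3, Y5, Step 3 Y2 Y3 H3 Y5)]"
| "derivation Y6 = [
     (Y7, Y10, Base), (Y8, X4, Step 2 X5 Y8 Y9 X4), (Y9, X1, Step 2 Y1 Y5 Y9 X1),
     (Y10, Y13, Step 3 Y3 Y4 Y10 Y13), (Y11, X12, Step 2 X3 Y8 Y11 X12),
     (Y12, X11, Step 2 X1 Y6 Y13 X11), (Y13, Y7, Step 1 Y1 Y5 Y13 Y7),
     (H1, Y6, Step 4 Y3 Y4 H1 Y6), (H2, Y6, Step 3 X6 Y6 H2 H1), (H3, Y6, Step 4 Y1 Y5 H3 Y6)]"
| "derivation Y7 = [
     (Y8, Y11, Base), (Y9, Y12, Base), (Y10, X13, Step 1 Y7 Y10 Y13 H3),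
     (Y11, Y1, Step 1 X4 Y9 Y11 Y1), (Y12, Y4, Step 1 X1 Y8 Y12 Y4),
     (Y13, X10, Step 1 Y6 Y7 Y13 X7), (H1, Y7, Step 4 Y3 Y5 H1 Y7), (H2, Y7, Step 3 X7 Y7 H2 H2),
     (H3, Y7, Step 4 Y3 Y5 H3 Y7)]"
| "derivation Y8 = [
     (Y9, Y13, Base), (Y10, X12, Step 1 Y8 Y10 Y13 Y1), (Y11, X1, Step 1 X2 Y9 Y11 X1),
     (Y12, X10, Step 2 X1 Y8 Y13 X10), (Y13, Y2, Step 1 X5 Y8 Y13 X3),
     (H1, Y8, Step 5 Y2 Y8 H1 Y9), (H2, Y8, Step 4 Y1 Y7 H2 Y8), (H3, Y8, Step 5 Y1 Y7 H3 Y8)]"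
| "derivation Y9 = [
     (Y10, X11, Step 1 Y9 Y10 Y13 Y4), (Y11, X10, Step 2 X3 Y9 Y11 X11),
     (Y12, X4, Step 1 X3 Y9 Y12 X6), (Y13, X2, Step 1 X3 Y9 Y13 X5),
     (H1, Y9, Step 4 X10 Y9 H1 X3), (H2, Y9, Step 5 Y3 Y9 H2 Y10), (H3, Y9, Step 5 Y4 Y7 H3 Y9)]"
| "derivation Y10 = [
     (Y11, X9, Step 1 X4 Y10 Y13 X9), (Y12, X8, Step 1 X1 Y10 Y13 X8), (Y13, X7, Base),
     (H1, Y10, Step 4 X9 Y10 H1 Y3), (H2, Y10, Step 4 X6 Y10 H2 Y7),
     (H3, Y10, Step 5 Y6 Y7 H3 Y10)]"
| "derivation Y11 = [
     (Y12, X6, Step 2 X1 Y11 Y13 X6), (Y13, X5, Step 1 X3 Y11 Y13 X7),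
     (H1, Y11, Step 4 X10 Y11 H1 Y3), (H2, Y11, Step 5 Y3 Y10 H2 Y11),
     (H3, Y11, Step 6 X2 Y12 H3 Y11)]"
| "derivation Y12 = [
     (Y13, X3, Step 1 X5 Y12 Y13 X7), (H1, Y12, Step 5 Y2 Y11 H1 Y12),
     (H2, Y12, Step 5 Y1 Y12 H2 Y13), (H3, Y12, Step 5 X13 Y12 H3 X1)]"
| "derivation Y13 = [
     (H1, Y13, Step 5 Y4 Y11 H1 Y13), (H2, Y13, Step 4 X2 Y2 Y13 Y13),
     (H3, Y13, Step 5 X12 Y13 H3 Y1)]"
| "derivation H1 = [
     (H2, H1, Step 2 X1 H1 H2 X1), (H2, H2, Step 1 X3 H1 H2 X3), (H2, H3, Step 1 X10 H1 H2 X10),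
     (H3, H1, Step 1 X3 Y3 H1 H1), (H3, H2, Step 1 X1 Y1 H3 H2), (H3, H3, Step 1 X1 Y1 H3 H3)]"
| "derivation H2 = [
     (H3, H1, Step 1 X13 H2 H3 X13), (H3, H2, Step 1 X3 H2 H3 X3), (H3, H3, Step 2 X2 H2 H3 X2)]"
| "derivation H3 = []"

fun level_in :: "(idx \<times> idx \<times> reason) list \<Rightarrow> idx \<Rightarrow> idx \<Rightarrow> nat option" where
  "level_in [] j k = None"
| "level_in ((j', k', r) # xs) j k =
     (if j' = j then if k' = k then Some (level r) else level_in xs j k else level_in xs j k)"

fun below :: "nat \<Rightarrow> nat option \<Rightarrow> bool" where
  "below n None = False"
| "below n (Some l) = (l < n)"

text \<open>The table only has entries for pairs in increasing order, so both orders are looked up.\<close>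

definition settled :: "nat \<Rightarrow> idx \<Rightarrow> idx \<Rightarrow> idx \<Rightarrow> bool" where
  "settled n i j k =
     (if i = j then True else if below n (level_in (derivation i) j k) then True
      else below n (level_in (derivation j) i k))"

fun pending :: "nat \<Rightarrow> (trit \<times> idx \<times> idx \<times> idx) list \<Rightarrow> (trit \<times> idx \<times> idx \<times> idx) list" where
  "pending n [] = []"
| "pending n ((t, i, j, k) # f) = (if settled n i j k then pending n f else (t, i, j, k) # pending n f)"

primrec justified :: "idx \<Rightarrow> idx \<Rightarrow> idx \<Rightarrow> reason \<Rightarrow> bool" where
  "justified a b m Base = ((a, b, m) \<in> set (normalized_triples @ pivots))"
| "justified a b m (Step n i j k l) = (case pending n (cocycle_equation (i, j, k, l)) of
     [(t, u)] \<Rightarrow> t \<noteq> Zero \<and> (u = (a, b, m) \<or> u = (b, a, m)) | _ \<Rightarrow> False)"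

fun justified_row :: "idx \<Rightarrow> (idx \<times> idx \<times> reason) list \<Rightarrow> bool" where
  "justified_row a [] = True"
| "justified_row a ((b, m, r) # xs) = (justified a b m r \<and> justified_row a xs)"

fun justified_rows :: "idx list \<Rightarrow> bool" where
  "justified_rows [] = True"
| "justified_rows (a # as) = (justified_row a (derivation a) \<and> justified_rows as)"

fun covers_third :: "idx \<Rightarrow> idx \<Rightarrow> idx list \<Rightarrow> bool" where
  "covers_third a b [] = True"
| "covers_third a b (m # ms) =
     (if weight_add (weight a) (weight b) = weight m
      then if level_in (derivation a) b m = None then False else covers_third a b ms
      else covers_third a b ms)"

fun covers_second :: "idx \<Rightarrow> idx list \<Rightarrow> bool" where
  "covers_second a [] = True"
| "covers_second a (b # bs) = (covers_third a b all_idx \<and> covers_second a bs)"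

fun covers_first :: "idx list \<Rightarrow> bool" where
  "covers_first [] = True"
| "covers_first (a # as) = (covers_second a as \<and> covers_first as)"

lemma derivation_justified: "justified_rows all_idx"
  by code_simp

lemma derivation_covers: "covers_first all_idx"
  by code_simp

definition zero_on :: "(idx \<times> idx \<times> idx) list \<Rightarrow> (idx \<Rightarrow> idx \<Rightarrow> idx \<Rightarrow> 'k::field) \<Rightarrow> bool" where
  "zero_on Z C \<longleftrightarrow> (\<forall>(i, j, k)\<in>set Z. C i j k = 0)"

lemma zero_onD: "zero_on Z C \<Longrightarrow> (i, j, k) \<in> set Z \<Longrightarrow> C i j k = 0"
  by (fastforce simp: zero_on_def)

lemma level_in_SomeD: "level_in xs j k = Some l \<Longrightarrow> \<exists>r. (j, k, r) \<in> set xs \<and> level r = l"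
  by (induction xs j k rule: level_in.induct) (auto split: if_splits)

lemma below_level_inD: "below n (level_in xs j k) \<Longrightarrow> \<exists>r. (j, k, r) \<in> set xs \<and> level r < n"
  by (cases "level_in xs j k") (auto dest: level_in_SomeD)

lemma justified_rowD: "justified_row a xs \<Longrightarrow> (b, m, r) \<in> set xs \<Longrightarrow> justified a b m r"
  by (induction a xs rule: justified_row.induct) auto

lemma justified_rowsD: "justified_rows as \<Longrightarrow> a \<in> set as \<Longrightarrow> justified_row a (derivation a)"
  by (induction as) auto

lemma derivation_sound:
  fixes C :: "idx \<Rightarrow> idx \<Rightarrow> idx \<Rightarrow> 'k::field"
  assumes alt: "alternating C" and defect: "\<And>a b d m. cocycle_defect structure_const C a b d m = 0"
    and base: "zero_on (normalized_triples @ pivots) C"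
  shows "(b, m, r) \<in> set (derivation a) \<Longrightarrow> C a b m = 0"
proof (induction "level r" arbitrary: a b m r rule: less_induct)
  case less
  have just: "justified a b m r"
    by (rule justified_rowD[OF justified_rowsD[OF derivation_justified] less.prems])
      (simp add: set_all_idx)
  have swap: "C i j k = - C j i k" for i j k
    using alt unfolding alternating_def by blast
  have zero: "C i j k = 0" if settled: "settled (level r) i j k" for i j k
  proof -
    consider "i = j" | r' where "(j, k, r') \<in> set (derivation i)" "level r' < level r"
      | r' where "(i, k, r') \<in> set (derivation j)" "level r' < level r"
      using settled below_level_inD unfolding settled_def by (metis (full_types))
    then show ?thesis
    proof cases
      case 1
      then show ?thesis
        using alt unfolding alternating_def by blast
    next
      case 2
      then show ?thesis
        using less.hyps by blast
    next
      case 3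
      then have "C j i k = 0"
        using less.hyps by blast
      then show ?thesis
        by (subst swap) simp
    qed
  qed
  show ?case
  proof (cases r)
    case Base
    then show ?thesis
      using just zero_onD[OF base, of a b m] by simp
  next
    case (Step n i j k l)
    let ?f = "cocycle_equation (i, j, k, l)"
    have "form_value (pending n f) C = form_value f C" for f
    proof (induction f)
      case (Cons p f)
      then show ?case
        using zero Step by (cases p) auto
    qed simp
    then have "form_value (pending n ?f) C = 0"
      by (simp only: form_value_cocycle_equation defect)
    moreover obtain t u where "pending n ?f = [(t, u)]" "t \<noteq> Zero" "u = (a, b, m) \<or> u = (b, a, m)"
      using just Step by (cases "pending n ?f"; cases "tl (pending n ?f)") (auto split: prod.splits)
    ultimately show ?thesis
      using swap[of a b m] by auto
  qed
qed

lemma covers_third_sound: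
  "covers_third a b ms \<Longrightarrow>
   list_all (\<lambda>m. weight_add (weight a) (weight b) = weight m \<longrightarrow> level_in (derivation a) b m \<noteq> None) ms"
  by (induction ms) (auto split: if_splits)

lemma covers_second_sound:
  "covers_second a bs \<Longrightarrow> list_all (\<lambda>b. \<forall>m. weight_add (weight a) (weight b) = weight m \<longrightarrow>
     level_in (derivation a) b m \<noteq> None) bs"
  by (induction bs) (use covers_third_sound[of a _ all_idx] in \<open>auto simp: list_all_iff set_all_idx\<close>)

lemma covers_first_sound:
  "covers_first as \<Longrightarrow> ordered_pairs (\<lambda>a b. \<forall>m. weight_add (weight a) (weight b) = weight m \<longrightarrow>
     level_in (derivation a) b m \<noteq> None) as"
  by (induction as) (use covers_second_sound in auto)

lemma ordered_pairs_mono: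
  "ordered_pairs P xs \<Longrightarrow> (\<And>a b. P a b \<Longrightarrow> Q a b) \<Longrightarrow> ordered_pairs Q xs"
  by (induction xs) (auto simp: list_all_iff)

context char3_field
begin

lemma weight_zero_cocycle_vanishes:
  assumes c: "(c :: 'k br3 \<Rightarrow> _) \<in> br3.Z2"
    and weight: "\<And>a b m. weight_add (weight a) (weight b) \<noteq> weight m \<Longrightarrow> cochain_coord c a b m = 0"
    and normalized: "zero_on normalized_triples (cochain_coord c)" and pivots: "zero_on pivots (cochain_coord c)"
  shows "c = 0"
proof -
  let ?C = "cochain_coord c"
  have c2: "c \<in> br3.cochain2"
    using c by (simp add: br3.Z2_def)
  note alt = cochain_coord_alternating[OF c2]
  have defect: "cocycle_defect structure_const ?C a b d m = 0" for a b d m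
    using c Z2_iff_cocycle_defect[OF c2] by blast
  have base: "zero_on (normalized_triples @ pivots) ?C"
    using normalized pivots by (auto simp: zero_on_def)
  have "\<forall>m. ?C a b m = 0" for a b
  proof (rule ordered_pairs_all[of "\<lambda>a b. \<forall>m. ?C a b m = 0" all_idx])
    have "?C a b m = 0" if "weight_add (weight a) (weight b) = weight m \<longrightarrow> level_in (derivation a) b m \<noteq> None"
      for a b m
    proof (cases "weight_add (weight a) (weight b) = weight m")
      case True
      then obtain r where "(b, m, r) \<in> set (derivation a)"
        using \<open>_ \<longrightarrow> _\<close> by (auto dest: level_in_SomeD)
      then show ?thesis
        by (rule derivation_sound[OF alt defect base])
    qed (rule weight)
    then show "ordered_pairs (\<lambda>a b. \<forall>m. ?C a b m = 0) all_idx"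
      by (intro ordered_pairs_mono[OF covers_first_sound[OF derivation_covers]]) blast
    show "\<forall>m. ?C b a m = 0" if zero: "\<forall>m. ?C a b m = 0" for a b
    proof
      fix m
      have "?C b a m = - ?C a b m"
        using alt unfolding alternating_def by blast
      then show "?C b a m = 0"
        using zero by simp
    qed
    show "\<forall>m. ?C a a m = 0" for a
      using alt unfolding alternating_def by blast
  qed (simp_all add: set_all_idx)
  then show ?thesis
    by (intro cochain2_eqI c2 zero_cochain2) (simp add: cochain_coord_def)
qed

lemma linear_map_of_matrix:
  fixes \<phi> :: "idx \<Rightarrow> idx \<Rightarrow> 'k"
  obtains f :: "'k br3 \<Rightarrow> 'k br3"
  where "f \<in> br3.cochain1" "\<And>i m. coord (f (basis_vec i)) m = \<phi> i m"
proof
  define f where "f X = (\<Sum>m\<in>UNIV. br3_scl (\<Sum>i\<in>UNIV. coord X i * \<phi> i m) (basis_vec m))" for X :: "'k br3"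
  have coord_f: "coord (f X) m = (\<Sum>i\<in>UNIV. coord X i * \<phi> i m)" for X m
  proof -
    have "coord (f X) m = (\<Sum>j\<in>UNIV. unit m j * (\<Sum>i\<in>UNIV. coord X i * \<phi> i j))"
      unfolding f_def coord_sum coord_scl coord_basis_vec by (intro sum.cong refl) (auto simp: unit_apply)
    then show ?thesis by simp
  qed
  show "f \<in> br3.cochain1"
    unfolding br3.cochain1_iff
    by (intro conjI allI br3_eqI)
      (simp_all only: coord_f coord_add coord_scl distrib_right sum.distrib mult.assoc flip: sum_distrib_left)
  show "coord (f (basis_vec i)) m = \<phi> i m" for i m
    by (simp only: coord_f coord_basis_vec sum_unit_mult)
qed

lemma cochain_coord_d1:
  assumes "(f :: 'k br3 \<Rightarrow> _) \<in> br3.cochain1" and \<phi>: "\<And>i m. coord (f (basis_vec i)) m = \<phi> i m"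
  shows "cochain_coord (br3.d1 f) a b m = combination (preimages m (structure_row a)) (\<phi> b)
    - combination (preimages m (structure_row b)) (\<phi> a)
    - combination (entries b (structure_row a)) (\<lambda>k. \<phi> k m)"
proof -
  have "coord (f (br3_br (basis_vec a) (basis_vec b))) m
      = (\<Sum>k\<in>UNIV. coord (br3_br (basis_vec a) (basis_vec b)) k * coord (f (basis_vec k)) m)"
    using assms(1) by (intro coord_linear) (simp_all add: br3.cochain1_iff)
  then show ?thesis
    by (simp add: cochain_coord_def br3.d1_def coord_diff coord_br_basis_vec coord_br_basis_vec_basis_vec
        \<phi> combination_preimages combination_row)
qed

text \<open>On the root vectors \<open>f\<close> is diagonal with entries \<open>t\<close>, so that the coboundary has the coordinate
  \<open>N (t\<^sub>a + t\<^sub>b - t\<^sub>k)\<close> at a bracket \<open>[e\<^sub>a, e\<^sub>b] = N e\<^sub>k\<close> of root vectors. With \<open>t = 0\<close> at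
  \<open>x\<^sub>1, x\<^sub>2, x\<^sub>3\<close>, the defining brackets, where \<open>N = 1\<close>, determine \<open>t\<close> recursively. The values of \<open>f\<close>
  on the \<open>h\<^sub>i\<close> are prescribed by their action on the simple root vectors; the matrix \<open>h\<close> is obtained from
  the prescribed values by the inverse of the Cartan matrix modulo 3. The coordinates at \<open>[x\<^sub>i, y\<^sub>i] = h\<^sub>i\<close> then
  determine \<open>t\<close> at \<open>y\<^sub>1, y\<^sub>2, y\<^sub>3\<close>.\<close>

lemma coboundary_normalization:
  fixes C :: "idx \<Rightarrow> idx \<Rightarrow> idx \<Rightarrow> 'k"
  obtains f :: "'k br3 \<Rightarrow> 'k br3"
  where "f \<in> br3.cochain1"
    "\<And>a b m. (a, b, m) \<in> set normalized_triples \<Longrightarrow> cochain_coord (br3.d1 f) a b m = C a b m"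
proof -
  define h where "h i = (\<lambda>m. case m of H1 \<Rightarrow> C X1 i X1 - C X3 i X3 | H2 \<Rightarrow> C X3 i X3
    | H3 \<Rightarrow> C X2 i X2 - C X1 i X1 | _ \<Rightarrow> 0)" for i
  define x4 where "x4 = - C X1 X2 X4"
  define x5 where "x5 = - C X2 X3 X5"
  define x6 where "x6 = x4 - C X3 X4 X6"
  define x7 where "x7 = x5 - C X3 X5 X7"
  define x8 where "x8 = x6 - C X3 X6 X8"
  define x9 where "x9 = x5 + x6 - C X5 X6 X9"
  define x10 where "x10 = x6 + x7 - C X6 X7 X10"
  define x11 where "x11 = x7 + x8 - C X7 X8 X11"
  define x12 where "x12 = x7 + x9 - C X7 X9 X12"
  define x13 where "x13 = x8 + x9 - C X8 X9 X13"
  define y1 where "y1 = C X1 Y1 H1 + h H1 H1"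
  define y2 where "y2 = C X2 Y2 H2 + h H2 H2"
  define y3 where "y3 = C X3 Y3 H3 + h H3 H3"
  define y4 where "y4 = y1 + y2 - C Y1 Y2 Y4"
  define y5 where "y5 = y2 + y3 - C Y2 Y3 Y5"
  define y6 where "y6 = y3 + y4 - C Y3 Y4 Y6"
  define y7 where "y7 = y3 + y5 - C Y3 Y5 Y7"
  define y8 where "y8 = y3 + y6 - C Y3 Y6 Y8"
  define y9 where "y9 = y5 + y6 - C Y5 Y6 Y9"
  define y10 where "y10 = y6 + y7 - C Y6 Y7 Y10"
  define y11 where "y11 = y7 + y8 - C Y7 Y8 Y11"
  define y12 where "y12 = y7 + y9 - C Y7 Y9 Y12"
  define y13 where "y13 = y8 + y9 - C Y8 Y9 Y13"
  note defs = x4_def x5_def x6_def x7_def x8_def x9_def x10_def x11_def x12_def x13_def y1_def y2_def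
    y3_def y4_def y5_def y6_def y7_def y8_def y9_def y10_def y11_def y12_def y13_def h_def
  define t where "t = (\<lambda>i. case i of X1 \<Rightarrow> 0 | X2 \<Rightarrow> 0 | X3 \<Rightarrow> 0 | X4 \<Rightarrow> x4 | X5 \<Rightarrow> x5 | X6 \<Rightarrow> x6 | X7 \<Rightarrow> x7
    | X8 \<Rightarrow> x8 | X9 \<Rightarrow> x9 | X10 \<Rightarrow> x10 | X11 \<Rightarrow> x11 | X12 \<Rightarrow> x12 | X13 \<Rightarrow> x13 | Y1 \<Rightarrow> y1 | Y2 \<Rightarrow> y2
    | Y3 \<Rightarrow> y3 | Y4 \<Rightarrow> y4 | Y5 \<Rightarrow> y5 | Y6 \<Rightarrow> y6 | Y7 \<Rightarrow> y7 | Y8 \<Rightarrow> y8 | Y9 \<Rightarrow> y9 | Y10 \<Rightarrow> y10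
    | Y11 \<Rightarrow> y11 | Y12 \<Rightarrow> y12 | Y13 \<Rightarrow> y13 | _ \<Rightarrow> 0)"
  define \<phi> where "\<phi> i m = (if i = H1 \<or> i = H2 \<or> i = H3 then h i m else if m = i then t i else 0)" for i m
  obtain f :: "'k br3 \<Rightarrow> 'k br3"
    where f: "f \<in> br3.cochain1" "\<And>i m. coord (f (basis_vec i)) m = \<phi> i m"
    using linear_map_of_matrix[of \<phi>] by blast
  have "list_all (\<lambda>(a, b, m). cochain_coord (br3.d1 f) a b m = C a b m) normalized_triples"
    by (simp add: normalized_triples_def cochain_coord_d1[OF f] \<phi>_def t_def defs)
  then have "\<And>a b m. (a, b, m) \<in> set normalized_triples \<Longrightarrow> cochain_coord (br3.d1 f) a b m = C a b m"
    by (auto simp: list_all_iff)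
  with f(1) show ?thesis
    by (rule that)
qed

lemma tval_trit_coef: "tval (trit_coef r j m) = (row_coef r j m :: 'k)"
  by (induction r j m rule: trit_coef.induct) auto

lemma pivots_length: "length pivots = 8"
  by (simp add: pivots_def)

lemma class_terms_pivots:
  assumes "s < 8" "t < 8" "pivots ! t = (a, b, m)"
  shows "cochain_coord (cochain_of_terms (class_terms ! s)) a b m = (if s = t then 1 else 0 :: 'k)"
proof -
  have len: "length class_terms = 8"
    by (simp add: class_terms_def)
  have "map (\<lambda>L. map (\<lambda>(a, b, m). trit_coef (wedge_row L a) b m) pivots) class_terms ! s ! t
      = map (\<lambda>s. map (\<lambda>t. if s = t then Pos else Zero) [0..<8]) [0..<8] ! s ! t"
    by (simp only: pivot_test)
  then have "trit_coef (wedge_row (class_terms ! s) a) b m = (if s = t then Pos else Zero)"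
    using assms by (simp add: len pivots_length)
  then show ?thesis
    by (simp add: cochain_coord_of_terms flip: tval_trit_coef)
qed

lemma class_terms_normalized:
  assumes "s < 8" "(a, b, m) \<in> set normalized_triples"
  shows "cochain_coord (cochain_of_terms (class_terms ! s)) a b m = (0 :: 'k)"
proof -
  have "class_terms ! s \<in> set class_terms"
    using assms(1) by (intro nth_mem) (simp add: class_terms_def)
  then have "trit_coef (wedge_row (class_terms ! s) a) b m = Zero"
    using normalized_test assms(2) by (auto simp: list_all_iff)
  then show ?thesis
    by (simp add: cochain_coord_of_terms flip: tval_trit_coef)
qed

lemma cochain_coord_sum:
  "cochain_coord (\<Sum>s\<in>I. f s) a b m = (\<Sum>s\<in>I. cochain_coord (f s) a b m :: 'k)"
proof (induction I rule: infinite_finite_induct)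
  case (insert s I)
  show ?case
    by (simp only: sum.insert[OF insert.hyps] cochain_coord_add insert.IH)
qed (simp_all add: cochain_coord_def)

lemma class_terms_eq:
  "{c_m18, c_m9, c_m6, c_m3, act_cochain br3_omega c_m18, act_cochain br3_omega c_m9,
    act_cochain br3_omega c_m6, act_cochain br3_omega c_m3}
    = (cochain_of_terms ` set class_terms :: ('k br3 \<Rightarrow> _) set)"
  by (simp only: cocycles_of_terms act_omega_of_terms class_terms_def list.set image_insert image_empty)

lemma class_terms_Z2: "cochain_of_terms ` set class_terms \<subseteq> (br3.Z2 :: ('k br3 \<Rightarrow> _) set)"
  unfolding class_terms_eq[symmetric]
  by (intro insert_subsetI empty_subsetI omega_cocycles_Z2 cocycles_Z2)

text \<open>After subtraction of a coboundary and of a combination of the eight cocycles, the weight 0 part is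
  normalized and vanishes at the pivots, hence is zero. The projection to weight 0 may be taken last because it
  leaves the normalized coordinates and the pivots, which have weight 0, unchanged.\<close>

lemma cocycle_mod_coboundary:
  assumes c: "(c :: 'k br3 \<Rightarrow> _) \<in> br3.Z2"
  shows "\<exists>s\<in>module.span br3.cochain_scl (cochain_of_terms ` set class_terms). c - s \<in> br3.B2"
proof -
  interpret cochains: vector_space "br3.cochain_scl :: 'k \<Rightarrow> _"
    by (rule br3.vector_space_cochain_scl)
  obtain f :: "'k br3 \<Rightarrow> 'k br3" where f: "f \<in> br3.cochain1"
    and f_norm: "\<And>a b m. (a, b, m) \<in> set normalized_triples \<Longrightarrow>
      cochain_coord (br3.d1 f) a b m = cochain_coord c a b m"
    using coboundary_normalization[of "cochain_coord c"] by blast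
  have d1: "br3.d1 f \<in> br3.B2"
    using f by (simp add: br3.B2_def)
  define c1 where "c1 = c - br3.d1 f"
  define e where "e = (\<lambda>s. case pivots ! s of (a, b, m) \<Rightarrow> cochain_coord c1 a b m)"
  let ?rep = "\<lambda>s. cochain_of_terms (class_terms ! s) :: 'k br3 \<Rightarrow> _"
  define r where "r = (\<Sum>s<8::nat. br3.cochain_scl (e s) (?rep s))"
  have mem: "class_terms ! s \<in> set class_terms" if "s < 8" for s
    using that by (intro nth_mem) (simp add: class_terms_def)
  have r_span: "r \<in> cochains.span (cochain_of_terms ` set class_terms)"
    unfolding r_def by (intro cochains.span_sum cochains.span_scale cochains.span_base imageI mem) simp
  have "r \<in> br3.Z2"
    using cochains.span_minimal[OF class_terms_Z2 br3.subspace_Z2] r_span by blast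
  have r_coord: "cochain_coord r a b m = (\<Sum>s<8::nat. e s * cochain_coord (?rep s) a b m)" for a b m
    by (simp only: r_def cochain_coord_sum cochain_coord_scl)
  define c2 where "c2 = c1 - r"
  have c2: "c2 \<in> br3.Z2"
    unfolding c2_def c1_def using c d1 br3.B2_subset_Z2 \<open>r \<in> br3.Z2\<close> by (intro br3.Z2_diff) auto
  have "zero_on normalized_triples (cochain_coord c2)"
    by (auto simp: zero_on_def c2_def c1_def cochain_coord_diff f_norm r_coord class_terms_normalized
        simp del: fun_diff_def minus_apply)
  moreover have "zero_on pivots (cochain_coord c2)"
    unfolding zero_on_def
  proof (intro ballI, clarify)
    fix a b m
    assume "(a, b, m) \<in> set pivots"
    then obtain t where t: "t < 8" "pivots ! t = (a, b, m)"
      by (auto simp: in_set_conv_nth pivots_length)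
    have "cochain_coord r a b m = (\<Sum>s<8::nat. e s * (if s = t then 1 else 0))"
      unfolding r_coord using t by (intro sum.cong refl) (simp add: class_terms_pivots)
    also have "\<dots> = e t"
      using t(1) by (simp add: if_distrib[of "(*) _"] sum.delta cong: if_cong)
    finally show "cochain_coord c2 a b m = 0"
      by (simp only: c2_def cochain_coord_diff) (simp add: e_def t(2))
  qed
  moreover obtain c3 where c3: "c3 \<in> br3.Z2" "c2 - c3 \<in> br3.B2"
    "\<And>a b m. cochain_coord c3 a b m
       = (if weight_add (weight a) (weight b) = weight m then cochain_coord c2 a b m else 0)"
    using weight_zero_part[OF c2] by blast
  ultimately have "c3 = 0"
    by (intro weight_zero_cocycle_vanishes) (auto simp: zero_on_def)
  then have "c2 \<in> br3.B2"
    using c3(2) by (simp only: diff_0_right)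
  then have "c2 + br3.d1 f \<in> br3.B2"
    using d1 by (rule br3.B2_add)
  moreover have "c2 + br3.d1 f = c - r"
    by (simp add: c2_def c1_def fun_eq_iff)
  ultimately show ?thesis
    using r_span by (intro bexI[of _ r]) simp_all
qed

end

theorem lemma7p1:
  assumes char3: "CHAR('k::alg_closed_field) = 3"
  shows "br3.dim (UNIV :: 'k br3 set) = 29
    \<and> distinct (br3_basis :: 'k br3 list)
    \<and> br3.independent (set (br3_basis :: 'k br3 list))
    \<and> br3.span (set (br3_basis :: 'k br3 list)) = UNIV
    \<and> (let S = {c_m18, c_m9, c_m6, c_m3,
                act_cochain br3_omega c_m18, act_cochain br3_omega c_m9,
                act_cochain br3_omega c_m6, act_cochain br3_omega c_m3}
               :: ('k br3 \<Rightarrow> 'k br3 \<Rightarrow> 'k br3) set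
       in S \<subseteq> br3.Z2 \<and> br3.H2 = br3.class_span S)"
proof -
  interpret char3_field "TYPE('k)"
    by unfold_locales (rule char3)
  show ?thesis
    unfolding Let_def class_terms_eq
    by (intro conjI dim_br3 distinct_br3_basis independent_br3_basis span_br3_basis class_terms_Z2
        br3.H2_eq_class_span cocycle_mod_coboundary)
qed

end
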